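(* Let $\mathcal R$ be a pmp equivalence relation on a standard probability space $(X,\mu)$, and let $T\in[\mathcal R]$ have infinite order. Then for all $n\in\mathbb N$ the following hold. (1) The set of $n$-tuples $(U_1,\dots,U_n)$ of elements of $[\mathcal R]$ such that $\langle T,U_1,\dots,U_n\rangle\simeq\mathbb F_{n+1}$ is a dense $G_\delta$ subset of $[\mathcal R]^n$. (2) If furthermore $\mathcal R$ is aperiodic, then the set of $n$-tuples $(U_1,\dots,U_n)$ of aperiodic elements of $[\mathcal R]$ such that $\langle T,U_1,\dots,U_n\rangle\simeq\mathbb F_{n+1}$ is a dense $G_\delta$ subset of $([\mathcal R]\cap\mathrm{APER})^n$.
   Context: Everything is understood modulo null sets. $(X,\mu)$ is a standard (atomless) probability space; $\mathrm{Aut}(X,\mu)$ is the group of measure-preserving Borel bijections of $X$ up to null sets. A pmp equivalence relation is the orbit equivalence relation of a measure-preserving action of a countable group on $(X,\mu)$; it is aperiodic if almost all its classes are infinite. The full group is $[\mathcal R]=\{T\in\mathrm{Aut}(X,\mu): T(x)\,\mathcal R\,x \text{ for a.e. } x\}$, with the topology of the uniform metric $d_u(T,T')=\mu(\{x:T(x)\neq T'(x)\})$. An element of $\mathrm{Aut}(X,\mu)$ is aperiodic if almost all its orbits are infinite; $\mathrm{APER}$ denotes the set of aperiodic elements. $\mathbb F_{k}$ is the free group on $k$ generators. *)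

theory Defs
  imports
    "HOL-Probability.Probability"
    "HOL-Algebra.Group_Action"
    "HOL-Algebra.Elementary_Groups"
begin

definition standard_borel :: "'a measure \<Rightarrow> bool" where
  "standard_borel M \<longleftrightarrow>
     (\<exists>X. topspace X = space M \<and> completely_metrizable_space X \<and> separable_space X \<and>
          sets M = sigma_sets (space M) {U. openin X U})"

definition atomless :: "'a measure \<Rightarrow> bool" where
  "atomless M \<longleftrightarrow>
     (\<forall>A \<in> sets M. emeasure M A > 0 \<longrightarrow>
        (\<exists>B \<in> sets M. B \<subseteq> A \<and> 0 < emeasure M B \<and> emeasure M B < emeasure M A))"

definition standard_prob_space :: "'a measure \<Rightarrow> bool" where
  "standard_prob_space M \<longleftrightarrow> prob_space M \<and> standard_borel M \<and> atomless M"

text \<open>Measure-preserving Borel bijections as honest functions, not yet identified modulo null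
  sets. Measurability of the inverse, automatic on standard Borel spaces by the Lusin--Souslin
  theorem, is part of the definition, so that this is a group for every \<open>M\<close>.\<close>

definition mp_bij :: "'a measure \<Rightarrow> ('a \<Rightarrow> 'a) monoid" where
  "mp_bij M = BijGroup (space M) \<lparr>carrier :=
     {f \<in> Bij (space M). f \<in> measurable M M \<and> inv_into (space M) f \<in> measurable M M \<and>
                         distr M M f = M}\<rparr>"

definition null_bij :: "'a measure \<Rightarrow> ('a \<Rightarrow> 'a) set" where
  "null_bij M = {f \<in> carrier (mp_bij M). AE x in M. f x = x}"

lemma carrier_mp_bij: "carrier (mp_bij M) =
    {f \<in> Bij (space M). f \<in> measurable M M \<and> inv_into (space M) f \<in> measurable M M \<and>
                        distr M M f = M}"
  by (simp add: mp_bij_def)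

lemma subgroup_mp_bij: "subgroup (carrier (mp_bij M)) (BijGroup (space M))"
proof -
  interpret B: group "BijGroup (space M)" by (rule group_BijGroup)
  have m: "g \<otimes>\<^bsub>BijGroup (space M)\<^esub> f = compose (space M) g f"
    if "g \<in> Bij (space M)" "f \<in> Bij (space M)" for f g
    using that by (simp add: BijGroup_def)
  show ?thesis
  proof (rule B.subgroupI)
    show "carrier (mp_bij M) \<subseteq> carrier (BijGroup (space M))"
      by (auto simp: carrier_mp_bij BijGroup_def)
    have "inv_into (space M) (\<lambda>x\<in>space M. x) x = x" if "x \<in> space M" for x
      using that by (metis (no_types, lifting) f_inv_into_f image_eqI inv_into_into restrict_apply)
    then have "(\<lambda>x\<in>space M. x) \<in> carrier (mp_bij M)"
      by (auto simp: carrier_mp_bij id_Bij cong: measurable_cong distr_cong)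
    then show "carrier (mp_bij M) \<noteq> {}" by blast
  next
    fix f assume "f \<in> carrier (mp_bij M)"
    then have f: "f \<in> Bij (space M)" "f \<in> measurable M M" "inv_into (space M) f \<in> measurable M M"
      "distr M M f = M" by (auto simp: carrier_mp_bij)
    then have b: "bij_betw f (space M) (space M)" by (simp add: Bij_def)
    let ?g = "restrict (inv_into (space M) f) (space M)"
    have eq: "inv\<^bsub>BijGroup (space M)\<^esub> f = ?g" by (rule inv_BijGroup[OF f(1)])
    have g: "?g \<in> Bij (space M)" by (rule restrict_inv_into_Bij[OF f(1)])
    have gm: "?g \<in> measurable M M" using f(3) by (simp cong: measurable_cong)
    have "inv_into (space M) ?g x = f x" if "x \<in> space M" for x
    proof (rule inv_into_f_eq)
      show "inj_on ?g (space M)" using g by (simp add: Bij_def bij_betw_def)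
      show "f x \<in> space M" "?g (f x) = x" using that b
        by (auto simp: bij_betw_def)
    qed
    then have im: "inv_into (space M) ?g \<in> measurable M M" using f(2) by (simp cong: measurable_cong)
    have "distr M M ?g = distr (distr M M f) M ?g" by (simp add: f(4))
    also have "\<dots> = distr M M (?g \<circ> f)" by (rule distr_distr[OF gm f(2)])
    also have "\<dots> = distr M M (\<lambda>x. x)"
      by (rule distr_cong) (use b in \<open>auto simp: bij_betw_def\<close>)
    finally have "distr M M ?g = M" by (simp add: distr_id2)
    then show "inv\<^bsub>BijGroup (space M)\<^esub> f \<in> carrier (mp_bij M)"
      using g gm im by (simp add: eq carrier_mp_bij)
  next
    fix g f assume "g \<in> carrier (mp_bij M)" "f \<in> carrier (mp_bij M)"
    then have f: "f \<in> Bij (space M)" "f \<in> measurable M M" "inv_into (space M) f \<in> measurable M M"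
      "distr M M f = M" and g: "g \<in> Bij (space M)" "g \<in> measurable M M"
      "inv_into (space M) g \<in> measurable M M" "distr M M g = M" by (auto simp: carrier_mp_bij)
    let ?h = "compose (space M) g f"
    have bf: "bij_betw f (space M) (space M)" and bg: "bij_betw g (space M) (space M)"
      using f g by (auto simp: Bij_def)
    have h: "?h \<in> Bij (space M)" by (rule compose_Bij[OF g(1) f(1)])
    have hm: "?h \<in> measurable M M"
    proof -
      have "g \<circ> f \<in> measurable M M" using f(2) g(2) by (rule measurable_comp)
      then show ?thesis by (subst measurable_cong[where g = "g \<circ> f"]) (auto simp: compose_def)
    qed
    have "inv_into (space M) ?h y = (inv_into (space M) f \<circ> inv_into (space M) g) y"
      if "y \<in> space M" for y
    proof (rule inv_into_f_eq)
      show "inj_on ?h (space M)" using h by (simp add: Bij_def bij_betw_def)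
      have y: "inv_into (space M) g y \<in> space M" "g (inv_into (space M) g y) = y"
        using bg that by (auto simp: bij_betw_def intro: inv_into_into f_inv_into_f)
      have z: "inv_into (space M) f (inv_into (space M) g y) \<in> space M"
        "f (inv_into (space M) f (inv_into (space M) g y)) = inv_into (space M) g y"
        using bf y(1) by (auto simp: bij_betw_def intro!: inv_into_into f_inv_into_f)
      show "(inv_into (space M) f \<circ> inv_into (space M) g) y \<in> space M" using z by simp
      show "?h ((inv_into (space M) f \<circ> inv_into (space M) g) y) = y"
        using y z by (simp add: compose_def)
    qed
    then have im: "inv_into (space M) ?h \<in> measurable M M"
      using measurable_comp[OF g(3) f(3)] by (subst measurable_cong) auto
    have "distr M M ?h = distr M M (g \<circ> f)"
      by (rule distr_cong) (auto simp: compose_def)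
    also have "\<dots> = distr (distr M M f) M g" by (rule distr_distr[symmetric, OF g(2) f(2)])
    finally have "distr M M ?h = M" by (simp add: f(4) g(4))
    then show "g \<otimes>\<^bsub>BijGroup (space M)\<^esub> f \<in> carrier (mp_bij M)"
      using h hm im by (simp add: m[OF g(1) f(1)] carrier_mp_bij)
  qed
qed

lemma group_mp_bij: "group (mp_bij M)"
proof -
  have "mp_bij M = BijGroup (space M) \<lparr>carrier := carrier (mp_bij M)\<rparr>" by (simp add: mp_bij_def)
  then show ?thesis
    using subgroup.subgroup_is_group[OF subgroup_mp_bij group_BijGroup] by metis
qed

lemma mult_mp_bij:
  assumes "g \<in> carrier (mp_bij M)" "f \<in> carrier (mp_bij M)" "x \<in> space M"
  shows "(g \<otimes>\<^bsub>mp_bij M\<^esub> f) x = g (f x)"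
  using assms by (simp add: mp_bij_def BijGroup_def compose_def)

lemma AE_mp_bij:
  assumes f: "f \<in> carrier (mp_bij M)" and P: "AE x in M. P x"
  shows "AE x in M. P (f x)"
proof -
  from P obtain N where N: "{x \<in> space M. \<not> P x} \<subseteq> N" "N \<in> sets M" "emeasure M N = 0"
    by (rule AE_E)
  have m: "f \<in> measurable M M" "distr M M f = M" using f by (auto simp: carrier_mp_bij)
  have "emeasure M (f -` N \<inter> space M) = 0"
    using emeasure_distr[OF m(1) N(2)] m(2) N(3) by simp
  moreover have "{x \<in> space M. \<not> P (f x)} \<subseteq> f -` N \<inter> space M"
    using N(1) measurable_space[OF m(1)] by auto
  ultimately show ?thesis using measurable_sets[OF m(1) N(2)] by (intro AE_I)
qed

lemma normal_null_bij: "null_bij M \<lhd> mp_bij M"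
proof -
  interpret G: group "mp_bij M" by (rule group_mp_bij)
  have inv: "(inv\<^bsub>mp_bij M\<^esub> f) (f x) = x" "f ((inv\<^bsub>mp_bij M\<^esub> f) x) = x"
    if "f \<in> carrier (mp_bij M)" "x \<in> space M" for f x
  proof -
    have one: "\<one>\<^bsub>mp_bij M\<^esub> x = x" using that by (simp add: mp_bij_def BijGroup_def)
    show "(inv\<^bsub>mp_bij M\<^esub> f) (f x) = x"
      using mult_mp_bij[of "inv\<^bsub>mp_bij M\<^esub> f" M f x] that one by simp
    show "f ((inv\<^bsub>mp_bij M\<^esub> f) x) = x"
      using mult_mp_bij[of f M "inv\<^bsub>mp_bij M\<^esub> f" x] that one by simp
  qed
  have sub: "subgroup (null_bij M) (mp_bij M)"
  proof (rule G.subgroupI)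
    show "null_bij M \<subseteq> carrier (mp_bij M)" by (auto simp: null_bij_def)
    have "\<one>\<^bsub>mp_bij M\<^esub> \<in> null_bij M"
      by (auto simp: null_bij_def) (simp add: mp_bij_def BijGroup_def)
    then show "null_bij M \<noteq> {}" by blast
  next
    fix f assume f: "f \<in> null_bij M"
    then have c: "f \<in> carrier (mp_bij M)" and ae: "AE x in M. f x = x" by (auto simp: null_bij_def)
    have "AE x in M. (inv\<^bsub>mp_bij M\<^esub> f) x = x"
      using ae AE_space by eventually_elim (use inv[OF c] in metis)
    then show "inv\<^bsub>mp_bij M\<^esub> f \<in> null_bij M" using c by (simp add: null_bij_def)
  next
    fix g f assume "g \<in> null_bij M" "f \<in> null_bij M"
    then have c: "g \<in> carrier (mp_bij M)" "f \<in> carrier (mp_bij M)"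
      and ae: "AE x in M. g x = x" "AE x in M. f x = x" by (auto simp: null_bij_def)
    have "AE x in M. (g \<otimes>\<^bsub>mp_bij M\<^esub> f) x = x"
      using ae AE_space by eventually_elim (simp add: mult_mp_bij[OF c])
    then show "g \<otimes>\<^bsub>mp_bij M\<^esub> f \<in> null_bij M" using c by (simp add: null_bij_def)
  qed
  show ?thesis
  proof (rule G.normal_invI[OF sub])
    fix f h assume f: "f \<in> carrier (mp_bij M)" and "h \<in> null_bij M"
    then have h: "h \<in> carrier (mp_bij M)" and ae: "AE x in M. h x = x" by (auto simp: null_bij_def)
    have "AE x in M. h ((inv\<^bsub>mp_bij M\<^esub> f) x) = (inv\<^bsub>mp_bij M\<^esub> f) x"
      by (rule AE_mp_bij[OF _ ae]) (use f in simp)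
    then have "AE x in M. (f \<otimes>\<^bsub>mp_bij M\<^esub> h \<otimes>\<^bsub>mp_bij M\<^esub> inv\<^bsub>mp_bij M\<^esub> f) x = x"
      using AE_space
    proof eventually_elim
      case (elim x)
      have "(inv\<^bsub>mp_bij M\<^esub> f) x \<in> space M"
        using G.inv_closed[OF f] elim(2) by (auto simp: carrier_mp_bij measurable_space)
      then show ?case using elim f h inv(2)[OF f elim(2)] by (simp add: mult_mp_bij)
    qed
    then show "f \<otimes>\<^bsub>mp_bij M\<^esub> h \<otimes>\<^bsub>mp_bij M\<^esub> inv\<^bsub>mp_bij M\<^esub> f \<in> null_bij M"
      using f h by (simp add: null_bij_def)
  qed
qed

text \<open>An element of \<open>Aut(X, \<mu>)\<close> is a coset of \<^const>\<open>null_bij\<close>, that is, an almost everywhere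
  equality class of measure-preserving Borel bijections.\<close>

definition mp_aut :: "'a measure \<Rightarrow> ('a \<Rightarrow> 'a) set monoid" where
  "mp_aut M = mp_bij M Mod null_bij M"

lemma group_mp_aut: "group (mp_aut M)"
  unfolding mp_aut_def by (rule normal.factorgroup_is_group[OF normal_null_bij])

definition aut_class :: "'a measure \<Rightarrow> ('a \<Rightarrow> 'a) \<Rightarrow> ('a \<Rightarrow> 'a) set" where
  "aut_class M f = null_bij M #>\<^bsub>mp_bij M\<^esub> f"

text \<open>The uniform metric; its value does not depend on the chosen representatives.\<close>

definition dist_u :: "'a measure \<Rightarrow> ('a \<Rightarrow> 'a) set \<Rightarrow> ('a \<Rightarrow> 'a) set \<Rightarrow> real" where
  "dist_u M S T = measure M {x \<in> space M. (SOME f. f \<in> S) x \<noteq> (SOME g. g \<in> T) x}"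

definition uniform_topology :: "'a measure \<Rightarrow> ('a \<Rightarrow> 'a) set topology" where
  "uniform_topology M = Metric_space.mtopology (carrier (mp_aut M)) (dist_u M)"

definition APER :: "'a measure \<Rightarrow> ('a \<Rightarrow> 'a) set set" where
  "APER M = {aut_class M f | f. f \<in> carrier (mp_bij M) \<and>
               (AE x in M. infinite {(f [^]\<^bsub>mp_bij M\<^esub> k) x | k :: int. True})}"

text \<open>Every countable group is isomorphic to one whose carrier consists of natural numbers, so
  letting \<open>G\<close> range over \<^typ>\<open>nat monoid\<close> covers all countable groups.\<close>

definition pmp_equiv :: "'a measure \<Rightarrow> ('a \<times> 'a) set \<Rightarrow> bool" where
  "pmp_equiv M R \<longleftrightarrow>
     (\<exists>(G :: nat monoid) \<phi>. group_action G (space M) \<phi> \<and>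
        (\<forall>g \<in> carrier G. \<phi> g \<in> carrier (mp_bij M)) \<and>
        R = {(x, y). x \<in> space M \<and> y \<in> orbit G \<phi> x})"

definition aperiodic_rel :: "'a measure \<Rightarrow> ('a \<times> 'a) set \<Rightarrow> bool" where
  "aperiodic_rel M R \<longleftrightarrow> (AE x in M. infinite (R `` {x}))"

definition full_group :: "'a measure \<Rightarrow> ('a \<times> 'a) set \<Rightarrow> ('a \<Rightarrow> 'a) set set" where
  "full_group M R =
     {aut_class M f | f. f \<in> carrier (mp_bij M) \<and> (AE x in M. (f x, x) \<in> R)}"

text \<open>The letter \<open>(s, True)\<close> stands for the generator \<open>s\<close> and \<open>(s, False)\<close> for its inverse.
  Elements of the free group are the reduced words.\<close>

definition inv_letter :: "'s \<times> bool \<Rightarrow> 's \<times> bool" where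
  "inv_letter a = (fst a, \<not> snd a)"

definition reduced :: "('s \<times> bool) list \<Rightarrow> bool" where
  "reduced w \<longleftrightarrow> successively (\<lambda>a b. b \<noteq> inv_letter a) w"

fun cons_letter :: "'s \<times> bool \<Rightarrow> ('s \<times> bool) list \<Rightarrow> ('s \<times> bool) list" where
  "cons_letter a [] = [a]"
| "cons_letter a (b # w) = (if b = inv_letter a then w else a # b # w)"

definition free_group :: "'s set \<Rightarrow> ('s \<times> bool) list monoid" where
  "free_group S =
     \<lparr>carrier = {w. reduced w \<and> set w \<subseteq> S \<times> UNIV},
      mult = (\<lambda>v w. foldr cons_letter v w),
      one = []\<rparr>"

lemma reduced_Cons: "reduced (a # w) \<longleftrightarrow> reduced w \<and> (w = [] \<or> hd w \<noteq> inv_letter a)"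
  by (cases w) (auto simp: reduced_def)

lemma inv_letter_inv_letter [simp]: "inv_letter (inv_letter a) = a"
  by (simp add: inv_letter_def)

lemma reduced_cons_letter: "reduced w \<Longrightarrow> reduced (cons_letter a w)"
proof (cases w)
  case Nil
  then show ?thesis by (simp add: reduced_def)
next
  case (Cons b v)
  assume "reduced w"
  then show ?thesis using Cons by (auto simp: reduced_Cons)
qed

lemma set_cons_letter: "set (cons_letter a w) \<subseteq> insert a (set w)"
  by (cases w) auto

lemma cons_letter_cancel: "reduced w \<Longrightarrow> cons_letter a (cons_letter (inv_letter a) w) = w"
proof (cases w)
  case (Cons b v)
  assume "reduced w"
  then show ?thesis using Cons by (cases v) (auto simp: reduced_Cons)
qed simp

lemma reduced_foldr: "reduced w \<Longrightarrow> reduced (foldr cons_letter v w)"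
  by (induction v) (auto intro: reduced_cons_letter)

lemma set_foldr_cons_letter: "set (foldr cons_letter v w) \<subseteq> set v \<union> set w"
proof (induction v)
  case (Cons a v)
  then show ?case using set_cons_letter[of a "foldr cons_letter v w"] by auto
qed simp

lemma foldr_cons_letter_Nil: "reduced w \<Longrightarrow> foldr cons_letter w [] = w"
proof (induction w)
  case (Cons a w)
  then show ?case by (cases w) (auto simp: reduced_Cons)
qed simp

lemma foldr_foldr_cons_letter:
  assumes "reduced w"
  shows "foldr cons_letter (foldr cons_letter u v) w = foldr cons_letter u (foldr cons_letter v w)"
proof (induction u)
  case (Cons a u)
  have "foldr cons_letter (cons_letter a x) w = cons_letter a (foldr cons_letter x w)" for x
  proof (cases x)
    case (Cons b y)
    then show ?thesis
      using cons_letter_cancel[OF reduced_foldr[OF assms]] by auto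
  qed simp
  then show ?case using Cons by simp
qed simp

lemma group_free_group: "group (free_group S)"
proof (rule groupI)
  fix w assume "w \<in> carrier (free_group S)"
  then have w: "reduced w" "set w \<subseteq> S \<times> UNIV" by (auto simp: free_group_def)
  define v where "v = foldr cons_letter (rev (map inv_letter w)) []"
  have S: "set (rev (map inv_letter w)) \<subseteq> S \<times> UNIV"
    using w(2) by (auto simp: inv_letter_def)
  have "v \<in> carrier (free_group S)"
    unfolding v_def
    using S set_foldr_cons_letter[of "rev (map inv_letter w)" "[]"]
      reduced_foldr[of "[]" "rev (map inv_letter w)"]
    by (simp add: free_group_def reduced_def)
  moreover have "foldr cons_letter (rev (map inv_letter w)) w = []" using w(1)
  proof (induction w)
    case (Cons a w)
    then show ?case by (cases w) (auto simp: reduced_Cons)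
  qed simp
  then have "v \<otimes>\<^bsub>free_group S\<^esub> w = \<one>\<^bsub>free_group S\<^esub>"
    using foldr_foldr_cons_letter[OF w(1), of "rev (map inv_letter w)" "[]"]
    by (simp add: free_group_def v_def)
  ultimately show "\<exists>v \<in> carrier (free_group S). v \<otimes>\<^bsub>free_group S\<^esub> w = \<one>\<^bsub>free_group S\<^esub>"
    by blast
next
  fix v w assume "v \<in> carrier (free_group S)" "w \<in> carrier (free_group S)"
  then show "v \<otimes>\<^bsub>free_group S\<^esub> w \<in> carrier (free_group S)"
    using set_foldr_cons_letter[of v w] by (auto simp: free_group_def intro: reduced_foldr)
qed (auto simp: free_group_def foldr_foldr_cons_letter reduced_def)

definition free_tuples :: "'a measure \<Rightarrow> ('a \<Rightarrow> 'a) set \<Rightarrow> nat \<Rightarrow> (nat \<Rightarrow> ('a \<Rightarrow> 'a) set) set" where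
  "free_tuples M T n =
     {U. subgroup_generated (mp_aut M) (insert T (U ` {..<n})) \<cong> free_group {..<n + 1}}"

definition dense_gdelta_in :: "'a topology \<Rightarrow> 'a set \<Rightarrow> bool" where
  "dense_gdelta_in X A \<longleftrightarrow> gdelta_in X A \<and> X closure_of A = topspace X"

text \<open>The set \<open>A\<^sup>n\<close> with the product of the subspace topologies; its points are the functions
  in \<open>{..<n} \<rightarrow>\<^sub>E A\<close>.\<close>

definition tuple_topology :: "'a measure \<Rightarrow> ('a \<Rightarrow> 'a) set set \<Rightarrow> nat \<Rightarrow> (nat \<Rightarrow> ('a \<Rightarrow> 'a) set) topology"
  where "tuple_topology M A n =
    product_topology (\<lambda>_. subtopology (uniform_topology M) A) {..<n}"

end

(* A tuple generates a free group of rank n + 1 together with T if and only if no nonempty reduced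
   word vanishes on it: one direction holds because finitely generated free groups are Hopfian.
   Hence the set in question is the intersection over all words w of the open sets {w(T, U) \<noteq> 1}
   in a complete metric space, and by Baire it suffices to see that each of them is dense.

   Since T has infinite order, it has arbitrarily long orbits on sets A of positive (and as small as
   desired) measure. Along w one chooses positions in such an orbit, moving by T at the letters T and
   jumping to fresh positions at all other letters. As w is reduced, this prescribes each U_i only as
   a partial injection between levels T^p A, which can be realised by a perturbation of U_i supported
   on a set of small measure: a left translate of U_i or, if U_i is aperiodic, a conjugate, so that
   aperiodicity persists. Then w(T, U) moves the starting level to a different one. *)

theory Submission
  imports Defs
begin

section \<open>Words in free groups\<close>

text \<open>\<open>T\<close> is given and cannot be perturbed, and infinite order says only that no
  power of it is trivial: all orbits may be finite, so long injective segments are available only on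
  a set of positive measure, for one bound on the length at a time. That is enough, because one word
  needs one path. The path stays inside a single orbit of \<open>T\<close>, so all its points are
  equivalent under \<open>R\<close>, and every perturbation built from it lies in the full group.
  The positions come from a height that counts a letter \<open>T\<close> as 1 or -1 and every other
  letter, inverse or not, as \<open>N\<close>, where \<open>N\<close> exceeds the length of the
  word: no nonempty factor of a reduced word then has height 0. The same heights, taken with respect
  to the letter of an aperiodic \<open>U_i\<close>, provide the segment of its orbit that the
  conjugation transports to the path. The points \<open>u (z j x)\<close> may coincide with points
  of the path in a way that varies with \<open>x\<close>; passing to a smaller set of positive
  measure fixes the pattern of coincidences and leaves a problem about a finite set.\<close>

text \<open>The complements of the two images in the finite set \<open>F\<close> have equal size, so
  any bijection between them completes the partial map. It is given by two parametrisations over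
  \<open>J\<close> because it always arises so, with \<open>J\<close> a set of letters or of path
  positions.\<close>

lemma partial_inj_extends_to_perm:
  assumes "finite F" "f ` J \<subseteq> F" "g ` J \<subseteq> F" "inj_on f J" "inj_on g J"
  obtains p where "bij_betw p F F" "\<And>j. j \<in> J \<Longrightarrow> p (f j) = g j"
proof -
  have "card (f ` J) = card (g ` J)"
    using assms by (simp add: card_image)
  then have "card (F - f ` J) = card (F - g ` J)"
    using assms by (simp add: card_Diff_subset finite_subset)
  then obtain r where r: "bij_betw r (F - f ` J) (F - g ` J)"
    using assms(1) finite_same_card_bij[of "F - f ` J" "F - g ` J"] by auto
  define p where "p = (\<lambda>x. if x \<in> f ` J then g (inv_into J f x) else r x)"
  have pf: "p (f j) = g j" if "j \<in> J" for j
    using that assms(4) by (simp add: p_def)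
  have "bij_betw p (f ` J) (g ` J)"
    using assms(4,5) pf by (intro bij_betw_imageI) (auto simp: inj_on_def image_image)
  moreover have "bij_betw p (F - f ` J) (F - g ` J)"
    using r by (rule bij_betw_cong[THEN iffD1, rotated]) (simp add: p_def)
  ultimately have "bij_betw p (f ` J \<union> (F - f ` J)) (g ` J \<union> (F - g ` J))"
    by (rule bij_betw_combine) auto
  moreover have "f ` J \<union> (F - f ` J) = F" "g ` J \<union> (F - g ` J) = F"
    using assms by auto
  ultimately show thesis using that[of p] pf by simp
qed

section \<open>Positions and heights along a reduced word\<close>

text \<open>Words act on the left and are read from the right: the letter at index \<open>j\<close>
  moves label \<open>j + 1\<close> to label \<open>j\<close>. \<open>letter_src\<close> and
  \<open>letter_tgt\<close> record this as an arrow of the generator itself, so an inverse letter is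
  traversed backwards.\<close>

definition letter_src :: "('s \<times> bool) list \<Rightarrow> nat \<Rightarrow> nat" where
  "letter_src w j = (if snd (w ! j) then Suc j else j)"

definition letter_tgt :: "('s \<times> bool) list \<Rightarrow> nat \<Rightarrow> nat" where
  "letter_tgt w j = (if snd (w ! j) then j else Suc j)"

definition letter_positions :: "('s \<times> bool) list \<Rightarrow> 's \<Rightarrow> nat set" where
  "letter_positions w s = {j. j < length w \<and> fst (w ! j) = s}"

lemma reduced_nth:
  assumes "reduced w" "Suc j < length w"
  shows "w ! Suc j \<noteq> inv_letter (w ! j)"
  using assms by (auto simp: reduced_def successively_conv_nth)

lemma reduced_same_sign:
  assumes "reduced w" "Suc j < length w" "fst (w ! j) = fst (w ! Suc j)"
  shows "snd (w ! j) = snd (w ! Suc j)"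
  using reduced_nth[OF assms(1,2)] assms(3) by (auto simp: inv_letter_def prod_eq_iff)

text \<open>Labels are shared only by adjacent letters, and adjacent letters with the same generator
  have a common source only if their signs are opposite, which a reduced word forbids.\<close>

lemma inj_on_letter_src:
  assumes "reduced w"
  shows "inj_on (letter_src w) (letter_positions w s)"
proof (rule inj_onI)
  fix i j assume "i \<in> letter_positions w s" "j \<in> letter_positions w s" "letter_src w i = letter_src w j"
  then show "i = j"
    using reduced_same_sign[OF assms, of i] reduced_same_sign[OF assms, of j]
    by (auto simp: letter_positions_def letter_src_def split: if_splits)
qed

lemma inj_on_letter_tgt:
  assumes "reduced w"
  shows "inj_on (letter_tgt w) (letter_positions w s)"
proof (rule inj_onI)
  fix i j assume "i \<in> letter_positions w s" "j \<in> letter_positions w s" "letter_tgt w i = letter_tgt w j"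
  then show "i = j"
    using reduced_same_sign[OF assms, of i] reduced_same_sign[OF assms, of j]
    by (auto simp: letter_positions_def letter_tgt_def split: if_splits)
qed

text \<open>Not a homomorphism to the integers: a letter other than \<open>s\<close> counts
  \<open>N\<close> whatever its sign, so two such letters never compensate each other. Only
  additivity under concatenation is kept.\<close>

fun letter_height :: "'s \<Rightarrow> int \<Rightarrow> ('s \<times> bool) list \<Rightarrow> int" where
  "letter_height s N [] = 0"
| "letter_height s N (a # w) =
    (if fst a = s then (if snd a then 1 else -1) else N) + letter_height s N w"

lemma letter_height_append: "letter_height s N (u @ v) = letter_height s N u + letter_height s N v"
  by (induction u) auto

lemma letter_height_const:
  assumes "\<forall>a \<in> set u. fst a = s" "reduced u" "u \<noteq> []"
  shows "letter_height s N u = (if snd (hd u) then 1 else -1) * int (length u)"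
  using assms
proof (induction u)
  case (Cons a u)
  show ?case
  proof (cases u)
    case Nil
    then show ?thesis using Cons.prems by auto
  next
    case (Cons b v)
    have "snd b = snd a"
      using reduced_same_sign[OF Cons.prems(2), of 0] Cons.prems(1) Cons by auto
    then show ?thesis using Cons.IH Cons.prems Cons by (auto simp: reduced_Cons algebra_simps)
  qed
qed simp

text \<open>One letter contributes \<open>N\<close>, and each of the remaining
  \<open>length u - 1\<close> letters at least -1.\<close>

lemma letter_height_other:
  assumes "\<exists>a \<in> set u. fst a \<noteq> s" "N > 0"
  shows "letter_height s N u \<ge> N - int (length u) + 1"
  using assms(1)
proof (induction u)
  case (Cons a u)
  have *: "letter_height s N v \<ge> - int (length v)" for v
    using assms(2) by (induction v) auto
  show ?case using Cons *[of u] assms(2) by (cases "\<exists>a \<in> set u. fst a \<noteq> s") auto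
qed simp

lemma reduced_append: "reduced (u @ v) \<Longrightarrow> reduced u \<and> reduced v"
  by (auto simp: reduced_def successively_append_iff)

lemma letter_height_nonzero:
  assumes "reduced u" "u \<noteq> []" "N > int (length u)"
  shows "letter_height s N u \<noteq> 0"
proof (cases "\<exists>a \<in> set u. fst a \<noteq> s")
  case True
  then show ?thesis using letter_height_other[of u s N] assms(3) by auto
next
  case False
  then show ?thesis using letter_height_const[of u s N] assms by auto
qed

text \<open>A height function on the suffixes of a reduced word in which reading \<open>s\<close> changes the
  height by one, so that following the word moves along a single orbit of \<open>s\<close> without ever
  returning: the other letters jump far away.\<close>

lemma letter_heights_exist:
  fixes w :: "('s \<times> bool) list"
  assumes "reduced w"
  obtains h :: "nat \<Rightarrow> int" where "inj_on h {..length w}"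
    "\<And>j. j \<in> letter_positions w s \<Longrightarrow> h (letter_tgt w j) = h (letter_src w j) + 1"
proof
  \<comment> \<open>Larger than the length of every factor of \<open>w\<close>.\<close>
  let ?N = "int (length w) + 1"
  let ?h = "\<lambda>j. letter_height s ?N (drop j w)"
  \<comment> \<open>By additivity the heights at \<open>i\<close> and \<open>j\<close> differ by the
    height of the nonempty reduced factor between them.\<close>
  have neq: "?h i \<noteq> ?h j" if "i < j" "j \<le> length w" for i j
  proof -
    have "drop i w = take (j - i) (drop i w) @ drop j w"
      using that by (metis append_take_drop_id drop_drop le_add_diff_inverse2 less_imp_le)
    moreover from this have "reduced (take (j - i) (drop i w))"
      using assms by (metis append_take_drop_id reduced_append)
    ultimately show ?thesis
      using letter_height_nonzero[of "take (j - i) (drop i w)" ?N s] that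
        letter_height_append[of s ?N "take (j - i) (drop i w)" "drop j w"] by auto
  qed
  show "inj_on ?h {..length w}"
    by (rule inj_onI) (metis atMost_iff neq linorder_neqE_nat)
  fix j assume "j \<in> letter_positions w s"
  then have "drop j w = w ! j # drop (Suc j) w" "fst (w ! j) = s"
    by (auto simp: letter_positions_def Cons_nth_drop_Suc)
  then show "?h (letter_tgt w j) = ?h (letter_src w j) + 1"
    by (auto simp: letter_tgt_def letter_src_def)
qed

section \<open>Evaluation of words in a group\<close>

definition letter_val :: "('g, 'b) monoid_scheme \<Rightarrow> ('s \<Rightarrow> 'g) \<Rightarrow> 's \<times> bool \<Rightarrow> 'g" where
  "letter_val G g a = (if snd a then g (fst a) else inv\<^bsub>G\<^esub> (g (fst a)))"

text \<open>The value at \<open>w\<close> of the homomorphism from the free group that sends each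
  generator \<open>s\<close> to \<open>g s\<close>. It is defined for arbitrary words, so that
  multiplicativity can be proved by induction without tracking reducedness.\<close>

definition word_val :: "('g, 'b) monoid_scheme \<Rightarrow> ('s \<Rightarrow> 'g) \<Rightarrow> ('s \<times> bool) list \<Rightarrow> 'g" where
  "word_val G g w = foldr (\<lambda>a x. letter_val G g a \<otimes>\<^bsub>G\<^esub> x) w \<one>\<^bsub>G\<^esub>"

lemma word_val_simps [simp]:
  "word_val G g [] = \<one>\<^bsub>G\<^esub>"
  "word_val G g (a # w) = letter_val G g a \<otimes>\<^bsub>G\<^esub> word_val G g w"
  by (simp_all add: word_val_def)

context group
begin

lemma letter_val_closed:
  "g \<in> S \<rightarrow> carrier G \<Longrightarrow> a \<in> S \<times> UNIV \<Longrightarrow> letter_val G g a \<in> carrier G"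
  by (auto simp: letter_val_def)

lemma word_val_closed:
  "g \<in> S \<rightarrow> carrier G \<Longrightarrow> set w \<subseteq> S \<times> UNIV \<Longrightarrow> word_val G g w \<in> carrier G"
  by (induction w) (auto intro!: m_closed letter_val_closed[of g S])

lemma letter_val_inv_letter:
  "g \<in> S \<rightarrow> carrier G \<Longrightarrow> a \<in> S \<times> UNIV \<Longrightarrow>
    letter_val G g (inv_letter a) = inv (letter_val G g a)"
  by (cases a) (auto simp: letter_val_def inv_letter_def Pi_iff)

lemma word_val_cons_letter:
  assumes "g \<in> S \<rightarrow> carrier G" "a \<in> S \<times> UNIV" "set w \<subseteq> S \<times> UNIV"
  shows "word_val G g (cons_letter a w) = letter_val G g a \<otimes> word_val G g w"
proof (cases w)
  case (Cons b v)
  have c: "letter_val G g a \<in> carrier G" "word_val G g v \<in> carrier G"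
    using assms Cons by (auto intro!: letter_val_closed[of g S] word_val_closed[of g S])
  then show ?thesis
    using Cons letter_val_inv_letter[OF assms(1,2)] by (auto simp: m_assoc[symmetric])
qed simp

lemma word_val_foldr:
  assumes "g \<in> S \<rightarrow> carrier G" "set v \<subseteq> S \<times> UNIV" "set w \<subseteq> S \<times> UNIV"
  shows "word_val G g (foldr cons_letter v w) = word_val G g v \<otimes> word_val G g w"
  using assms(2)
proof (induction v)
  case Nil
  then show ?case using word_val_closed[OF assms(1,3)] by simp
next
  case (Cons a v)
  have "set (foldr cons_letter v w) \<subseteq> S \<times> UNIV"
    using set_foldr_cons_letter[of v w] Cons.prems assms(3) by auto
  moreover have "letter_val G g a \<in> carrier G" "word_val G g v \<in> carrier G" "word_val G g w \<in> carrier G"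
    using assms Cons.prems by (auto intro!: letter_val_closed[of g S] word_val_closed[of g S])
  ultimately show ?case
    using Cons word_val_cons_letter[OF assms(1), of a] by (simp add: m_assoc)
qed

lemma word_val_hom:
  assumes "g \<in> S \<rightarrow> carrier G"
  shows "word_val G g \<in> hom (free_group S) G"
  using word_val_closed[OF assms] word_val_foldr[OF assms]
  by (auto intro!: homI simp: free_group_def)

lemma word_val_image:
  assumes "g \<in> S \<rightarrow> carrier G"
  shows "word_val G g ` carrier (free_group S) = generate G (g ` S)"
proof
  have letter: "letter_val G g a \<in> generate G (g ` S)" if "a \<in> S \<times> UNIV" for a
    using that by (auto simp: letter_val_def intro: generate.incl generate.inv)
  have "word_val G g w \<in> generate G (g ` S)" if "set w \<subseteq> S \<times> UNIV" for w
    using that by (induction w) (auto intro!: generate.one generate.eng letter)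
  then show "word_val G g ` carrier (free_group S) \<subseteq> generate G (g ` S)"
    by (auto simp: free_group_def)
  interpret h: group_hom "free_group S" G "word_val G g"
    using word_val_hom[OF assms] group_free_group
    by (simp add: group_hom_def group_hom_axioms_def group_axioms)
  have "x \<in> word_val G g ` carrier (free_group S)" if "x \<in> generate G (g ` S)" for x
    using that
  proof induction
    case one
    show ?case by (rule image_eqI[of _ _ "[]"]) (auto simp: free_group_def reduced_def)
  next
    case (incl x)
    then obtain s where "s \<in> S" "x = g s" by auto
    moreover from this have "g s \<in> carrier G" using assms by auto
    ultimately have "x = word_val G g [(s, True)]" "[(s, True)] \<in> carrier (free_group S)"
      by (simp_all add: letter_val_def free_group_def reduced_def)
    then show ?case by (rule image_eqI)
  next
    case (inv x)
    then obtain s where "s \<in> S" "x = g s" by auto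
    moreover from this have "g s \<in> carrier G" using assms by auto
    ultimately have "inv x = word_val G g [(s, False)]" "[(s, False)] \<in> carrier (free_group S)"
      by (simp_all add: letter_val_def free_group_def reduced_def)
    then show ?case by (rule image_eqI)
  next
    case (eng x y)
    then obtain u v where uv: "u \<in> carrier (free_group S)" "v \<in> carrier (free_group S)"
      "x = word_val G g u" "y = word_val G g v" by blast
    show ?case
      using h.hom_mult[OF uv(1,2)] h.m_closed[OF uv(1,2)] uv(3,4) by (intro image_eqI) auto
  qed
  then show "generate G (g ` S) \<subseteq> word_val G g ` carrier (free_group S)" by blast
qed

end

text \<open>Uniqueness half of the universal property: homomorphisms out of the free group
  correspond to families indexed by the generators, which is what makes them countable by hand in
  the Hopfian argument.\<close>

lemma hom_free_group_eq:
  assumes "group K" "\<phi> \<in> hom (free_group S) K" "g \<in> S \<rightarrow> carrier K"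
    "\<And>s. s \<in> S \<Longrightarrow> \<phi> [(s, True)] = g s" "w \<in> carrier (free_group S)"
  shows "\<phi> w = word_val K g w"
proof -
  interpret K: group K by fact
  interpret F: group "free_group S" by (rule group_free_group)
  interpret h: group_hom "free_group S" K \<phi>
    using assms by (simp add: group_hom_def group_hom_axioms_def group_free_group)
  have letter: "\<phi> [a] = letter_val K g a" if a: "a \<in> S \<times> UNIV" for a
  proof (cases "snd a")
    case True
    then show ?thesis using a assms(4) by (cases a) (auto simp: letter_val_def)
  next
    case False
    then obtain s where s: "a = (s, False)" "s \<in> S" using a by (cases a) auto
    have "inv\<^bsub>free_group S\<^esub> [(s, True)] = [(s, False)]"
      using s by (intro F.inv_equality) (auto simp: free_group_def reduced_def inv_letter_def)
    then show ?thesis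
      using h.hom_inv[of "[(s, True)]"] s assms(4)
      by (auto simp: letter_val_def free_group_def reduced_def)
  qed
  have "reduced w \<and> set w \<subseteq> S \<times> UNIV"
    using assms(5) by (simp add: free_group_def)
  then show ?thesis
  proof (induction w)
    case Nil
    then show ?case using h.hom_one by (simp add: free_group_def)
  next
    case (Cons a w)
    \<comment> \<open>The word is reduced, so prepending \<open>a\<close> causes no cancellation and
      the list is a product in the free group.\<close>
    then have aw: "a # w = [a] \<otimes>\<^bsub>free_group S\<^esub> w"
      by (cases w) (auto simp: free_group_def reduced_Cons)
    have c: "[a] \<in> carrier (free_group S)" "w \<in> carrier (free_group S)"
      using Cons.prems by (auto simp: free_group_def reduced_Cons reduced_def[of "[]"])
    have "\<phi> (a # w) = \<phi> [a] \<otimes>\<^bsub>K\<^esub> \<phi> w"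
      using h.hom_mult[OF c] aw by metis
    then show ?case using Cons letter[of a] by (simp add: reduced_Cons)
  qed
qed

section \<open>Residual finiteness and the Hopfian property\<close>

text \<open>Residual finiteness: along a nonempty reduced word the generators only have to act as
  partial injections on the positions of the word.\<close>

lemma free_group_residually_finite:
  fixes w :: "('s \<times> bool) list"
  assumes "w \<in> carrier (free_group S)" "w \<noteq> []"
  obtains b where "b \<in> S \<rightarrow>\<^sub>E carrier (BijGroup {..length w})"
    "word_val (BijGroup {..length w}) b w \<noteq> \<one>\<^bsub>BijGroup {..length w}\<^esub>"
proof -
  let ?m = "length w"
  let ?B = "BijGroup {..?m}"
  have w: "reduced w" "set w \<subseteq> S \<times> UNIV" using assms by (auto simp: free_group_def)
  have "\<exists>p. bij_betw p {..?m} {..?m} \<and>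
      (\<forall>j \<in> letter_positions w s. p (letter_src w j) = letter_tgt w j)" for s
  proof -
    have "letter_src w ` letter_positions w s \<subseteq> {..?m}" "letter_tgt w ` letter_positions w s \<subseteq> {..?m}"
      by (auto simp: letter_positions_def letter_src_def letter_tgt_def)
    then show ?thesis
      using partial_inj_extends_to_perm[OF finite_atMost _ _ inj_on_letter_src[OF w(1)] inj_on_letter_tgt[OF w(1)]]
      by metis
  qed
  then obtain p where p: "\<And>s. bij_betw (p s) {..?m} {..?m}"
    "\<And>s j. j \<in> letter_positions w s \<Longrightarrow> p s (letter_src w j) = letter_tgt w j" by metis
  \<comment> \<open>Extensional in \<open>s\<close>, so that the families compared in the Hopfian
    argument range over a finite set.\<close>
  define b where "b = (\<lambda>s\<in>S. restrict (p s) {..?m})"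
  interpret B: group ?B by (rule group_BijGroup)
  have bS: "b s \<in> Bij {..?m}" "b s \<in> carrier ?B" if "s \<in> S" for s
    using p(1)[of s] that by (auto simp: b_def Bij_def BijGroup_def)
  then have b: "b \<in> S \<rightarrow> carrier ?B" by auto
  have wv: "word_val ?B b (drop j w) \<in> carrier ?B" for j
    using B.word_val_closed[OF b] w(2) by (meson order_trans set_drop_subset)
  have mult: "(f \<otimes>\<^bsub>?B\<^esub> g) x = f (g x)" if "f \<in> carrier ?B" "g \<in> carrier ?B" "x \<le> ?m" for f g x
    using that by (simp add: BijGroup_def compose_def)
  \<comment> \<open>After the last \<open>i\<close> letters have acted, the point
    \<open>length w\<close> has reached \<open>length w - i\<close>; after the whole word it has
    reached 0.\<close>
  have "word_val ?B b (drop (?m - i) w) ?m = ?m - i" if "i \<le> ?m" for i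
    using that
  proof (induction i)
    case 0
    then show ?case by (simp add: BijGroup_def)
  next
    case (Suc i)
    define j where "j = ?m - Suc i"
    have j: "j < ?m" "Suc j = ?m - i" using Suc.prems by (auto simp: j_def)
    define s where "s = fst (w ! j)"
    have js: "j \<in> letter_positions w s" using j by (simp add: letter_positions_def s_def)
    have "w ! j \<in> set w" using j(1) by simp
    then have sS: "s \<in> S" using w(2) by (auto simp: s_def)
    have d: "drop j w = w ! j # drop (Suc j) w" using j(1) by (simp add: Cons_nth_drop_Suc)
    have lv: "letter_val ?B b (w ! j) \<in> carrier ?B"
      using bS(2)[OF sS] by (simp add: letter_val_def s_def)
    have "word_val ?B b (drop j w) ?m = letter_val ?B b (w ! j) (Suc j)"
      using Suc j(2) lv wv[of "Suc j"] by (simp add: d mult)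
    also have "\<dots> = j"
    proof (cases "snd (w ! j)")
      case True
      then show ?thesis using p(2)[OF js] sS j
        by (simp add: letter_val_def letter_src_def letter_tgt_def b_def flip: s_def)
    next
      case False
      then have "b s j = Suc j" using p(2)[OF js] sS j
        by (simp add: letter_src_def letter_tgt_def b_def)
      moreover have "inj_on (b s) {..?m}" using bS(1)[OF sS] by (simp add: Bij_def bij_betw_def)
      ultimately have "inv_into {..?m} (b s) (Suc j) = j"
        using j(1) by (intro inv_into_f_eq) auto
      then show ?thesis using False j bS(1)[OF sS]
        by (simp add: letter_val_def inv_BijGroup flip: s_def)
    qed
    finally show ?case by (simp add: j_def)
  qed
  from this[of ?m] have "word_val ?B b w ?m = 0" by simp
  moreover have "\<one>\<^bsub>?B\<^esub> ?m = ?m" by (simp add: BijGroup_def)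
  ultimately have "word_val ?B b w \<noteq> \<one>\<^bsub>?B\<^esub>" using assms(2) by auto
  moreover have "b \<in> S \<rightarrow>\<^sub>E carrier ?B"
    using bS(2) by (auto simp: b_def)
  ultimately show thesis using that by blast
qed

text \<open>Malcev's counting argument: precomposition with a surjective endomorphism is an injective,
  hence surjective, self-map of the finite set of homomorphisms into a finite group.\<close>

lemma free_group_hopfian:
  assumes "finite S" "\<phi> \<in> hom (free_group S) (free_group S)"
    and surj: "\<phi> ` carrier (free_group S) = carrier (free_group S)"
    and w: "w \<in> carrier (free_group S)" "\<phi> w = []"
  shows "w = []"
proof (rule ccontr)
  assume "w \<noteq> []"
  let ?F = "free_group S"
  let ?B = "BijGroup {..length w}"
  interpret F: group ?F by (rule group_free_group)
  interpret B: group ?B by (rule group_BijGroup)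
  obtain b where b: "b \<in> S \<rightarrow>\<^sub>E carrier ?B" "word_val ?B b w \<noteq> \<one>\<^bsub>?B\<^esub>"
    using free_group_residually_finite[OF w(1) \<open>w \<noteq> []\<close>] by blast
  have gen: "[(s, True)] \<in> carrier ?F" if "s \<in> S" for s
    using that by (auto simp: free_group_def reduced_def)
  \<comment> \<open>A family \<open>a\<close> stands for the homomorphism with these values on the
    generators; \<open>\<Psi>\<close> is precomposition with \<open>\<phi>\<close> in these
    coordinates.\<close>
  define \<Psi> where "\<Psi> = (\<lambda>a. \<lambda>s\<in>S. word_val ?B a (\<phi> [(s, True)]))"
  have comp: "word_val ?B a (\<phi> v) = word_val ?B (\<Psi> a) v" and \<Psi>: "\<Psi> a \<in> S \<rightarrow>\<^sub>E carrier ?B"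
    if a: "a \<in> S \<rightarrow>\<^sub>E carrier ?B" and "v \<in> carrier ?F" for a v
  proof -
    have ha: "word_val ?B a \<in> hom ?F ?B" using a by (intro B.word_val_hom) auto
    have "word_val ?B a \<circ> \<phi> \<in> hom ?F ?B" using assms(2) ha by (rule Group.hom_compose)
    then show \<Psi>: "\<Psi> a \<in> S \<rightarrow>\<^sub>E carrier ?B"
      using gen by (auto simp: \<Psi>_def hom_def Pi_iff)
    have "(word_val ?B a \<circ> \<phi>) v = word_val ?B (\<Psi> a) v"
    proof (rule hom_free_group_eq[OF group_BijGroup])
      show "word_val ?B a \<circ> \<phi> \<in> hom ?F ?B" by fact
    qed (use \<Psi> that in \<open>auto simp: \<Psi>_def\<close>)
    then show "word_val ?B a (\<phi> v) = word_val ?B (\<Psi> a) v" by simp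
  qed
  have fin: "finite (S \<rightarrow>\<^sub>E carrier ?B)"
  proof (rule finite_PiE[OF assms(1)])
    have "carrier ?B \<subseteq> {..length w} \<rightarrow>\<^sub>E {..length w}"
      by (auto simp: BijGroup_def Bij_def bij_betw_def PiE_def)
    then show "finite (carrier ?B)" by (rule finite_subset) (auto intro: finite_PiE)
  qed
  \<comment> \<open>Every generator is a value of \<open>\<phi>\<close>, so the composite with
    \<open>\<phi>\<close> determines \<open>a\<close>.\<close>
  have "inj_on \<Psi> (S \<rightarrow>\<^sub>E carrier ?B)"
  proof (rule inj_onI)
    fix a a' assume a: "a \<in> S \<rightarrow>\<^sub>E carrier ?B" "a' \<in> S \<rightarrow>\<^sub>E carrier ?B" "\<Psi> a = \<Psi> a'"
    show "a = a'"
    proof (rule PiE_ext[OF a(1,2)])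
      fix s assume s: "s \<in> S"
      obtain v where v: "v \<in> carrier ?F" "\<phi> v = [(s, True)]" using gen[OF s] surj by (metis imageE)
      have "word_val ?B a [(s, True)] = word_val ?B a' [(s, True)]"
        using comp[OF a(1) v(1)] comp[OF a(2) v(1)] v(2) a(3) by simp
      moreover have "a s \<in> carrier ?B" "a' s \<in> carrier ?B" using s a(1,2) by auto
      ultimately show "a s = a' s" by (simp add: letter_val_def)
    qed
  qed
  then have "\<Psi> ` (S \<rightarrow>\<^sub>E carrier ?B) = S \<rightarrow>\<^sub>E carrier ?B"
    using \<Psi> fin w(1) by (intro endo_inj_surj) auto
  \<comment> \<open>The homomorphism that detects \<open>w\<close> factors through
    \<open>\<phi>\<close>, which kills \<open>w\<close>.\<close>
  then have "b \<in> \<Psi> ` (S \<rightarrow>\<^sub>E carrier ?B)" using b(1) by simp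
  then obtain a where a: "a \<in> S \<rightarrow>\<^sub>E carrier ?B" "\<Psi> a = b" by (elim imageE) simp
  show False using comp[OF a(1) w(1)] w(2) a(2) b(2) by simp
qed

text \<open>The isomorphism is abstract and need not match \<open>g\<close> with free generators.
  Composed with evaluation it becomes a surjective endomorphism of the free group, so the Hopfian
  property forces evaluation to have trivial kernel; conversely, a trivial kernel makes evaluation
  an isomorphism onto the generated subgroup.\<close>

lemma (in group) subgroup_generated_iso_free_group_iff:
  assumes "finite S" and g: "g \<in> S \<rightarrow> carrier G"
  shows "subgroup_generated G (g ` S) \<cong> free_group S \<longleftrightarrow>
    (\<forall>w \<in> carrier (free_group S). w \<noteq> [] \<longrightarrow> word_val G g w \<noteq> \<one>)"
proof
  let ?H = "subgroup_generated G (g ` S)"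
  have "carrier G \<inter> g ` S = g ` S" using g by auto
  then have cH: "carrier ?H = word_val G g ` carrier (free_group S)"
    using word_val_image[OF g] by (simp add: carrier_subgroup_generated)
  have hH: "word_val G g \<in> hom (free_group S) ?H"
    using word_val_hom[OF g] cH by (auto simp: hom_def)
  {
    assume "?H \<cong> free_group S"
    then obtain \<theta> where \<theta>: "\<theta> \<in> hom ?H (free_group S)" "bij_betw \<theta> (carrier ?H) (carrier (free_group S))"
      by (auto simp: is_iso_def iso_def)
    interpret \<theta>: group_hom ?H "free_group S" \<theta>
      using \<theta>(1) group_free_group by (simp add: group_hom_def group_hom_axioms_def)
    have h: "\<theta> \<circ> word_val G g \<in> hom (free_group S) (free_group S)"
      using hH \<theta>(1) by (rule Group.hom_compose)
    have s: "(\<theta> \<circ> word_val G g) ` carrier (free_group S) = carrier (free_group S)"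
      using \<theta>(2) cH by (metis bij_betw_imp_surj_on image_comp)
    have "(\<theta> \<circ> word_val G g) w = []" if "word_val G g w = \<one>" for w
      using \<theta>.hom_one that by (simp add: free_group_def)
    then show "\<forall>w \<in> carrier (free_group S). w \<noteq> [] \<longrightarrow> word_val G g w \<noteq> \<one>"
      using free_group_hopfian[OF assms(1) h s] by blast
  }
  assume *: "\<forall>w \<in> carrier (free_group S). w \<noteq> [] \<longrightarrow> word_val G g w \<noteq> \<one>"
  interpret F: group "free_group S" by (rule group_free_group)
  interpret h: group_hom "free_group S" ?H "word_val G g"
    using hH group_free_group by (simp add: group_hom_def group_hom_axioms_def)
  have "inj_on (word_val G g) (carrier (free_group S))"
    using h.inj_iff_trivial_ker * by (auto simp: kernel_def free_group_def reduced_def)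
  then have "word_val G g \<in> iso (free_group S) ?H"
    using hH cH by (simp add: iso_def bij_betw_def)
  then have "free_group S \<cong> ?H" by (auto simp: is_iso_def)
  then show "?H \<cong> free_group S" by (rule F.iso_sym)
qed

section \<open>The automorphism group with the uniform metric\<close>

locale standard_pmp =
  fixes M :: "'a measure"
  assumes standard: "standard_prob_space M"
begin

sublocale prob_space M
  using standard by (simp add: standard_prob_space_def)

sublocale G: group "mp_bij M"
  by (rule group_mp_bij)

sublocale A: group "mp_aut M"
  by (rule group_mp_aut)

abbreviation mcomp (infixr "\<odot>" 70) where "f \<odot> g \<equiv> f \<otimes>\<^bsub>mp_bij M\<^esub> g"
abbreviation minv where "minv f \<equiv> inv\<^bsub>mp_bij M\<^esub> f"
abbreviation ident where "ident \<equiv> \<one>\<^bsub>mp_bij M\<^esub>"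
abbreviation ipow where "ipow f (k :: int) \<equiv> f [^]\<^bsub>mp_bij M\<^esub> k"
abbreviation MB where "MB \<equiv> carrier (mp_bij M)"
abbreviation cls where "cls f \<equiv> aut_class M f"

lemma MB_D:
  assumes "f \<in> MB"
  shows "f \<in> measurable M M" "bij_betw f (space M) (space M)" "distr M M f = M"
  using assms by (auto simp: carrier_mp_bij Bij_def)

lemma MB_space: "f \<in> MB \<Longrightarrow> x \<in> space M \<Longrightarrow> f x \<in> space M"
  by (rule measurable_space[OF MB_D(1)])

lemma ident_apply: "x \<in> space M \<Longrightarrow> ident x = x"
  by (simp add: mp_bij_def BijGroup_def)

lemma mcomp_apply: "f \<in> MB \<Longrightarrow> g \<in> MB \<Longrightarrow> x \<in> space M \<Longrightarrow> (f \<odot> g) x = f (g x)"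
  by (rule mult_mp_bij)

lemma minv_left: "f \<in> MB \<Longrightarrow> x \<in> space M \<Longrightarrow> minv f (f x) = x"
  by (metis G.inv_closed G.l_inv mcomp_apply ident_apply)

lemma minv_right: "f \<in> MB \<Longrightarrow> x \<in> space M \<Longrightarrow> f (minv f x) = x"
  by (metis G.inv_closed G.r_inv mcomp_apply ident_apply)

lemma MB_inj: "f \<in> MB \<Longrightarrow> x \<in> space M \<Longrightarrow> y \<in> space M \<Longrightarrow> f x = f y \<longleftrightarrow> x = y"
  by (metis minv_left)

lemma ipow_add_apply:
  "f \<in> MB \<Longrightarrow> x \<in> space M \<Longrightarrow> ipow f (i + j) x = ipow f i (ipow f j x)"
  by (simp add: G.int_pow_mult mcomp_apply)

lemma ipow_eq_iff:
  assumes "f \<in> MB" "x \<in> space M"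
  shows "ipow f i x = ipow f j x \<longleftrightarrow> ipow f (i - j) x = x"
proof -
  have "ipow f i x = ipow f j (ipow f (i - j) x)"
    using ipow_add_apply[OF assms, of j "i - j"] by simp
  then show ?thesis using MB_inj[of "ipow f j"] assms by (metis G.int_pow_closed MB_space)
qed

lemma emeasure_vimage: "f \<in> MB \<Longrightarrow> A \<in> sets M \<Longrightarrow> emeasure M (f -` A \<inter> space M) = emeasure M A"
  using emeasure_distr[of f M M A] MB_D by metis

lemma image_eq_vimage_minv:
  assumes "f \<in> MB" "A \<subseteq> space M"
  shows "f ` A = minv f -` A \<inter> space M"
proof
  show "f ` A \<subseteq> minv f -` A \<inter> space M"
    using assms by (auto simp: minv_left MB_space subset_iff)
  show "minv f -` A \<inter> space M \<subseteq> f ` A"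
    using assms by (auto intro!: image_eqI[of _ _ "minv f _"] simp: minv_right)
qed

lemma image_MB:
  assumes "f \<in> MB" "A \<in> sets M"
  shows "f ` A \<in> sets M" "emeasure M (f ` A) = emeasure M A"
proof -
  have *: "f ` A = minv f -` A \<inter> space M"
    using assms sets.sets_into_space by (intro image_eq_vimage_minv) auto
  show "f ` A \<in> sets M"
    unfolding * using MB_D(1)[of "minv f"] assms by (intro measurable_sets) auto
  show "emeasure M (f ` A) = emeasure M A"
    unfolding * using assms by (intro emeasure_vimage) auto
qed

section \<open>Separating sets and measurability of coincidence\<close>

text \<open>Balls around a countable dense set with radii \<open>1 / (k + 1)\<close>. Such a family
  turns the statement that two points differ into countably many measurable conditions.\<close>

lemma separating_sets:
  obtains E :: "nat \<Rightarrow> 'a set" where "\<And>n. E n \<in> sets M"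
    "\<And>x y. x \<in> space M \<Longrightarrow> y \<in> space M \<Longrightarrow> x \<noteq> y \<Longrightarrow> \<exists>n. x \<in> E n \<and> y \<notin> E n"
proof -
  obtain X where X: "topspace X = space M" "completely_metrizable_space X" "separable_space X"
    "sets M = sigma_sets (space M) {U. openin X U}"
    using standard by (auto simp: standard_prob_space_def standard_borel_def)
  from X(2) obtain S d where "Metric_space S d" "X = Metric_space.mtopology S d"
    by (auto simp: completely_metrizable_space_def)
  then interpret D: Metric_space S d by simp
  have XD: "X = D.mtopology" by fact
  have S: "S = space M" using X(1) XD by simp
  obtain C where C: "countable C" "C \<subseteq> S" "D.mtopology closure_of C = S"
    using X(3) by (auto simp: separable_space_def XD)
  have Cn: "C \<noteq> {}" using C(3) not_empty S by auto
  define E where "E = (\<lambda>n. case prod_decode n of (i, k) \<Rightarrow>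
    D.mball (from_nat_into C i) (1 / Suc k))"
  have "E n \<in> sets M" for n
    unfolding X(4) using D.openin_mball by (auto simp: E_def XD split: prod.splits)
  moreover have "\<exists>n. x \<in> E n \<and> y \<notin> E n" if xy: "x \<in> space M" "y \<in> space M" "x \<noteq> y" for x y
  proof -
    have pos: "d x y > 0" using xy S D.mdist_pos_less by simp
    \<comment> \<open>Two points of a ball of this radius are closer to each other than
      \<open>d x y\<close>.\<close>
    then obtain k where k: "1 / Suc k < d x y / 2"
      using nat_approx_posE[of "d x y / 2"] by (metis half_gt_zero_iff)
    have "x \<in> D.mtopology closure_of C" using xy S C(3) by simp
    then have "\<forall>r>0. \<exists>c\<in>C. c \<in> D.mball x r"
      unfolding D.metric_closure_of by blast
    moreover have "1 / real (Suc k) > 0" by simp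
    ultimately obtain c where c: "c \<in> C" "c \<in> D.mball x (1 / Suc k)" by blast
    obtain i where i: "from_nat_into C i = c" using from_nat_into_surj[OF C(1) c(1)] by blast
    have "x \<in> D.mball c (1 / Suc k)" using c D.commute[of c x] by auto
    moreover have "y \<notin> D.mball c (1 / Suc k)"
    proof
      assume "y \<in> D.mball c (1 / Suc k)"
      then have "d x y < 1 / Suc k + 1 / Suc k"
        using c D.triangle[of x c y] by (auto simp del: of_nat_Suc)
      then show False using k by linarith
    qed
    ultimately show ?thesis
      by (intro exI[of _ "prod_encode (i, k)"]) (simp add: E_def i)
  qed
  ultimately show thesis using that by blast
qed

text \<open>Two values differ exactly when some \<open>E n\<close> contains the first and not the
  second, which writes the set as a countable union of differences of preimages.\<close>

lemma sets_neq:
  assumes "f \<in> measurable M M" "g \<in> measurable M M"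
  shows "{x \<in> space M. f x \<noteq> g x} \<in> sets M"
proof -
  obtain E :: "nat \<Rightarrow> 'a set" where E: "\<And>n. E n \<in> sets M"
    "\<And>x y. x \<in> space M \<Longrightarrow> y \<in> space M \<Longrightarrow> x \<noteq> y \<Longrightarrow> \<exists>n. x \<in> E n \<and> y \<notin> E n"
    using separating_sets by blast
  have "{x \<in> space M. f x \<noteq> g x} = (\<Union>n. (f -` E n \<inter> space M) - (g -` E n \<inter> space M))"
    using E(2) measurable_space[OF assms(1)] measurable_space[OF assms(2)] by auto
  moreover have "(f -` E n \<inter> space M) - (g -` E n \<inter> space M) \<in> sets M" for n
    using assms E(1) by (intro sets.Diff measurable_sets)
  ultimately show ?thesis by auto
qed

lemma sets_neq_MB [measurable]:
  "f \<in> MB \<Longrightarrow> g \<in> MB \<Longrightarrow> {x \<in> space M. f x \<noteq> g x} \<in> sets M"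
  by (simp add: sets_neq MB_D)

lemma sets_eq_MB:
  assumes "f \<in> MB" "g \<in> MB"
  shows "{x \<in> space M. f x = g x} \<in> sets M"
proof -
  have "{x \<in> space M. f x = g x} = space M - {x \<in> space M. f x \<noteq> g x}" by auto
  then show ?thesis using sets_neq_MB[OF assms] by auto
qed

section \<open>Classes modulo null sets\<close>

text \<open>Membership in the right coset says that \<open>g \<odot> minv f\<close> is almost
  everywhere the identity; preimages of null sets under \<open>f\<close> are null, so substituting
  \<open>f x\<close> for \<open>x\<close> turns this into almost everywhere equality.\<close>

lemma cls_iff: "f \<in> MB \<Longrightarrow> g \<in> cls f \<longleftrightarrow> g \<in> MB \<and> (AE x in M. g x = f x)"
proof -
  assume f: "f \<in> MB"
  have null: "(AE x in M. g x = f x) \<longleftrightarrow> g \<odot> minv f \<in> null_bij M" if g: "g \<in> MB"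
  proof
    assume "AE x in M. g x = f x"
    from AE_mp_bij[OF G.inv_closed[OF f] this]
    have "AE x in M. g (minv f x) = f (minv f x)" .
    then have "AE x in M. (g \<odot> minv f) x = x"
      using AE_space by eventually_elim (use f g in \<open>simp add: mcomp_apply minv_right\<close>)
    moreover have "g \<odot> minv f \<in> MB" using f g by (intro G.m_closed G.inv_closed)
    ultimately show "g \<odot> minv f \<in> null_bij M" unfolding null_bij_def by blast
  next
    assume "g \<odot> minv f \<in> null_bij M"
    then have "AE x in M. (g \<odot> minv f) x = x" by (simp add: null_bij_def)
    from AE_mp_bij[OF f this] have "AE x in M. (g \<odot> minv f) (f x) = f x" .
    then show "AE x in M. g x = f x"
      using AE_space by eventually_elim (use f g in \<open>simp add: mcomp_apply minv_left MB_space\<close>)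
  qed
  have nsub: "subgroup (null_bij M) (mp_bij M)"
    by (rule normal_imp_subgroup[OF normal_null_bij])
  have "g \<in> cls f \<longleftrightarrow> g \<in> MB \<and> g \<odot> minv f \<in> null_bij M"
    unfolding aut_class_def
    using subgroup.rcos_module[OF nsub G.group_axioms f]
      G.r_coset_subset_G[OF subgroup.subset[OF nsub] f] by blast
  then show ?thesis using null by blast
qed

lemma cls_eq_iff: "f \<in> MB \<Longrightarrow> g \<in> MB \<Longrightarrow> cls f = cls g \<longleftrightarrow> (AE x in M. f x = g x)"
proof
  assume fg: "f \<in> MB" "g \<in> MB"
  show "AE x in M. f x = g x" if "cls f = cls g"
    using that fg cls_iff[OF fg(1), of f] cls_iff[OF fg(2), of f] by auto
  assume *: "AE x in M. f x = g x"
  then have **: "AE x in M. g x = f x" by auto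
  have "h \<in> cls f \<longleftrightarrow> h \<in> cls g" for h
    unfolding cls_iff[OF fg(1)] cls_iff[OF fg(2)]
  proof (intro conj_cong refl iffI)
    show "AE x in M. h x = g x" if "AE x in M. h x = f x" using that * by eventually_elim simp
    show "AE x in M. h x = f x" if "AE x in M. h x = g x" using that * by eventually_elim simp
  qed
  then show "cls f = cls g" by blast
qed

lemma carrier_mp_aut: "carrier (mp_aut M) = cls ` MB"
  by (simp add: mp_aut_def carrier_FactGroup aut_class_def)

text \<open>The bridge between the two levels: pointwise constructions are made with honest
  bijections, while group identities and distances live on classes.\<close>

sublocale cls: group_hom "mp_bij M" "mp_aut M" "aut_class M"
proof -
  have "(\<lambda>f. null_bij M #>\<^bsub>mp_bij M\<^esub> f) \<in> hom (mp_bij M) (mp_aut M)"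
    unfolding mp_aut_def by (rule normal.r_coset_hom_Mod[OF normal_null_bij])
  then show "group_hom (mp_bij M) (mp_aut M) (aut_class M)"
    by (simp add: group_hom_def group_hom_axioms_def aut_class_def[abs_def] G.group_axioms A.group_axioms)
qed

section \<open>The bi-invariant uniform metric\<close>

text \<open>The uniform distance on representatives, free of the choices that \<open>dist_u\<close>
  makes with \<open>SOME\<close>.\<close>

definition neq_measure :: "('a \<Rightarrow> 'a) \<Rightarrow> ('a \<Rightarrow> 'a) \<Rightarrow> real" where
  "neq_measure f g = measure M {x \<in> space M. f x \<noteq> g x}"

lemma neq_measure_cong:
  assumes "f \<in> MB" "g \<in> MB" "f' \<in> MB" "g' \<in> MB" "AE x in M. f x = f' x" "AE x in M. g x = g' x"
  shows "neq_measure f g = neq_measure f' g'"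
proof -
  have "AE x in M. x \<in> {x \<in> space M. f x \<noteq> g x} \<longleftrightarrow> x \<in> {x \<in> space M. f' x \<noteq> g' x}"
    using assms(5,6) by eventually_elim simp
  then show ?thesis
    unfolding neq_measure_def
    by (rule finite_measure_eq_AE[OF _ sets_neq_MB[OF assms(1,2)] sets_neq_MB[OF assms(3,4)]])
qed

lemma dist_u_cls:
  assumes "f \<in> MB" "g \<in> MB"
  shows "dist_u M (cls f) (cls g) = neq_measure f g"
proof -
  have *: "(SOME f'. f' \<in> cls f) \<in> MB \<and> (AE x in M. (SOME f'. f' \<in> cls f) x = f x)" if f: "f \<in> MB" for f
  proof -
    have "f \<in> cls f" using cls_iff[OF f] f by simp
    then have "(SOME f'. f' \<in> cls f) \<in> cls f"
      by (rule someI[of "\<lambda>f'. f' \<in> cls f"])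
    then show ?thesis unfolding cls_iff[OF f] .
  qed
  have "dist_u M (cls f) (cls g) = neq_measure (SOME f'. f' \<in> cls f) (SOME g'. g' \<in> cls g)"
    by (simp add: dist_u_def neq_measure_def)
  also have "\<dots> = neq_measure f g"
    using *[OF assms(1)] *[OF assms(2)] assms by (intro neq_measure_cong) (blast+)
  finally show ?thesis .
qed

lemma neq_measure_triangle:
  assumes "f \<in> MB" "g \<in> MB" "h \<in> MB"
  shows "neq_measure f h \<le> neq_measure f g + neq_measure g h"
proof -
  have "neq_measure f h \<le> measure M ({x \<in> space M. f x \<noteq> g x} \<union> {x \<in> space M. g x \<noteq> h x})"
    unfolding neq_measure_def using assms by (intro finite_measure_mono) auto
  also have "\<dots> \<le> neq_measure f g + neq_measure g h"
    unfolding neq_measure_def using assms by (intro measure_Un_le) auto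
  finally show ?thesis .
qed

lemma neq_measure_eq_0:
  assumes "f \<in> MB" "g \<in> MB"
  shows "neq_measure f g = 0 \<longleftrightarrow> (AE x in M. f x = g x)"
  unfolding neq_measure_def using assms by (subst prob_eq_0) auto

sublocale D: Metric_space "carrier (mp_aut M)" "dist_u M"
proof
  show "0 \<le> dist_u M S T" for S T by (simp add: dist_u_def)
  show "dist_u M S T = dist_u M T S" for S T by (simp add: dist_u_def eq_commute)
  show "dist_u M S T = 0 \<longleftrightarrow> S = T" if "S \<in> carrier (mp_aut M)" "T \<in> carrier (mp_aut M)" for S T
  proof -
    obtain f g where fg: "f \<in> MB" "S = cls f" "g \<in> MB" "T = cls g"
      using \<open>S \<in> _\<close> \<open>T \<in> _\<close> unfolding carrier_mp_aut by blast
    show ?thesis unfolding fg(2,4) using fg(1,3) by (simp only: dist_u_cls neq_measure_eq_0 cls_eq_iff)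
  qed
  show "dist_u M S V \<le> dist_u M S T + dist_u M T V"
    if "S \<in> carrier (mp_aut M)" "T \<in> carrier (mp_aut M)" "V \<in> carrier (mp_aut M)" for S T V
    using that by (auto simp: carrier_mp_aut dist_u_cls intro: neq_measure_triangle)
qed

lemma uniform_topology_eq: "uniform_topology M = D.mtopology"
  by (simp add: uniform_topology_def)

lemma neq_measure_comp_left:
  assumes "f \<in> MB" "g \<in> MB" "h \<in> MB"
  shows "neq_measure (h \<odot> f) (h \<odot> g) = neq_measure f g"
proof -
  have "{x \<in> space M. (h \<odot> f) x \<noteq> (h \<odot> g) x} = {x \<in> space M. f x \<noteq> g x}"
    using assms by (auto simp: mcomp_apply MB_inj MB_space)
  then show ?thesis by (simp add: neq_measure_def)
qed

lemma neq_measure_comp_right: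
  assumes "f \<in> MB" "g \<in> MB" "h \<in> MB"
  shows "neq_measure (f \<odot> h) (g \<odot> h) = neq_measure f g"
proof -
  have "{x \<in> space M. (f \<odot> h) x \<noteq> (g \<odot> h) x} = h -` {x \<in> space M. f x \<noteq> g x} \<inter> space M"
    using assms by (auto simp: mcomp_apply MB_space)
  then show ?thesis using emeasure_vimage[OF assms(3), of "{x \<in> space M. f x \<noteq> g x}"] assms
    by (simp add: neq_measure_def measure_def)
qed

lemma dist_u_left:
  assumes "F \<in> carrier (mp_aut M)" "H \<in> carrier (mp_aut M)" "K \<in> carrier (mp_aut M)"
  shows "dist_u M (K \<otimes>\<^bsub>mp_aut M\<^esub> F) (K \<otimes>\<^bsub>mp_aut M\<^esub> H) = dist_u M F H"
  using assms by (auto simp: carrier_mp_aut dist_u_cls neq_measure_comp_left simp flip: cls.hom_mult)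

lemma dist_u_right:
  assumes "F \<in> carrier (mp_aut M)" "H \<in> carrier (mp_aut M)" "K \<in> carrier (mp_aut M)"
  shows "dist_u M (F \<otimes>\<^bsub>mp_aut M\<^esub> K) (H \<otimes>\<^bsub>mp_aut M\<^esub> K) = dist_u M F H"
  using assms by (auto simp: carrier_mp_aut dist_u_cls neq_measure_comp_right simp flip: cls.hom_mult)

lemma dist_u_mult:
  assumes "F \<in> carrier (mp_aut M)" "H \<in> carrier (mp_aut M)" "F' \<in> carrier (mp_aut M)" "H' \<in> carrier (mp_aut M)"
  shows "dist_u M (F \<otimes>\<^bsub>mp_aut M\<^esub> H) (F' \<otimes>\<^bsub>mp_aut M\<^esub> H') \<le> dist_u M F F' + dist_u M H H'"
  using D.triangle[of "F \<otimes>\<^bsub>mp_aut M\<^esub> H" "F' \<otimes>\<^bsub>mp_aut M\<^esub> H" "F' \<otimes>\<^bsub>mp_aut M\<^esub> H'"] assms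
  by (simp add: dist_u_left dist_u_right)

text \<open>Bi-invariance: multiplying by the inverse of \<open>F\<close> on the left and by the
  inverse of \<open>H\<close> on the right turns the pair \<open>F\<close>, \<open>H\<close> into
  the pair of inverses in the opposite order.\<close>

lemma dist_u_inv:
  assumes F: "F \<in> carrier (mp_aut M)" and H: "H \<in> carrier (mp_aut M)"
  shows "dist_u M (inv\<^bsub>mp_aut M\<^esub> F) (inv\<^bsub>mp_aut M\<^esub> H) = dist_u M F H"
proof -
  have "dist_u M F H = dist_u M (inv\<^bsub>mp_aut M\<^esub> F \<otimes>\<^bsub>mp_aut M\<^esub> F) (inv\<^bsub>mp_aut M\<^esub> F \<otimes>\<^bsub>mp_aut M\<^esub> H)"
    using assms by (simp only: dist_u_left A.inv_closed)
  also have "\<dots> = dist_u M (\<one>\<^bsub>mp_aut M\<^esub> \<otimes>\<^bsub>mp_aut M\<^esub> inv\<^bsub>mp_aut M\<^esub> H) (inv\<^bsub>mp_aut M\<^esub> F \<otimes>\<^bsub>mp_aut M\<^esub> H \<otimes>\<^bsub>mp_aut M\<^esub> inv\<^bsub>mp_aut M\<^esub> H)"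
    using assms by (subst dist_u_right) auto
  also have "\<dots> = dist_u M (inv\<^bsub>mp_aut M\<^esub> H) (inv\<^bsub>mp_aut M\<^esub> F)"
    using assms by (simp add: A.m_assoc)
  finally show ?thesis by (simp add: D.commute)
qed

section \<open>Gluing of maps and completeness\<close>

text \<open>The cover may overlap; \<open>disjointed\<close> makes it a partition. The bijection
  \<open>f\<close> keeps the images of its parts disjoint and acts on each part as a
  measure-preserving map, so countable additivity gives invariance of the measure. The same
  decomposition shows that images of measurable sets are measurable, which is measurability of the
  inverse.\<close>

lemma glue_MB:
  fixes h :: "nat \<Rightarrow> 'a \<Rightarrow> 'a" and C :: "nat \<Rightarrow> 'a set"
  assumes h: "\<And>k. h k \<in> MB" and C: "\<And>k. C k \<in> sets M" "(\<Union>k. C k) = space M"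
    and f: "bij_betw f (space M) (space M)" "f \<in> extensional (space M)"
    and fh: "\<And>k x. x \<in> C k \<Longrightarrow> f x = h k x"
  shows "f \<in> MB"
proof -
  define P where "P = disjointed C"
  have P: "P k \<in> sets M" "(\<Union>k. P k) = space M" "disjoint_family P" "P k \<subseteq> C k" for k
    using C sets.range_disjointed_sets[of C M]
    by (auto simp: P_def UN_disjointed_eq disjoint_family_disjointed disjointed_subset)
  have Psp: "P k \<subseteq> space M" for k using P(2) by blast
  have fP: "f x = h k x" if "x \<in> P k" for k x using fh P(4) that by blast
  have Pex: "\<exists>k. x \<in> P k" if "x \<in> space M" for x using P(2) that by blast
  have vim: "f -` B \<inter> space M = (\<Union>k. (h k -` B \<inter> space M) \<inter> P k)" for B
  proof (intro Set.set_eqI iffI)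
    fix x assume x: "x \<in> f -` B \<inter> space M"
    then obtain k where "x \<in> P k" using Pex by blast
    then show "x \<in> (\<Union>k. (h k -` B \<inter> space M) \<inter> P k)" using x fP[of x k] by auto
  next
    fix x assume "x \<in> (\<Union>k. (h k -` B \<inter> space M) \<inter> P k)"
    then obtain k where "h k x \<in> B" "x \<in> space M" "x \<in> P k" by blast
    then show "x \<in> f -` B \<inter> space M" using fP[of x k] by simp
  qed
  have hvim: "h k -` B \<inter> space M \<in> sets M" if "B \<in> sets M" for B k
    by (rule measurable_sets[OF MB_D(1)[OF h] that])
  have fm: "f \<in> measurable M M"
  proof (rule measurableI)
    show "f x \<in> space M" if "x \<in> space M" for x using f(1) that by (rule bij_betwE[rule_format])
    show "f -` B \<inter> space M \<in> sets M" if "B \<in> sets M" for B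
      unfolding vim using hvim[OF that] P(1) by (intro sets.countable_UN sets.Int) auto
  qed
  have fi: "f ` B = (\<Union>k. h k ` (B \<inter> P k))" if "B \<subseteq> space M" for B
  proof -
    have "f ` B = (\<Union>k. f ` (B \<inter> P k))" using that Pex by blast
    also have "\<dots> = (\<Union>k. h k ` (B \<inter> P k))" using fP by (intro SUP_cong image_cong) auto
    finally show ?thesis .
  qed
  have fim: "f ` B \<in> sets M" if B: "B \<in> sets M" for B
    unfolding fi[OF sets.sets_into_space[OF B]]
    by (intro sets.countable_UN image_subsetI image_MB(1)[OF h] sets.Int B P(1))
  have im: "inv_into (space M) f \<in> measurable M M"
  proof (rule measurableI)
    show "inv_into (space M) f x \<in> space M" if "x \<in> space M" for x
      using f(1) that by (metis bij_betw_imp_surj_on inv_into_into)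
    fix B assume B: "B \<in> sets M"
    have "inv_into (space M) f -` B \<inter> space M = f ` B"
    proof
      show "inv_into (space M) f -` B \<inter> space M \<subseteq> f ` B"
      proof
        fix x assume "x \<in> inv_into (space M) f -` B \<inter> space M"
        then show "x \<in> f ` B"
          using f(1) by (intro image_eqI[of _ _ "inv_into (space M) f x"]) (auto simp: bij_betw_def f_inv_into_f)
      qed
      show "f ` B \<subseteq> inv_into (space M) f -` B \<inter> space M"
      proof
        fix x assume "x \<in> f ` B"
        then obtain y where "y \<in> B" "x = f y" by blast
        moreover from this have "y \<in> space M" using sets.sets_into_space[OF B] by blast
        ultimately show "x \<in> inv_into (space M) f -` B \<inter> space M"
          using f(1) by (auto simp: bij_betw_def)
      qed
    qed
    then show "inv_into (space M) f -` B \<inter> space M \<in> sets M" using fim[OF B] by simp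
  qed
  have em: "emeasure M (f ` B) = emeasure M B" if B: "B \<in> sets M" for B
  proof -
    have "disjoint_family (\<lambda>k. h k ` (B \<inter> P k))"
      unfolding disjoint_family_on_def
    proof (intro ballI impI)
      fix i j :: nat assume ij: "i \<noteq> j"
      have "h k ` (B \<inter> P k) = f ` (B \<inter> P k)" for k using fP by (intro image_cong) auto
      moreover have "f ` (B \<inter> P i) \<inter> f ` (B \<inter> P j) = f ` ((B \<inter> P i) \<inter> (B \<inter> P j))"
        using f(1) Psp by (intro inj_on_image_Int[symmetric, of _ "space M"]) (auto simp: bij_betw_def)
      moreover have "P i \<inter> P j = {}" using P(3) ij by (auto simp: disjoint_family_on_def)
      ultimately show "h i ` (B \<inter> P i) \<inter> h j ` (B \<inter> P j) = {}" by auto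
    qed
    then have "emeasure M (f ` B) = (\<Sum>k. emeasure M (h k ` (B \<inter> P k)))"
      unfolding fi[OF sets.sets_into_space[OF B]]
      by (intro suminf_emeasure[symmetric] image_subsetI image_MB(1)[OF h] sets.Int B P(1))
    also have "\<dots> = (\<Sum>k. emeasure M (B \<inter> P k))"
      by (intro suminf_cong image_MB(2)[OF h] sets.Int B P(1))
    also have "\<dots> = emeasure M (\<Union>k. B \<inter> P k)"
      using B P(1,3) by (intro suminf_emeasure) (auto simp: disjoint_family_on_def)
    also have "(\<Union>k. B \<inter> P k) = B" using P(2) sets.sets_into_space[OF B] by blast
    finally show ?thesis .
  qed
  have "distr M M f = M"
  proof (rule measure_eqI)
    fix B assume "B \<in> sets (distr M M f)"
    then have B: "B \<in> sets M" by simp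
    have "f ` (f -` B \<inter> space M) = B"
    proof
      show "B \<subseteq> f ` (f -` B \<inter> space M)"
      proof
        fix y assume y: "y \<in> B"
        then have "y \<in> f ` space M"
          using f(1) sets.sets_into_space[OF B] by (auto simp: bij_betw_def)
        then show "y \<in> f ` (f -` B \<inter> space M)" using y by auto
      qed
    qed auto
    then show "emeasure (distr M M f) B = emeasure M B"
      using em[of "f -` B \<inter> space M"] measurable_sets[OF fm B] B by (simp add: emeasure_distr fm)
  qed simp
  then show ?thesis using f fm im by (simp add: carrier_mp_bij Bij_def)
qed

text \<open>Deleting the points that some \<open>h k\<close> maps out of the current set costs only
  a null set; the intersection of the iterates is closed under all \<open>h k\<close>.\<close>

lemma invariant_conull_set:
  fixes h :: "nat \<Rightarrow> 'a \<Rightarrow> 'a"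
  assumes h: "\<And>k. h k \<in> MB" and P: "P \<in> sets M" "AE x in M. x \<in> P"
  obtains Y where "Y \<in> sets M" "Y \<subseteq> P" "AE x in M. x \<in> Y" "\<And>k x. x \<in> Y \<Longrightarrow> h k x \<in> Y"
proof -
  define Q where "Q = rec_nat P (\<lambda>_ S. S \<inter> (\<Inter>k. h k -` S \<inter> space M))"
  have Q0: "Q 0 = P" and QS: "Q (Suc l) = Q l \<inter> (\<Inter>k. h k -` Q l \<inter> space M)" for l
    by (simp_all add: Q_def)
  have Q: "Q l \<in> sets M \<and> (AE x in M. x \<in> Q l)" for l
  proof (induction l)
    case 0
    then show ?case using P by (simp add: Q0)
  next
    case (Suc l)
    have "h k -` Q l \<inter> space M \<in> sets M" for k
      using Suc by (intro measurable_sets[OF MB_D(1)[OF h]]) simp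
    then have "Q (Suc l) \<in> sets M"
      unfolding QS using Suc by (intro sets.Int[of "Q l"] sets.countable_INT') auto
    moreover have "AE x in M. \<forall>k. h k x \<in> Q l"
      unfolding AE_all_countable using AE_mp_bij[OF h, of "\<lambda>x. x \<in> Q l"] Suc by simp
    then have "AE x in M. x \<in> Q (Suc l)"
      using AE_space conjunct2[OF Suc] by eventually_elim (simp add: QS)
    ultimately show ?case by simp
  qed
  show thesis
  proof (rule that[of "\<Inter>l. Q l"])
    show "(\<Inter>l. Q l) \<in> sets M" using Q by (intro sets.countable_INT') auto
    show "(\<Inter>l. Q l) \<subseteq> P" using Q0 by blast
    have "AE x in M. \<forall>l. x \<in> Q l" unfolding AE_all_countable using Q by simp
    then show "AE x in M. x \<in> (\<Inter>l. Q l)" by eventually_elim simp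
    show "h k x \<in> (\<Inter>l. Q l)" if "x \<in> (\<Inter>l. Q l)" for k x
    proof
      fix l
      have "x \<in> Q (Suc l)" using that by blast
      then show "h k x \<in> Q l" by (simp add: QS)
    qed
  qed
qed

text \<open>By Borel--Cantelli the sequences \<open>f k\<close> and their inverses are almost everywhere eventually
  constant; on a conull set invariant under all of them the two limits are mutually inverse, and
  off that set the limit is made the identity, so that it is an honest bijection.\<close>

lemma fast_Cauchy_limit:
  fixes f :: "nat \<Rightarrow> 'a \<Rightarrow> 'a"
  assumes f: "\<And>k. f k \<in> MB" and fast: "\<And>k. neq_measure (f k) (f (Suc k)) \<le> (1/2) ^ k"
  obtains F where "F \<in> MB" "(\<lambda>k. neq_measure (f k) F) \<longlonglongrightarrow> 0"
proof -
  \<comment> \<open>The inverses are controlled as well, at the same cost by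
    \<open>dist_u_inv\<close>, since the inverse of the limit is obtained as their limit.\<close>
  define A where "A k = {x \<in> space M. f k x \<noteq> f (Suc k) x} \<union>
    {x \<in> space M. minv (f k) x \<noteq> minv (f (Suc k)) x}" for k
  have fi: "minv (f k) \<in> MB" for k using f by simp
  have A: "A k \<in> sets M" for k
    unfolding A_def using sets_neq_MB[OF f f] sets_neq_MB[OF fi fi] by (rule sets.Un)
  have inv_eq: "neq_measure (minv (f k)) (minv (f (Suc k))) = neq_measure (f k) (f (Suc k))" for k
    using dist_u_inv[of "cls (f k)" "cls (f (Suc k))"] f fi
    by (simp add: dist_u_cls flip: cls.hom_inv)
  have Ale: "measure M (A k) \<le> 2 * (1/2) ^ k" for k
  proof -
    have "measure M (A k) \<le> neq_measure (f k) (f (Suc k)) + neq_measure (minv (f k)) (minv (f (Suc k)))"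
      unfolding A_def neq_measure_def
      by (intro measure_Un_le sets_neq_MB[OF f f] sets_neq_MB[OF fi fi])
    then show ?thesis using fast[of k] inv_eq[of k] by simp
  qed
  have "summable (\<lambda>k. measure M (A k))"
    by (rule summable_comparison_test'[where g = "\<lambda>k. 2 * (1/2) ^ k" and N = 0]) 
      (use Ale in \<open>auto intro!: summable_mult summable_geometric\<close>)
  then have "AE x in M. eventually (\<lambda>n. x \<in> space M - A n) sequentially"
    using A emeasure_finite by (intro borel_cantelli_AE1) (auto simp: less_top[symmetric])
  then have ev: "AE x in M. \<exists>K. \<forall>k\<ge>K. x \<notin> A k"
    unfolding eventually_sequentially by eventually_elim blast
  define P where "P = (\<Union>K. \<Inter>k\<in>{K..}. space M - A k)"
  have Ps: "P \<in> sets M" unfolding P_def using A by (intro sets.countable_UN image_subsetI sets.countable_INT') auto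
  have Pae: "AE x in M. x \<in> P"
    using ev AE_space by eventually_elim (auto simp: P_def)
  \<comment> \<open>One sequence interleaving the maps and their inverses, so that the invariant set
    is stable under both.\<close>
  define h where "h n = (if even n then f (n div 2) else minv (f (n div 2)))" for n
  have h: "h n \<in> MB" for n using f fi by (simp add: h_def)
  obtain Y where Y: "Y \<in> sets M" "Y \<subseteq> P" "AE x in M. x \<in> Y" "\<And>k x. x \<in> Y \<Longrightarrow> h k x \<in> Y"
    by (rule invariant_conull_set[OF h Ps Pae]) (rule that)
  have Ysp: "x \<in> space M" if "x \<in> Y" for x using Y(1) that sets.sets_into_space by blast
  have fY: "f k x \<in> Y" and fiY: "minv (f k) x \<in> Y" if "x \<in> Y" for k x
    using Y(4)[OF that, of "2 * k"] Y(4)[OF that, of "Suc (2 * k)"] by (simp_all add: h_def)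
  \<comment> \<open>A stage from which both sequences are constant at \<open>x\<close>.\<close>
  define K where "K x = (LEAST K. \<forall>k\<ge>K. x \<notin> A k)" for x
  have K: "\<forall>k\<ge>K x. x \<notin> A k" if "x \<in> Y" for x
  proof -
    have "x \<in> P" using Y(2) that by (rule subsetD)
    then obtain L where "x \<in> (\<Inter>k\<in>{L..}. space M - A k)" unfolding P_def by (rule UN_E)
    then have "\<exists>K. \<forall>k\<ge>K. x \<notin> A k" by (intro exI[of _ L]) auto
    then show ?thesis unfolding K_def by (rule LeastI_ex)
  qed
  have stable: "f k x = f L x \<and> minv (f k) x = minv (f L) x"
    if "x \<in> space M" "\<forall>k\<ge>L. x \<notin> A k" "k \<ge> L" for x k L
    using \<open>k \<ge> L\<close>
  proof (induction k rule: dec_induct)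
    case (step k)
    have "x \<notin> A k" using that(2) step.hyps by blast
    then have "f (Suc k) x = f k x" "minv (f (Suc k)) x = minv (f k) x"
      using that(1) by (simp_all add: A_def)
    then show ?case using step.IH by simp
  qed simp
  define F where "F = (\<lambda>x\<in>space M. if x \<in> Y then f (K x) x else x)"
  define F' where "F' = (\<lambda>x\<in>space M. if x \<in> Y then minv (f (K x)) x else x)"
  have FY: "F x = f k x" "F' x = minv (f k) x" if "x \<in> Y" "k \<ge> K x" for x k
    using stable[OF Ysp[OF that(1)] K[OF that(1)] that(2)] that(1) Ysp
    by (simp_all add: F_def F'_def)
  have FinY: "F x \<in> Y" "F' x \<in> Y" if "x \<in> Y" for x
    using FY[OF that order_refl] fY[OF that] fiY[OF that] by simp_all
  have FF: "F' (F x) = x" "F (F' x) = x" if x: "x \<in> Y" for x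
  proof -
    \<comment> \<open>Late enough for both \<open>x\<close> and \<open>F x\<close>, so that the two
      limits are values of one map and of its own inverse.\<close>
    let ?k = "max (K x) (K (F x))"
    have "F' (F x) = minv (f ?k) (f ?k x)"
      using FY(1)[OF x, of ?k] FY(2)[OF FinY(1)[OF x], of ?k] by simp
    then show "F' (F x) = x" using f x Ysp by (simp add: minv_left)
    let ?k = "max (K x) (K (F' x))"
    have "F (F' x) = f ?k (minv (f ?k) x)"
      using FY(2)[OF x, of ?k] FY(1)[OF FinY(2)[OF x], of ?k] by simp
    then show "F (F' x) = x" using f x Ysp by (simp add: minv_right)
  qed
  have off: "F x = x" "F' x = x" if "x \<in> space M" "x \<notin> Y" for x
    using that by (simp_all add: F_def F'_def)
  have bij: "bij_betw F (space M) (space M)"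
  proof (rule bij_betw_byWitness[where f' = F'])
    show "\<forall>x\<in>space M. F' (F x) = x" "\<forall>x\<in>space M. F (F' x) = x"
      using FF off by metis+
    show "F ` space M \<subseteq> space M" "F' ` space M \<subseteq> space M"
      using FinY off Ysp by (metis image_subsetI)+
  qed
  \<comment> \<open>Index 0 is the part off \<open>Y\<close>, where the limit is the identity; index
    \<open>k + 1\<close> collects the points of \<open>Y\<close> that are stable from stage
    \<open>k\<close> on, where the limit is \<open>f k\<close>.\<close>
  define C where "C n = (case n of 0 \<Rightarrow> space M - Y | Suc k \<Rightarrow> Y \<inter> (\<Inter>j\<in>{k..}. space M - A j))" for n
  define g where "g n = (case n of 0 \<Rightarrow> ident | Suc k \<Rightarrow> f k)" for n
  have Cs: "C n \<in> sets M" for n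
  proof (cases n)
    case 0
    then show ?thesis using Y(1) by (simp add: C_def)
  next
    case (Suc k)
    have "(\<Inter>j\<in>{k..}. space M - A j) \<in> sets M" using A by (intro sets.countable_INT') auto
    then show ?thesis using Y(1) Suc by (simp add: C_def)
  qed
  have "F \<in> MB"
  proof (rule glue_MB[of g C])
    show "g n \<in> MB" for n using f by (simp add: g_def split: nat.split)
    show "C n \<in> sets M" for n by (rule Cs)
    show "(\<Union>n. C n) = space M"
    proof (intro equalityI subsetI)
      fix x assume "x \<in> (\<Union>n. C n)"
      then show "x \<in> space M" using sets.sets_into_space[OF Cs] by blast
    next
      fix x assume x: "x \<in> space M"
      show "x \<in> (\<Union>n. C n)"
      proof (cases "x \<in> Y")
        case True
        then have "x \<in> C (Suc (K x))" using K[OF True] x by (simp add: C_def)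
        then show ?thesis by blast
      next
        case False
        then have "x \<in> C 0" using x by (simp add: C_def)
        then show ?thesis by blast
      qed
    qed
    show "F \<in> extensional (space M)" by (simp add: F_def)
    show "F x = g n x" if "x \<in> C n" for n x
    proof (cases n)
      case 0
      then show ?thesis using that off(1) by (simp add: C_def g_def ident_apply)
    next
      case (Suc k)
      then have x: "x \<in> Y" "\<forall>j\<ge>k. x \<notin> A j" using that by (auto simp: C_def)
      have "K x \<le> k" unfolding K_def using x(2) by (rule Least_le)
      then show ?thesis using FY(1)[OF x(1)] Suc by (simp add: g_def)
    qed
  qed (rule bij)
  moreover have "(\<lambda>k. neq_measure (f k) F) \<longlonglongrightarrow> 0"
  proof -
    \<comment> \<open>Points at which some change still happens at stage \<open>k\<close> or later.
      These sets decrease to a null set, and almost everywhere off \<open>B k\<close> the limit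
      equals \<open>f k\<close>.\<close>
    define B where "B k = (\<Union>j\<in>{k..}. A j)" for k
    have B: "B k \<in> sets M" for k unfolding B_def using A by (intro sets.countable_UN') auto
    have "(\<lambda>k. measure M (B k)) \<longlonglongrightarrow> measure M (\<Inter>k. B k)"
    proof (rule finite_Lim_measure_decseq)
      show "range B \<subseteq> sets M" using B by blast
      show "decseq B" unfolding decseq_def B_def by (intro allI impI UN_mono) auto
    qed
    moreover have "measure M (\<Inter>k. B k) = 0"
    proof -
      have "AE x in M. x \<notin> (\<Inter>k. B k)"
        using ev by eventually_elim (auto simp: B_def)
      moreover have "(\<Inter>k. B k) \<in> sets M" using B by (intro sets.countable_INT') auto
      ultimately show ?thesis by (simp add: prob_eq_0)
    qed
    ultimately have lim: "(\<lambda>k. measure M (B k)) \<longlonglongrightarrow> 0" by simp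
    have le: "neq_measure (f k) F \<le> measure M (B k)" for k
      unfolding neq_measure_def
    proof (rule finite_measure_mono_AE[OF _ B])
      show "AE x in M. x \<in> {x \<in> space M. f k x \<noteq> F x} \<longrightarrow> x \<in> B k"
        using Y(3)
      proof eventually_elim
        case (elim x)
        show ?case
        proof (cases "x \<in> B k")
          case False
          then have "\<forall>j\<ge>k. x \<notin> A j" by (auto simp: B_def)
          then have "K x \<le> k" unfolding K_def by (rule Least_le)
          then show ?thesis using FY(1)[OF elim, of k] by simp
        qed simp
      qed
    qed
    show ?thesis
      by (rule tendsto_sandwich[OF _ _ tendsto_const lim])
        (use le in \<open>auto simp: neq_measure_def\<close>)
  qed
  ultimately show thesis using that by blast
qed

text \<open>A Cauchy sequence converges once a subsequence does, so it suffices to pass to one with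
  successive distances below \<open>(1/2) ^ k\<close>.\<close>

lemma mcomplete_mp_aut: "D.mcomplete"
  unfolding D.mcomplete_def
proof (intro allI impI)
  fix \<sigma> assume \<sigma>: "D.MCauchy \<sigma>"
  then have "\<forall>k. \<exists>N. \<forall>n n'. N \<le> n \<longrightarrow> N \<le> n' \<longrightarrow> dist_u M (\<sigma> n) (\<sigma> n') < (1/2) ^ k"
    unfolding D.MCauchy_def by auto
  then obtain N where N: "\<And>k n n'. N k \<le> n \<Longrightarrow> N k \<le> n' \<Longrightarrow> dist_u M (\<sigma> n) (\<sigma> n') < (1/2) ^ k"
    by metis
  have "\<exists>r. \<forall>k. N k \<le> r k \<and> r k < r (Suc k)"
  proof (rule dependent_nat_choice)
    show "\<exists>x. N 0 \<le> x" by blast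
    show "\<exists>y. N (Suc k) \<le> y \<and> x < y" for x k
      by (rule exI[of _ "max (N (Suc k)) (Suc x)"]) simp
  qed
  then obtain r where r: "\<And>k. N k \<le> r k" "\<And>k. r k < r (Suc k)" by blast
  have mono: "strict_mono r" using r(2) by (simp add: strict_mono_Suc_iff)
  have rng: "range \<sigma> \<subseteq> cls ` MB"
    using \<sigma>[unfolded D.MCauchy_def, THEN conjunct1] unfolding carrier_mp_aut .
  have "\<exists>f. f \<in> MB \<and> \<sigma> (r k) = cls f" for k
  proof -
    have "\<sigma> (r k) \<in> cls ` MB" using rng by (rule subsetD) (rule rangeI)
    then obtain f where "\<sigma> (r k) = cls f" "f \<in> MB" by (rule imageE)
    then show ?thesis by (intro exI[of _ f] conjI)
  qed
  then obtain f where f: "\<And>k. f k \<in> MB" "\<And>k. \<sigma> (r k) = cls (f k)" by metis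
  have fast: "neq_measure (f k) (f (Suc k)) \<le> (1/2) ^ k" for k
  proof -
    have "N k \<le> r (Suc k)" using r(1)[of k] r(2)[of k] by linarith
    then have "dist_u M (\<sigma> (r k)) (\<sigma> (r (Suc k))) < (1/2) ^ k" using N r(1) by blast
    then show ?thesis using f by (simp add: dist_u_cls)
  qed
  obtain F where F: "F \<in> MB" "(\<lambda>k. neq_measure (f k) F) \<longlonglongrightarrow> 0"
    by (rule fast_Cauchy_limit[OF f(1) fast]) (rule that)
  have "limitin D.mtopology (\<sigma> \<circ> r) (cls F) sequentially"
    unfolding D.limit_metric_sequentially
  proof (intro conjI allI impI)
    show "cls F \<in> carrier (mp_aut M)" using F by simp
    fix \<epsilon> :: real assume "\<epsilon> > 0"
    then obtain L where "\<forall>k\<ge>L. norm (neq_measure (f k) F - 0) < \<epsilon>"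
      using LIMSEQ_D[OF F(2)] by blast
    then have "(\<sigma> \<circ> r) k \<in> carrier (mp_aut M) \<and> dist_u M ((\<sigma> \<circ> r) k) (cls F) < \<epsilon>" if "k \<ge> L" for k
      using that f F(1) by (auto simp: dist_u_cls)
    then show "\<exists>L. \<forall>k\<ge>L. (\<sigma> \<circ> r) k \<in> carrier (mp_aut M) \<and> dist_u M ((\<sigma> \<circ> r) k) (cls F) < \<epsilon>"
      by blast
  qed
  from D.MCauchy_convergent_subsequence[OF \<sigma> mono this]
  show "\<exists>x. limitin D.mtopology \<sigma> x sequentially" by (rule exI)
qed

section \<open>Aperiodic elements\<close>

lemma ipow_fixed:
  assumes "f \<in> MB" "x \<in> space M" "f x = x"
  shows "ipow f q x = x"
proof (induction q rule: int_induct[where k = 0])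
  case base
  then show ?case using assms by (simp add: ident_apply)
next
  case (step1 i)
  then show ?case using ipow_add_apply[OF assms(1,2), of i 1] assms by simp
next
  case (step2 i)
  have "ipow f (- 1) x = x"
    using assms minv_left[OF assms(1,2)] by (simp add: G.int_pow_neg)
  then show ?case using ipow_add_apply[OF assms(1,2), of i "- 1"] step2 by simp
qed

lemma infinite_orbit_iff:
  assumes f: "f \<in> MB" and x: "x \<in> space M"
  shows "infinite {ipow f k x | k. True} \<longleftrightarrow> (\<forall>k. k \<noteq> 0 \<longrightarrow> ipow f k x \<noteq> x)"
proof
  assume inf: "infinite {ipow f k x | k. True}"
  show "\<forall>k. k \<noteq> 0 \<longrightarrow> ipow f k x \<noteq> x"
  proof (intro allI impI notI)
    fix k :: int assume k: "k \<noteq> 0" "ipow f k x = x"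
    have fk: "ipow f k \<in> MB" using f by simp
    have "ipow f i x \<in> (\<lambda>i. ipow f i x) ` {-\<bar>k\<bar>..\<bar>k\<bar>}" for i
    proof
      have "ipow (ipow f k) (i div k) x = x" by (rule ipow_fixed[OF fk x k(2)])
      then have "ipow f (i - i mod k) x = x"
        using f by (simp add: G.int_pow_pow minus_mod_eq_mult_div)
      then show "ipow f i x = ipow f (i mod k) x" using ipow_eq_iff[OF f x] by blast
      \<comment> \<open>A nonzero remainder has the sign of \<open>k\<close>, hence the symmetric
        interval.\<close>
      show "i mod k \<in> {-\<bar>k\<bar>..\<bar>k\<bar>}"
      proof (cases "k > 0")
        case True
        show ?thesis using pos_mod_bound[OF True, of i] pos_mod_sign[OF True, of i]
          unfolding atLeastAtMost_iff by linarith
      next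
        case False
        then have "k < 0" using k(1) by simp
        show ?thesis using neg_mod_bound[OF \<open>k < 0\<close>, of i] neg_mod_sign[OF \<open>k < 0\<close>, of i]
          unfolding atLeastAtMost_iff by linarith
      qed
    qed
    then have "{ipow f k x | k. True} \<subseteq> (\<lambda>i. ipow f i x) ` {-\<bar>k\<bar>..\<bar>k\<bar>}" by blast
    then show False using inf by (meson finite_atLeastAtMost_int finite_imageI finite_subset)
  qed
next
  assume *: "\<forall>k. k \<noteq> 0 \<longrightarrow> ipow f k x \<noteq> x"
  have "inj (\<lambda>k. ipow f k x)"
    using * ipow_eq_iff[OF f x] by (intro injI) (metis eq_iff_diff_eq_0)
  then have "infinite (range (\<lambda>k. ipow f k x))"
    using finite_imageD infinite_UNIV_int by blast
  moreover have "range (\<lambda>k. ipow f k x) = {ipow f k x | k. True}" by blast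
  ultimately show "infinite {ipow f k x | k. True}" by simp
qed

definition aperiodic :: "('a \<Rightarrow> 'a) \<Rightarrow> bool" where
  "aperiodic f \<longleftrightarrow> (AE x in M. \<forall>k::int. k \<noteq> 0 \<longrightarrow> ipow f k x \<noteq> x)"

lemma neq_measure_eq_1:
  assumes "f \<in> MB" "g \<in> MB"
  shows "neq_measure f g = 1 \<longleftrightarrow> (AE x in M. f x \<noteq> g x)"
proof -
  have "neq_measure f g = 1 \<longleftrightarrow> (AE x in M. x \<in> {x \<in> space M. f x \<noteq> g x})"
    unfolding neq_measure_def by (rule prob_eq_1[OF sets_neq_MB[OF assms]])
  also have "\<dots> \<longleftrightarrow> (AE x in M. f x \<noteq> g x)" by (rule AE_cong) simp
  finally show ?thesis .
qed

text \<open>Aperiodicity becomes a condition on the class and the metric alone, from which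
  closedness and invariance under conjugation can be read off.\<close>

lemma aperiodic_iff_dist:
  assumes f: "f \<in> MB"
  shows "aperiodic f \<longleftrightarrow> (\<forall>k::int. k \<noteq> 0 \<longrightarrow> dist_u M (cls f [^]\<^bsub>mp_aut M\<^esub> k) \<one>\<^bsub>mp_aut M\<^esub> = 1)"
proof -
  have d: "dist_u M (cls f [^]\<^bsub>mp_aut M\<^esub> k) \<one>\<^bsub>mp_aut M\<^esub> = neq_measure (ipow f k) ident" for k :: int
  proof -
    have "cls f [^]\<^bsub>mp_aut M\<^esub> k = cls (ipow f k)" "\<one>\<^bsub>mp_aut M\<^esub> = cls ident"
      using cls.hom_int_pow[OF f] cls.hom_one by simp_all
    then show ?thesis using dist_u_cls[of "ipow f k" ident] f by simp
  qed
  have n: "neq_measure (ipow f k) ident = 1 \<longleftrightarrow> (AE x in M. ipow f k x \<noteq> x)" for k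
  proof -
    have "neq_measure (ipow f k) ident = 1 \<longleftrightarrow> (AE x in M. ipow f k x \<noteq> ident x)"
      using f by (intro neq_measure_eq_1) auto
    also have "\<dots> \<longleftrightarrow> (AE x in M. ipow f k x \<noteq> x)" by (rule AE_cong) (simp add: ident_apply)
    finally show ?thesis .
  qed
  have "(AE x in M. k \<noteq> 0 \<longrightarrow> ipow f k x \<noteq> x) \<longleftrightarrow> (k \<noteq> 0 \<longrightarrow> (AE x in M. ipow f k x \<noteq> x))" for k
    by (cases "k = 0") simp_all
  then show ?thesis unfolding aperiodic_def AE_all_countable d n by simp
qed

lemma APER_eq:
  "APER M = {F \<in> carrier (mp_aut M). \<forall>k::int. k \<noteq> 0 \<longrightarrow> dist_u M (F [^]\<^bsub>mp_aut M\<^esub> k) \<one>\<^bsub>mp_aut M\<^esub> = 1}"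
proof -
  have "APER M = {cls f | f. f \<in> MB \<and> aperiodic f}"
  proof -
    have "(AE x in M. infinite {ipow f k x | k :: int. True}) \<longleftrightarrow> aperiodic f" if "f \<in> MB" for f
      unfolding aperiodic_def by (rule AE_cong) (rule infinite_orbit_iff[OF that])
    then show ?thesis unfolding APER_def by blast
  qed
  also have "\<dots> = {cls f | f. f \<in> MB \<and> (\<forall>k::int. k \<noteq> 0 \<longrightarrow> dist_u M (cls f [^]\<^bsub>mp_aut M\<^esub> k) \<one>\<^bsub>mp_aut M\<^esub> = 1)}"
    using aperiodic_iff_dist by blast
  also have "\<dots> = {F \<in> carrier (mp_aut M). \<forall>k::int. k \<noteq> 0 \<longrightarrow> dist_u M (F [^]\<^bsub>mp_aut M\<^esub> k) \<one>\<^bsub>mp_aut M\<^esub> = 1}"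
  proof -
    have "{h f | f. f \<in> B \<and> Q (h f)} = {F \<in> h ` B. Q F}"
      for h :: "('a \<Rightarrow> 'a) \<Rightarrow> ('a \<Rightarrow> 'a) set" and B Q by blast
    then show ?thesis unfolding carrier_mp_aut .
  qed
  finally show ?thesis .
qed

lemma cls_in_APER_iff:
  assumes f: "f \<in> MB"
  shows "cls f \<in> APER M \<longleftrightarrow> aperiodic f"
proof -
  have "cls f \<in> carrier (mp_aut M)" using f by simp
  then show ?thesis unfolding APER_eq aperiodic_iff_dist[OF f] by blast
qed

lemma dist_u_nat_pow:
  assumes "F \<in> carrier (mp_aut M)" "H \<in> carrier (mp_aut M)"
  shows "dist_u M (F [^]\<^bsub>mp_aut M\<^esub> k) (H [^]\<^bsub>mp_aut M\<^esub> k) \<le> real k * dist_u M F H"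
proof (induction k)
  case (Suc k)
  have "dist_u M (F [^]\<^bsub>mp_aut M\<^esub> Suc k) (H [^]\<^bsub>mp_aut M\<^esub> Suc k)
    \<le> dist_u M (F [^]\<^bsub>mp_aut M\<^esub> k) (H [^]\<^bsub>mp_aut M\<^esub> k) + dist_u M F H"
    using dist_u_mult[of "F [^]\<^bsub>mp_aut M\<^esub> k" F "H [^]\<^bsub>mp_aut M\<^esub> k" H] assms by simp
  then show ?case using Suc by (simp add: algebra_simps)
qed simp

lemma dist_u_int_pow:
  assumes "F \<in> carrier (mp_aut M)" "H \<in> carrier (mp_aut M)"
  shows "dist_u M (F [^]\<^bsub>mp_aut M\<^esub> k) (H [^]\<^bsub>mp_aut M\<^esub> k) \<le> real_of_int \<bar>k\<bar> * dist_u M F H"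
proof (cases "k \<ge> 0")
  case True
  then obtain n where "k = int n" by (metis nonneg_int_cases)
  then show ?thesis using dist_u_nat_pow[OF assms, of n] by (simp add: int_pow_int)
next
  case False
  then obtain n where "k = - int n" by (metis nonpos_int_cases linear)
  then show ?thesis using dist_u_nat_pow[OF assms, of n] assms
    by (simp add: A.int_pow_neg int_pow_int dist_u_inv)
qed

text \<open>Distances are at most 1, so being at distance exactly 1 from the identity is a closed
  condition, and the power maps are Lipschitz. Closedness is what makes the aperiodic part of the
  full group accessible to Baire.\<close>

lemma closedin_APER: "closedin D.mtopology (APER M)"
  unfolding D.closedin_metric
proof (intro conjI allI impI)
  show "APER M \<subseteq> carrier (mp_aut M)" unfolding APER_eq by blast
  fix F assume "F \<in> carrier (mp_aut M) - APER M"
  then obtain k :: int where F: "F \<in> carrier (mp_aut M)" and k: "k \<noteq> 0"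
    "dist_u M (F [^]\<^bsub>mp_aut M\<^esub> k) \<one>\<^bsub>mp_aut M\<^esub> \<noteq> 1"
    unfolding APER_eq by blast
  \<comment> \<open>The gap below 1, divided by the Lipschitz constant \<open>\<bar>k\<bar>\<close>
    of the \<open>k\<close>-th power.\<close>
  define \<delta> where "\<delta> = (1 - dist_u M (F [^]\<^bsub>mp_aut M\<^esub> k) \<one>\<^bsub>mp_aut M\<^esub>) / real_of_int \<bar>k\<bar>"
  have "dist_u M (F [^]\<^bsub>mp_aut M\<^esub> k) \<one>\<^bsub>mp_aut M\<^esub> < 1"
    using k(2) by (simp add: dist_u_def less_le)
  then have "\<delta> > 0" using k(1) by (simp add: \<delta>_def)
  moreover have "disjnt (APER M) (D.mball F \<delta>)"
    unfolding disjnt_iff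
  proof (intro allI notI, elim conjE)
    fix H assume H: "H \<in> APER M" "H \<in> D.mball F \<delta>"
    then have Hc: "H \<in> carrier (mp_aut M)" and d: "dist_u M F H < \<delta>" by auto
    have "dist_u M (H [^]\<^bsub>mp_aut M\<^esub> k) \<one>\<^bsub>mp_aut M\<^esub> \<le>
      dist_u M (H [^]\<^bsub>mp_aut M\<^esub> k) (F [^]\<^bsub>mp_aut M\<^esub> k) + dist_u M (F [^]\<^bsub>mp_aut M\<^esub> k) \<one>\<^bsub>mp_aut M\<^esub>"
      using F Hc by (intro D.triangle) auto
    also have "dist_u M (H [^]\<^bsub>mp_aut M\<^esub> k) (F [^]\<^bsub>mp_aut M\<^esub> k) \<le> real_of_int \<bar>k\<bar> * dist_u M F H"
      using dist_u_int_pow[OF F Hc] by (simp add: D.commute)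
    also have "\<dots> < real_of_int \<bar>k\<bar> * \<delta>" using d k(1) by (intro mult_strict_left_mono) auto
    also have "\<dots> = 1 - dist_u M (F [^]\<^bsub>mp_aut M\<^esub> k) \<one>\<^bsub>mp_aut M\<^esub>" using k(1) by (simp add: \<delta>_def)
    finally have "dist_u M (H [^]\<^bsub>mp_aut M\<^esub> k) \<one>\<^bsub>mp_aut M\<^esub> < 1" by simp
    moreover have "dist_u M (H [^]\<^bsub>mp_aut M\<^esub> k) \<one>\<^bsub>mp_aut M\<^esub> = 1"
      using H(1) k(1) unfolding APER_eq by blast
    ultimately show False by simp
  qed
  ultimately show "\<exists>r>0. disjnt (APER M) (D.mball F r)" by blast
qed

text \<open>Conjugation is an isometric automorphism fixing the identity, so it respects the metric
  description of \<open>APER M\<close>.\<close>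

lemma APER_conj:
  assumes F: "F \<in> APER M" and S: "S \<in> carrier (mp_aut M)"
  shows "S \<otimes>\<^bsub>mp_aut M\<^esub> F \<otimes>\<^bsub>mp_aut M\<^esub> inv\<^bsub>mp_aut M\<^esub> S \<in> APER M"
proof -
  let ?c = "\<lambda>H. S \<otimes>\<^bsub>mp_aut M\<^esub> H \<otimes>\<^bsub>mp_aut M\<^esub> inv\<^bsub>mp_aut M\<^esub> S"
  have c1: "?c \<one>\<^bsub>mp_aut M\<^esub> = \<one>\<^bsub>mp_aut M\<^esub>" using S by simp
  have hom: "?c \<in> hom (mp_aut M) (mp_aut M)"
  proof -
    have "inv\<^bsub>mp_aut M\<^esub> S \<otimes>\<^bsub>mp_aut M\<^esub> (S \<otimes>\<^bsub>mp_aut M\<^esub> H) = H" if "H \<in> carrier (mp_aut M)" for H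
      using S that by (simp flip: A.m_assoc)
    then show ?thesis using S by (intro homI) (simp_all add: A.m_assoc)
  qed
  have Fc: "F \<in> carrier (mp_aut M)" using F unfolding APER_eq by blast
  have "dist_u M (?c F [^]\<^bsub>mp_aut M\<^esub> k) \<one>\<^bsub>mp_aut M\<^esub> = dist_u M (F [^]\<^bsub>mp_aut M\<^esub> k) \<one>\<^bsub>mp_aut M\<^esub>" for k :: int
  proof -
    have "?c F [^]\<^bsub>mp_aut M\<^esub> k = ?c (F [^]\<^bsub>mp_aut M\<^esub> k)"
      using hom_int_pow[OF hom Fc A.group_axioms A.group_axioms] by simp
    then have "dist_u M (?c F [^]\<^bsub>mp_aut M\<^esub> k) \<one>\<^bsub>mp_aut M\<^esub> = dist_u M (?c (F [^]\<^bsub>mp_aut M\<^esub> k)) (?c \<one>\<^bsub>mp_aut M\<^esub>)"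
      using c1 by simp
    also have "\<dots> = dist_u M (F [^]\<^bsub>mp_aut M\<^esub> k) \<one>\<^bsub>mp_aut M\<^esub>"
      using S Fc by (simp only: dist_u_right dist_u_left A.m_closed A.inv_closed A.int_pow_closed A.one_closed)
    finally show ?thesis .
  qed
  moreover have "?c F \<in> carrier (mp_aut M)" using S Fc by simp
  ultimately show ?thesis using F unfolding APER_eq by simp
qed

section \<open>Shrinking sets of positive measure, and long orbits\<close>

text \<open>Atomlessness gives a part of strictly smaller positive measure; either it or its
  complement in \<open>B\<close> has at most half the measure.\<close>

lemma half_measure_subset:
  assumes B: "B \<in> sets M" "measure M B > 0"
  shows "\<exists>A \<in> sets M. A \<subseteq> B \<and> 0 < measure M A \<and> measure M A \<le> measure M B / 2"
proof -
  have "emeasure M B > 0" using B(2) by (simp add: emeasure_eq_measure)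
  then obtain C where C: "C \<in> sets M" "C \<subseteq> B" "0 < emeasure M C" "emeasure M C < emeasure M B"
    using standard B(1) unfolding standard_prob_space_def atomless_def by blast
  have c: "0 < measure M C" "measure M C < measure M B"
    using C(3,4) by (simp_all add: emeasure_eq_measure ennreal_less_iff)
  have d: "measure M (B - C) = measure M B - measure M C"
    using B(1) C(1,2) by (intro finite_measure_Diff)
  show ?thesis
  proof (cases "measure M C \<le> measure M B / 2")
    case True
    then show ?thesis using C c by (intro bexI[of _ C] conjI)
  next
    case False
    have "B - C \<in> sets M" using B C by simp
    moreover have "B - C \<subseteq> B" by blast
    moreover have "0 < measure M (B - C)" "measure M (B - C) \<le> measure M B / 2"
      using False c d by linarith+
    ultimately show ?thesis by (intro bexI[of _ "B - C"] conjI)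
  qed
qed

lemma small_subset:
  assumes B: "B \<in> sets M" "measure M B > 0" and "\<epsilon> > 0"
  obtains A where "A \<in> sets M" "A \<subseteq> B" "0 < measure M A" "measure M A < \<epsilon>"
proof -
  have "\<exists>A \<in> sets M. A \<subseteq> B \<and> 0 < measure M A \<and> measure M A \<le> (1/2) ^ n" for n
  proof (induction n)
    case 0
    show ?case using B by (intro bexI[of _ B]) simp_all
  next
    case (Suc n)
    then obtain A where A: "A \<in> sets M" "A \<subseteq> B" "0 < measure M A" "measure M A \<le> (1/2) ^ n" by blast
    obtain C where C: "C \<in> sets M" "C \<subseteq> A" "0 < measure M C" "measure M C \<le> measure M A / 2"
      using half_measure_subset[OF A(1,3)] by blast
    have "measure M C \<le> (1/2) ^ Suc n" using A(4) C(4) by simp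
    moreover have "C \<subseteq> B" using C(2) A(2) by (rule subset_trans)
    ultimately show ?case using C(1,3) by (intro bexI[of _ C] conjI)
  qed
  moreover obtain n :: nat where "(1/2 :: real) ^ n < \<epsilon>"
    using real_arch_pow_inv[of \<epsilon> "1/2"] assms(3) by auto
  ultimately show thesis using that by (meson le_less_trans)
qed

text \<open>If the maps do not agree on a part of positive measure, then the images of almost every
  point of \<open>B\<close> are separated by some \<open>E n\<close>; countably many such cases
  cover \<open>B\<close> up to a null set, so one of them has positive measure.\<close>

lemma shrink_pair:
  assumes e: "e \<in> MB" "e' \<in> MB" and B: "B \<in> sets M" "measure M B > 0"
  shows "\<exists>A \<in> sets M. A \<subseteq> B \<and> measure M A > 0 \<and> ((\<forall>x\<in>A. e x = e' x) \<or> e ` A \<inter> e' ` A = {})"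
proof (cases "measure M (B \<inter> {x \<in> space M. e x = e' x}) > 0")
  case True
  then show ?thesis using B(1) sets_eq_MB[OF e]
    by (intro bexI[of _ "B \<inter> {x \<in> space M. e x = e' x}"]) auto
next
  case False
  obtain E :: "nat \<Rightarrow> 'a set" where E: "\<And>n. E n \<in> sets M"
    "\<And>x y. x \<in> space M \<Longrightarrow> y \<in> space M \<Longrightarrow> x \<noteq> y \<Longrightarrow> \<exists>n. x \<in> E n \<and> y \<notin> E n"
    using separating_sets by blast
  \<comment> \<open>\<open>e\<close> maps this set into \<open>E n\<close>, and \<open>e'\<close>
    maps it into the complement of \<open>E n\<close>.\<close>
  define C where "C n = B \<inter> ((e -` E n \<inter> space M) - (e' -` E n \<inter> space M))" for n
  have C: "C n \<in> sets M" for n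
    unfolding C_def
    by (rule sets.Int[OF B(1) sets.Diff[OF measurable_sets[OF MB_D(1)[OF e(1)] E(1)]
      measurable_sets[OF MB_D(1)[OF e(2)] E(1)]]])
  have Cd: "e ` C n \<inter> e' ` C n = {}" for n
    by (auto simp: C_def)
  have "\<exists>n. measure M (C n) > 0"
  proof (rule ccontr)
    assume "\<not> ?thesis"
    then have "C n \<in> null_sets M" for n
      using C by (simp add: null_sets_def emeasure_eq_measure zero_less_measure_iff)
    moreover have "B \<inter> {x \<in> space M. e x = e' x} \<in> null_sets M"
      using False B(1) sets_eq_MB[OF e] by (simp add: null_sets_def emeasure_eq_measure zero_less_measure_iff)
    ultimately have null: "(B \<inter> {x \<in> space M. e x = e' x}) \<union> (\<Union>n. C n) \<in> null_sets M"
      by (intro null_sets.Un null_sets_UN)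
    have "B \<subseteq> (B \<inter> {x \<in> space M. e x = e' x}) \<union> (\<Union>n. C n)"
    proof
      fix x assume x: "x \<in> B"
      then have xs: "x \<in> space M" using sets.sets_into_space[OF B(1)] by (rule rev_subsetD)
      show "x \<in> (B \<inter> {x \<in> space M. e x = e' x}) \<union> (\<Union>n. C n)"
      proof (cases "e x = e' x")
        case False
        then obtain n where "e x \<in> E n \<and> e' x \<notin> E n"
          using E(2)[OF MB_space[OF e(1) xs] MB_space[OF e(2) xs]] by blast
        then have "x \<in> C n" using x xs by (simp add: C_def)
        then show ?thesis by blast
      qed (use x xs in simp)
    qed
    then have "B \<in> null_sets M" by (rule null_sets_subset[OF null B(1)])
    then show False using B(2) by (simp add: null_sets_def measure_def)
  qed
  then obtain n where "measure M (C n) > 0" by blast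
  moreover have "C n \<subseteq> B" by (simp add: C_def)
  ultimately show ?thesis using C[of n] Cd[of n] by blast
qed

text \<open>Both alternatives pass to subsets, so the pairs can be treated one after
  another.\<close>

lemma shrink_pairs:
  assumes "finite K" "K \<subseteq> MB \<times> MB" and B: "B \<in> sets M" "measure M B > 0"
  shows "\<exists>A \<in> sets M. A \<subseteq> B \<and> measure M A > 0 \<and>
    (\<forall>(e, e') \<in> K. (\<forall>x\<in>A. e x = e' x) \<or> e ` A \<inter> e' ` A = {})"
  using assms(1,2)
proof (induction K rule: finite_induct)
  case empty
  then show ?case using B by blast
next
  case (insert p K)
  obtain e e' where p: "p = (e, e')" by (cases p)
  have ee: "e \<in> MB" "e' \<in> MB" using insert.prems p by auto
  obtain A where A: "A \<in> sets M" "A \<subseteq> B" "measure M A > 0"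
    "\<forall>(e, e') \<in> K. (\<forall>x\<in>A. e x = e' x) \<or> e ` A \<inter> e' ` A = {}"
    using insert.IH insert.prems by auto
  obtain C where C: "C \<in> sets M" "C \<subseteq> A" "measure M C > 0"
    "(\<forall>x\<in>C. e x = e' x) \<or> e ` C \<inter> e' ` C = {}"
    using shrink_pair[OF ee A(1,3)] by blast
  have "\<forall>(e, e') \<in> K. (\<forall>x\<in>C. e x = e' x) \<or> e ` C \<inter> e' ` C = {}"
    using A(4) C(2) by fast
  then have "\<forall>(e, e') \<in> insert p K. (\<forall>x\<in>C. e x = e' x) \<or> e ` C \<inter> e' ` C = {}"
    using C(4) p by simp
  then show ?case using C(1-3) A(2) by (intro bexI[of _ C] conjI) auto
qed

text \<open>Otherwise almost every point has a period between 1 and \<open>L\<close>, and then the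
  power with exponent \<open>fact L\<close> is almost everywhere the identity, contrary to infinite
  order.\<close>

lemma infinite_order_imp_long_orbits:
  fixes L :: nat
  assumes t: "t \<in> MB" and inf: "\<And>k :: nat. k > 0 \<Longrightarrow> cls t [^]\<^bsub>mp_aut M\<^esub> k \<noteq> \<one>\<^bsub>mp_aut M\<^esub>"
  obtains B where "B \<in> sets M" "measure M B > 0"
    "\<And>x k :: int. x \<in> B \<Longrightarrow> k \<noteq> 0 \<Longrightarrow> \<bar>k\<bar> \<le> int L \<Longrightarrow> ipow t k x \<noteq> x"
proof -
  define m :: nat where "m = fact L"
  define N where "N = (\<Union>k\<in>{1..L}. {x \<in> space M. ipow t (int k) x = ident x})"
  have N: "N \<in> sets M" unfolding N_def
    using t by (intro sets.finite_UN sets_eq_MB) auto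
  have "measure M (space M - N) > 0"
  proof (rule ccontr)
    assume "\<not> ?thesis"
    then have "measure M (space M - N) = 0" by (simp add: zero_less_measure_iff)
    then have "AE x in M. x \<notin> space M - N" using N by (simp add: prob_eq_0)
    then have "AE x in M. ipow t (int m) x = x"
      using AE_space
    proof eventually_elim
      case (elim x)
      then obtain k where k: "k \<in> {1..L}" "ipow t (int k) x = x"
        by (auto simp: N_def ident_apply)
      have "k dvd m" unfolding m_def using k(1) by (intro dvd_fact) auto
      then obtain q where q: "m = k * q" by (rule dvdE)
      have "ipow (ipow t (int k)) (int q) x = x"
        by (rule ipow_fixed[OF G.int_pow_closed[OF t] elim(2) k(2)])
      then show ?case using t q by (simp add: G.int_pow_pow)
    qed
    then have "AE x in M. ipow t (int m) x = ident x"
      using AE_space by eventually_elim (simp add: ident_apply)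
    then have "cls (ipow t (int m)) = cls ident"
      using t by (subst cls_eq_iff) auto
    then have "cls t [^]\<^bsub>mp_aut M\<^esub> m = \<one>\<^bsub>mp_aut M\<^esub>"
      using cls.hom_int_pow[OF t, of "int m"] cls.hom_one by (simp add: int_pow_int)
    then show False using inf[of m] by (simp add: m_def)
  qed
  moreover have "ipow t k x \<noteq> x" if "x \<in> space M - N" "k \<noteq> 0" "\<bar>k\<bar> \<le> int L" for x k
  proof
    assume fixed: "ipow t k x = x"
    have x: "x \<in> space M" using that(1) by blast
    have "ipow t \<bar>k\<bar> x = x"
    proof (cases "k \<ge> 0")
      case False
      have "ident x = ipow t (- k) x"
        using ipow_eq_iff[OF t x, of 0 "- k"] fixed by simp
      then show ?thesis using False x by (simp add: ident_apply)
    qed (use fixed in simp)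
    then have "ipow t (int (nat \<bar>k\<bar>)) x = ident x" using x by (simp add: ident_apply)
    moreover have "nat \<bar>k\<bar> \<in> {1..L}" using that(2,3) by auto
    ultimately have "x \<in> N" unfolding N_def using x by blast
    then show False using that(1) by blast
  qed
  ultimately show thesis using that[of "space M - N"] N by blast
qed

end

lemma (in group_hom) word_val_hom_image:
  assumes "\<And>s. s \<in> S \<Longrightarrow> g s \<in> carrier G" "set w \<subseteq> S \<times> UNIV"
  shows "h (word_val G g w) = word_val H (\<lambda>s. h (g s)) w"
  using assms(2)
proof (induction w)
  case (Cons a w)
  have a: "fst a \<in> S" using Cons.prems by auto
  have g: "g \<in> S \<rightarrow> carrier G" using assms(1) by simp
  have "letter_val G g a \<in> carrier G" "word_val G g w \<in> carrier G"
    using Cons.prems G.letter_val_closed[OF g, of a] G.word_val_closed[OF g, of w] by auto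
  moreover have "h (letter_val G g a) = letter_val H (\<lambda>s. h (g s)) a"
    using assms(1)[OF a] by (simp add: letter_val_def)
  ultimately show ?case using Cons by simp
qed simp

section \<open>Perturbations inside the full group\<close>

locale pmp_relation = standard_pmp +
  fixes R :: "('a \<times> 'a) set"
  assumes pmp: "pmp_equiv M R"
begin

section \<open>The full group as a closed set\<close>

text \<open>Elements of the acting countable group, listed possibly with repetitions; this reduces
  membership in an orbit to countably many equations between measurable maps.\<close>

lemma R_enum:
  obtains c :: "nat \<Rightarrow> 'a \<Rightarrow> 'a" where "\<And>k. c k \<in> MB"
    "\<And>x y. (x, y) \<in> R \<longleftrightarrow> x \<in> space M \<and> (\<exists>k. y = c k x)"
proof -
  obtain H :: "nat monoid" and \<phi> where H: "group_action H (space M) \<phi>"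
    "\<forall>g \<in> carrier H. \<phi> g \<in> MB" "R = {(x, y). x \<in> space M \<and> y \<in> orbit H \<phi> x}"
    using pmp unfolding pmp_equiv_def by blast
  have "group H" using H(1) by (simp add: group_action_def group_hom_def)
  then have ne: "carrier H \<noteq> {}" using group.is_monoid monoid.one_closed by blast
  have cnt: "countable (carrier H)" by simp
  show thesis
  proof (rule that[of "\<lambda>k. \<phi> (from_nat_into (carrier H) k)"])
    show "\<phi> (from_nat_into (carrier H) k) \<in> MB" for k
      using H(2) from_nat_into[OF ne] by blast
    show "(x, y) \<in> R \<longleftrightarrow> x \<in> space M \<and> (\<exists>k. y = \<phi> (from_nat_into (carrier H) k) x)" for x y
      unfolding H(3) orbit_def
      using from_nat_into_surj[OF cnt] from_nat_into[OF ne] by (simp, metis)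
  qed
qed

lemma R_refl: "x \<in> space M \<Longrightarrow> (x, x) \<in> R"
  and R_sym: "(x, y) \<in> R \<Longrightarrow> (y, x) \<in> R"
  and R_trans: "(x, y) \<in> R \<Longrightarrow> (y, z) \<in> R \<Longrightarrow> (x, z) \<in> R"
proof -
  obtain H :: "nat monoid" and \<phi> where H: "group_action H (space M) \<phi>"
    "R = {(x, y). x \<in> space M \<and> y \<in> orbit H \<phi> x}"
    using pmp unfolding pmp_equiv_def by blast
  interpret group_action H "space M" \<phi> by (rule H(1))
  have sp: "y \<in> space M" if "x \<in> space M" "y \<in> orbit H \<phi> x" for x y
    using that element_image unfolding orbit_def by blast
  show "x \<in> space M \<Longrightarrow> (x, x) \<in> R" using orbit_refl H(2) by simp
  show "(x, y) \<in> R \<Longrightarrow> (y, x) \<in> R" using orbit_sym[of x y] sp[of x y] H(2) by simp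
  show "(x, y) \<in> R \<Longrightarrow> (y, z) \<in> R \<Longrightarrow> (x, z) \<in> R"
    using orbit_trans[of x y z] sp[of x y] sp[of y z] H(2) by simp
qed

definition FR :: "('a \<Rightarrow> 'a) set" where
  "FR = {f \<in> MB. AE x in M. (f x, x) \<in> R}"

lemma FR_MB: "f \<in> FR \<Longrightarrow> f \<in> MB"
  and FR_AE: "f \<in> FR \<Longrightarrow> AE x in M. (f x, x) \<in> R"
  by (simp_all add: FR_def)

lemma FR_I: "f \<in> MB \<Longrightarrow> AE x in M. (f x, x) \<in> R \<Longrightarrow> f \<in> FR"
  by (simp add: FR_def)

lemma FR_ident: "ident \<in> FR"
proof (rule FR_I)
  show "AE x in M. (ident x, x) \<in> R"
    using AE_space by eventually_elim (simp add: ident_apply R_refl)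
qed simp

lemma FR_comp:
  assumes "f \<in> FR" "g \<in> FR"
  shows "f \<odot> g \<in> FR"
proof (rule FR_I)
  have fg: "f \<in> MB" "g \<in> MB" using assms FR_MB by blast+
  then show "f \<odot> g \<in> MB" by simp
  from AE_mp_bij[OF fg(2) FR_AE[OF assms(1)]] FR_AE[OF assms(2)] AE_space
  show "AE x in M. ((f \<odot> g) x, x) \<in> R"
    by eventually_elim (use fg in \<open>auto simp: mcomp_apply intro: R_trans\<close>)
qed

lemma FR_inv:
  assumes "f \<in> FR"
  shows "minv f \<in> FR"
proof (rule FR_I)
  have f: "f \<in> MB" using assms by (rule FR_MB)
  then show "minv f \<in> MB" by simp
  from AE_mp_bij[OF G.inv_closed[OF f] FR_AE[OF assms]] AE_space
  show "AE x in M. (minv f x, x) \<in> R"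
    by eventually_elim (use f in \<open>auto simp: minv_right intro: R_sym\<close>)
qed

lemma FR_ipow:
  assumes "f \<in> FR"
  shows "ipow f k \<in> FR"
proof (induction k rule: int_induct[where k = 0])
  case base
  then show ?case by (simp add: FR_ident)
next
  case (step1 i)
  then show ?case using assms FR_MB[OF assms] FR_comp[of "ipow f i" f] by (simp add: G.int_pow_mult)
next
  case (step2 i)
  have "ipow f (i - 1) = ipow f i \<odot> minv f"
    using G.int_pow_mult[OF FR_MB[OF assms], of i "- 1"] FR_MB[OF assms] by (simp add: G.int_pow_neg)
  then show ?case using step2 FR_comp FR_inv assms by simp
qed

lemma FR_piecewise:
  assumes f: "f \<in> MB" and h: "\<And>k::nat. h k \<in> FR" and fh: "\<And>x. x \<in> space M \<Longrightarrow> \<exists>k. f x = h k x"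
  shows "f \<in> FR"
proof (rule FR_I[OF f])
  have "AE x in M. \<forall>k. (h k x, x) \<in> R"
    unfolding AE_all_countable using FR_AE[OF h] by simp
  then show "AE x in M. (f x, x) \<in> R"
    using AE_space by eventually_elim (use fh in metis)
qed

lemma full_group_eq: "full_group M R = cls ` FR"
  unfolding full_group_def FR_def by blast

lemma cls_in_full_group_iff:
  assumes f: "f \<in> MB"
  shows "cls f \<in> full_group M R \<longleftrightarrow> f \<in> FR"
proof
  assume "cls f \<in> full_group M R"
  then obtain g where g: "g \<in> FR" "cls f = cls g" unfolding full_group_eq by (rule imageE)
  then have "AE x in M. f x = g x" using f FR_MB[OF g(1)] cls_eq_iff by simp
  with FR_AE[OF g(1)] have "AE x in M. (f x, x) \<in> R" by eventually_elim simp
  then show "f \<in> FR" using f by (intro FR_I)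
next
  show "f \<in> FR \<Longrightarrow> cls f \<in> full_group M R" unfolding full_group_eq by (rule imageI)
qed

lemma full_group_subset: "full_group M R \<subseteq> carrier (mp_aut M)"
  unfolding full_group_eq carrier_mp_aut using FR_MB by (intro image_mono) blast

text \<open>Measurability comes from the enumeration: \<open>(f x, x)\<close> is outside
  \<open>R\<close> exactly when \<open>x\<close> differs from every
  \<open>c k (f x)\<close>.\<close>

lemma sets_notin_R:
  assumes f: "f \<in> MB"
  shows "{x \<in> space M. (f x, x) \<notin> R} \<in> sets M"
proof -
  obtain c :: "nat \<Rightarrow> 'a \<Rightarrow> 'a" where c: "\<And>k. c k \<in> MB"
    "\<And>x y. (x, y) \<in> R \<longleftrightarrow> x \<in> space M \<and> (\<exists>k. y = c k x)"
    using R_enum by blast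
  have "{x \<in> space M. (f x, x) \<notin> R} = (\<Inter>k. {x \<in> space M. ident x \<noteq> (c k \<odot> f) x})"
    using c(2) MB_space[OF f] c(1) f by (auto simp: mcomp_apply ident_apply)
  also have "\<dots> \<in> sets M"
    using c(1) f by (intro sets.countable_INT' image_subsetI sets_neq_MB) auto
  finally show ?thesis .
qed

text \<open>A map outside the full group takes the points of a set \<open>N\<close> of positive
  measure out of their classes. Any element of the full group differs from it almost everywhere on
  \<open>N\<close>, so the ball of radius \<open>measure M N\<close> misses the full group.\<close>

lemma closedin_full_group: "closedin D.mtopology (full_group M R)"
  unfolding D.closedin_metric
proof (intro conjI allI impI)
  show "full_group M R \<subseteq> carrier (mp_aut M)" by (rule full_group_subset)
  fix F assume F: "F \<in> carrier (mp_aut M) - full_group M R"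
  then have "F \<in> cls ` MB" unfolding carrier_mp_aut by (rule DiffD1)
  then obtain f where f: "F = cls f" "f \<in> MB" by (rule imageE)
  define N where "N = {x \<in> space M. (f x, x) \<notin> R}"
  have N: "N \<in> sets M" unfolding N_def by (rule sets_notin_R[OF f(2)])
  have "measure M N \<noteq> 0"
  proof
    assume "measure M N = 0"
    then have "AE x in M. x \<notin> N" using N by (simp add: prob_eq_0)
    then have "AE x in M. (f x, x) \<in> R" using AE_space by eventually_elim (simp add: N_def)
    then have "cls f \<in> full_group M R" using f(2) by (simp add: cls_in_full_group_iff FR_I)
    then show False using F f(1) by simp
  qed
  then have "measure M N > 0" by (simp add: zero_less_measure_iff)
  moreover have "disjnt (full_group M R) (D.mball F (measure M N))"
    unfolding disjnt_iff
  proof (intro allI notI, elim conjE)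
    fix H assume H: "H \<in> full_group M R" "H \<in> D.mball F (measure M N)"
    obtain h where h: "H = cls h" "h \<in> FR" using H(1) unfolding full_group_eq by (rule imageE)
    have "neq_measure f h < measure M N"
      using H(2) f h(1) FR_MB[OF h(2)] by (simp add: dist_u_cls)
    moreover have "measure M N \<le> neq_measure f h"
      unfolding neq_measure_def
    proof (rule finite_measure_mono_AE)
      show "AE x in M. x \<in> N \<longrightarrow> x \<in> {x \<in> space M. f x \<noteq> h x}"
        using FR_AE[OF h(2)] by eventually_elim (auto simp: N_def)
      show "{x \<in> space M. f x \<noteq> h x} \<in> sets M" by (rule sets_neq_MB[OF f(2) FR_MB[OF h(2)]])
    qed
    ultimately show False by simp
  qed
  ultimately show "\<exists>r>0. disjnt (full_group M R) (D.mball F r)" by blast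
qed

section \<open>Prescribing elements of the full group on towers\<close>

text \<open>The sets \<open>e p ` A\<close> are the levels of a tower, which \<open>Q\<close> permutes according to \<open>\<pi>\<close>.\<close>

lemma tower_permutation:
  fixes e :: "'i \<Rightarrow> 'a \<Rightarrow> 'a"
  assumes F: "finite F" and e: "\<And>p. p \<in> F \<Longrightarrow> e p \<in> FR" and A: "A \<in> sets M"
    and disj: "\<And>p q. p \<in> F \<Longrightarrow> q \<in> F \<Longrightarrow> p \<noteq> q \<Longrightarrow> e p ` A \<inter> e q ` A = {}"
    and \<pi>: "bij_betw \<pi> F F"
  obtains Q where "Q \<in> FR" "\<And>p x. p \<in> F \<Longrightarrow> x \<in> A \<Longrightarrow> Q (e p x) = e (\<pi> p) x"
    "neq_measure Q ident \<le> card F * measure M A"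
proof -
  have eMB: "e p \<in> MB" if "p \<in> F" for p using e[OF that] by (rule FR_MB)
  have As: "x \<in> space M" if "x \<in> A" for x using sets.sets_into_space[OF A] that by (rule subsetD)
  define U where "U = (\<Union>p\<in>F. e p ` A)"
  have U: "U \<in> sets M" unfolding U_def using F image_MB(1)[OF eMB A] by (intro sets.finite_UN) auto
  have Usp: "x \<in> space M" if "x \<in> U" for x using sets.sets_into_space[OF U] that by (rule subsetD)
  \<comment> \<open>Defined for an arbitrary relabelling \<open>\<rho>\<close>, because the inverse
    of \<open>act \<pi>\<close> is \<open>act \<pi>'\<close>. Levels are disjoint, so
    \<open>THE\<close> is well determined on \<open>U\<close>.\<close>
  define act where "act \<rho> = (\<lambda>x\<in>space M. if x \<in> U then
      (let p = (THE p. p \<in> F \<and> x \<in> e p ` A) in e (\<rho> p) (minv (e p) x)) else x)" for \<rho>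
  have act_on: "act \<rho> (e p x) = e (\<rho> p) x" if "p \<in> F" "x \<in> A" for \<rho> p x
  proof -
    have U': "e p x \<in> U" using that unfolding U_def by blast
    have "(THE q. q \<in> F \<and> e p x \<in> e q ` A) = p"
    proof (rule the_equality)
      show "p \<in> F \<and> e p x \<in> e p ` A" using that by blast
      show "q = p" if "q \<in> F \<and> e p x \<in> e q ` A" for q
        using disj[of p q] that \<open>p \<in> F\<close> \<open>x \<in> A\<close> by blast
    qed
    then show ?thesis
      using U' Usp[OF U'] minv_left[OF eMB[OF that(1)] As[OF that(2)]] by (simp add: act_def)
  qed
  have act_off: "act \<rho> x = x" if "x \<in> space M" "x \<notin> U" for \<rho> x
    using that by (simp add: act_def)
  define \<pi>' where "\<pi>' = inv_into F \<pi>"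
  have \<pi>'F: "\<pi>' p \<in> F" "\<pi> p \<in> F" "\<pi>' (\<pi> p) = p" "\<pi> (\<pi>' p) = p" if "p \<in> F" for p
    using \<pi> that unfolding \<pi>'_def
    by (auto simp: bij_betw_def f_inv_into_f inv_into_into)
  have act_in: "act \<rho> x \<in> U" "act \<sigma> (act \<rho> x) = x"
    if "x \<in> U" "\<And>p. p \<in> F \<Longrightarrow> \<rho> p \<in> F" "\<And>p. p \<in> F \<Longrightarrow> \<sigma> (\<rho> p) = p" for x \<rho> \<sigma>
  proof -
    have "\<exists>p\<in>F. \<exists>a\<in>A. x = e p a" using that(1) unfolding U_def by blast
    then obtain p a where pa: "p \<in> F" "a \<in> A" "x = e p a" by blast
    have 1: "act \<rho> x = e (\<rho> p) a" using act_on[OF pa(1,2)] pa(3) by simp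
    then show "act \<rho> x \<in> U" unfolding U_def using that(2)[OF pa(1)] pa(2) by blast
    show "act \<sigma> (act \<rho> x) = x"
      using 1 act_on[OF that(2)[OF pa(1)] pa(2), of \<sigma>] that(3)[OF pa(1)] pa(3) by simp
  qed
  have bij: "bij_betw (act \<pi>) (space M) (space M)"
  proof (rule bij_betw_byWitness[where f' = "act \<pi>'"])
    show "\<forall>x\<in>space M. act \<pi>' (act \<pi> x) = x"
      using act_in(2)[of _ \<pi> \<pi>'] \<pi>'F act_off by metis
    show "\<forall>x\<in>space M. act \<pi> (act \<pi>' x) = x"
      using act_in(2)[of _ \<pi>' \<pi>] \<pi>'F act_off by metis
    show "act \<pi> ` space M \<subseteq> space M"
    proof (rule image_subsetI)
      fix x assume x: "x \<in> space M"
      show "act \<pi> x \<in> space M"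
      proof (cases "x \<in> U")
        case True
        show ?thesis by (rule Usp[OF act_in(1)[OF True \<pi>'F(2) \<pi>'F(3)]])
      qed (use x act_off in simp)
    qed
    show "act \<pi>' ` space M \<subseteq> space M"
    proof (rule image_subsetI)
      fix x assume x: "x \<in> space M"
      show "act \<pi>' x \<in> space M"
      proof (cases "x \<in> U")
        case True
        show ?thesis by (rule Usp[OF act_in(1)[OF True \<pi>'F(1) \<pi>'F(4)]])
      qed (use x act_off in simp)
    qed
  qed
  obtain g where g: "bij_betw g {0..<card F} F" using ex_bij_betw_nat_finite[OF F] by blast
  have gF: "g n \<in> F" if "n < card F" for n using g that by (auto simp: bij_betw_def)
  \<comment> \<open>The finitely many levels come first; every later index repeats the complement of
    the tower, with the identity on it.\<close>
  define C where "C n = (if n < card F then e (g n) ` A else space M - U)" for n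
  define h where "h n = (if n < card F then e (\<pi> (g n)) \<odot> minv (e (g n)) else ident)" for n
  have hFR: "h n \<in> FR" for n
    unfolding h_def using FR_comp[OF e FR_inv[OF e]] gF \<pi>'F(2) FR_ident by simp
  have CU: "\<exists>n. x \<in> C n" if x: "x \<in> space M" for x
  proof (cases "x \<in> U")
    case True
    then obtain p where "p \<in> F" "x \<in> e p ` A" unfolding U_def by blast
    moreover from this obtain n where "n < card F" "p = g n"
      using g unfolding bij_betw_def by (metis atLeastLessThan_iff imageE)
    ultimately have "x \<in> C n" by (simp add: C_def)
    then show ?thesis by blast
  next
    case False
    then have "x \<in> C (card F)" using x by (simp add: C_def)
    then show ?thesis by blast
  qed
  have Ch: "act \<pi> x = h n x" if "x \<in> C n" for n x
  proof (cases "n < card F")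
    case True
    then have "x \<in> e (g n) ` A" using that by (simp add: C_def)
    then obtain a where a: "a \<in> A" "x = e (g n) a" by blast
    have "act \<pi> x = e (\<pi> (g n)) a" using act_on[OF gF[OF True] a(1)] a(2) by simp
    moreover have "h n x = e (\<pi> (g n)) a"
      using True a gF[OF True] \<pi>'F(2)[OF gF[OF True]] eMB As[OF a(1)]
      by (simp add: h_def mcomp_apply minv_left MB_space)
    ultimately show ?thesis by simp
  next
    case False
    then have "x \<in> space M" "x \<notin> U" using that by (simp_all add: C_def)
    then show ?thesis using act_off False by (simp add: h_def ident_apply)
  qed
  have Cs: "C n \<in> sets M" for n
    unfolding C_def using image_MB(1)[OF eMB[OF gF] A] U by simp
  have "act \<pi> \<in> MB"
  proof (rule glue_MB[of h C])
    show "h n \<in> MB" for n using hFR by (rule FR_MB)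
    show "(\<Union>n. C n) = space M"
      using CU sets.sets_into_space[OF Cs] by blast
    show "act \<pi> \<in> extensional (space M)" by (simp add: act_def)
  qed (use Cs bij Ch in simp_all)
  then have "act \<pi> \<in> FR"
    by (rule FR_piecewise[where h = h, OF _ hFR]) (use CU Ch in blast)
  moreover have "neq_measure (act \<pi>) ident \<le> card F * measure M A"
  proof -
    have "neq_measure (act \<pi>) ident \<le> measure M U"
      unfolding neq_measure_def
    proof (rule finite_measure_mono[OF _ U], rule subsetI)
      fix x assume "x \<in> {x \<in> space M. act \<pi> x \<noteq> ident x}"
      then have x: "x \<in> space M" "act \<pi> x \<noteq> ident x" by simp_all
      show "x \<in> U"
      proof (rule ccontr)
        assume "x \<notin> U"
        then show False using act_off[OF x(1)] x(2) ident_apply[OF x(1)] by simp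
      qed
    qed
    also have "\<dots> \<le> (\<Sum>p\<in>F. measure M (e p ` A))"
      unfolding U_def using F image_MB(1)[OF eMB A] by (intro measure_UNION_le) auto
    also have "\<dots> = (\<Sum>p\<in>F. measure M A)"
      using image_MB(2)[OF eMB A] by (intro sum.cong) (simp_all add: measure_def)
    finally show ?thesis by simp
  qed
  ultimately show thesis using that[of "act \<pi>"] act_on by blast
qed

text \<open>After shrinking \<open>B\<close>, any two of the maps \<open>y j\<close>, \<open>z j\<close> either coincide or have disjoint images,
  so the values at a single point \<open>x0\<close> record all coincidences and the problem becomes that of
  extending a partial injection of a finite set.\<close>

lemma partial_map_extension:
  fixes y z :: "'j \<Rightarrow> 'a \<Rightarrow> 'a"
  assumes J: "finite J" and y: "\<And>j. j \<in> J \<Longrightarrow> y j \<in> FR" and z: "\<And>j. j \<in> J \<Longrightarrow> z j \<in> FR"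
    and B: "B \<in> sets M" "measure M B > 0"
    and inj: "AE x in M. x \<in> B \<longrightarrow> inj_on (\<lambda>j. y j x) J \<and> inj_on (\<lambda>j. z j x) J"
    and \<epsilon>: "\<epsilon> > 0"
  obtains A Q where "A \<in> sets M" "A \<subseteq> B" "measure M A > 0" "Q \<in> FR" "neq_measure Q ident < \<epsilon>"
    "\<And>x j. x \<in> A \<Longrightarrow> j \<in> J \<Longrightarrow> Q (y j x) = z j x"
proof -
  define E where "E = y ` J \<union> z ` J"
  have E: "finite E" "E \<subseteq> FR" using J y z by (auto simp: E_def)
  have "finite (E \<times> E)" "E \<times> E \<subseteq> MB \<times> MB" using E FR_MB by auto
  from shrink_pairs[OF this B] obtain A1 where A1: "A1 \<in> sets M" "A1 \<subseteq> B" "measure M A1 > 0"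
    "\<forall>(e, e') \<in> E \<times> E. (\<forall>x\<in>A1. e x = e' x) \<or> e ` A1 \<inter> e' ` A1 = {}" by blast
  \<comment> \<open>The \<open>+ 1\<close> covers empty \<open>E\<close> and makes the final
    estimate strict.\<close>
  have "\<epsilon> / (card E + 1) > 0" using \<epsilon> by simp
  from small_subset[OF A1(1,3) this] obtain A where A: "A \<in> sets M" "A \<subseteq> A1" "0 < measure M A"
    "measure M A < \<epsilon> / (card E + 1)" by blast
  have "\<exists>x\<in>A. inj_on (\<lambda>j. y j x) J \<and> inj_on (\<lambda>j. z j x) J"
  proof (rule ccontr)
    assume *: "\<not> ?thesis"
    from inj have "AE x in M. x \<notin> A"
      by eventually_elim (use * A(2) A1(2) in blast)
    then have "measure M A = 0" using A(1) by (simp add: prob_eq_0)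
    then show False using A(3) by simp
  qed
  then obtain x0 where x0: "x0 \<in> A" "inj_on (\<lambda>j. y j x0) J" "inj_on (\<lambda>j. z j x0) J" by blast
  have dich: "(\<forall>x\<in>A. e x = e' x) \<or> e ` A \<inter> e' ` A = {}" if "e \<in> E" "e' \<in> E" for e e'
  proof -
    have "(\<forall>x\<in>A1. e x = e' x) \<or> e ` A1 \<inter> e' ` A1 = {}" using A1(4) that by simp
    then show ?thesis using A(2) by blast
  qed
  have same: "e x = e' x" if "e \<in> E" "e' \<in> E" "e x0 = e' x0" "x \<in> A" for e e' x
    using dich[OF that(1,2)] that(3,4) x0(1) by blast
  define F where "F = (\<lambda>e. e x0) ` E"
  \<comment> \<open>One map for each value at \<open>x0\<close>; maps with the same value there
    agree on all of \<open>A\<close>, so the choice does not matter.\<close>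
  define rep where "rep p = (SOME e. e \<in> E \<and> e x0 = p)" for p
  have rep: "rep p \<in> E" "rep p x0 = p" if "p \<in> F" for p
  proof -
    have "\<exists>e. e \<in> E \<and> e x0 = p" using that unfolding F_def by blast
    then have "rep p \<in> E \<and> rep p x0 = p" unfolding rep_def by (rule someI_ex)
    then show "rep p \<in> E" "rep p x0 = p" by simp_all
  qed
  have F: "finite F" "card F \<le> card E" unfolding F_def using E(1) by (simp_all add: card_image_le)
  have yE: "y j \<in> E" "z j \<in> E" if "j \<in> J" for j using that unfolding E_def by simp_all
  have yF: "y j x0 \<in> F" "z j x0 \<in> F" if "j \<in> J" for j unfolding F_def using yE[OF that] by simp_all
  obtain \<pi> where \<pi>: "bij_betw \<pi> F F" "\<And>j. j \<in> J \<Longrightarrow> \<pi> (y j x0) = z j x0"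
    using partial_inj_extends_to_perm[OF F(1) _ _ x0(2,3)] yF by (metis image_subsetI)
  have disj: "rep p ` A \<inter> rep q ` A = {}" if "p \<in> F" "q \<in> F" "p \<noteq> q" for p q
    using dich[OF rep(1)[OF that(1)] rep(1)[OF that(2)]] rep(2)[OF that(1)] rep(2)[OF that(2)] that(3) x0(1)
    by metis
  have repFR: "rep p \<in> FR" if "p \<in> F" for p using rep(1)[OF that] E(2) by blast
  obtain Q where Q: "Q \<in> FR" "\<And>p x. p \<in> F \<Longrightarrow> x \<in> A \<Longrightarrow> Q (rep p x) = rep (\<pi> p) x"
    "neq_measure Q ident \<le> card F * measure M A"
    by (rule tower_permutation[OF F(1) _ A(1) _ \<pi>(1), of rep]) (erule repFR, erule (2) disj, rule that)
  show thesis
  proof (rule that[of A Q])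
    show "A \<subseteq> B" using A(2) A1(2) by (rule subset_trans)
    have "real (card F) * measure M A \<le> real (card E) * (\<epsilon> / (card E + 1))"
      using F(2) A(3,4) by (intro mult_mono) auto
    also have "\<dots> < \<epsilon>" using \<epsilon> by (simp add: field_simps)
    finally show "neq_measure Q ident < \<epsilon>" using Q(3) by simp
    show "Q (y j x) = z j x" if "x \<in> A" "j \<in> J" for x j
    proof -
      have "y j x = rep (y j x0) x"
        by (rule same[OF yE(1)[OF that(2)] rep(1)[OF yF(1)[OF that(2)]] _ that(1)])
          (simp add: rep(2)[OF yF(1)[OF that(2)]])
      moreover have "z j x = rep (z j x0) x"
        by (rule same[OF yE(2)[OF that(2)] rep(1)[OF yF(2)[OF that(2)]] _ that(1)])
          (simp add: rep(2)[OF yF(2)[OF that(2)]])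
      ultimately show ?thesis
        using Q(2)[OF yF(1)[OF that(2)] that(1)] \<pi>(2)[OF that(2)] by simp
    qed
  qed (use A Q in simp_all)
qed

text \<open>Left multiplication by a small \<open>Q\<close> suffices to prescribe \<open>u\<close> on finitely many pieces, but it may
  destroy aperiodicity. If \<open>u\<close> is aperiodic, it is conjugated instead: \<open>S\<close> carries an orbit segment
  of \<open>u\<close>, indexed by the heights of the word, to the prescribed path.\<close>

lemma perturb_one:
  assumes w: "reduced w" and B: "B \<in> sets M" "measure M B > 0"
    and z: "\<And>j. z j \<in> FR" and inj: "\<And>x. x \<in> B \<Longrightarrow> inj_on (\<lambda>j. z j x) {..length w}"
    and u: "u \<in> FR" and \<epsilon>: "\<epsilon> > 0"
  obtains A u' where "A \<in> sets M" "A \<subseteq> B" "measure M A > 0" "u' \<in> FR" "neq_measure u u' < \<epsilon>"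
    "aperiodic u \<Longrightarrow> aperiodic u'"
    "\<And>x j. x \<in> A \<Longrightarrow> j \<in> letter_positions w s \<Longrightarrow> u' (z (letter_src w j) x) = z (letter_tgt w j) x"
proof -
  have uMB: "u \<in> MB" and zMB: "\<And>j. z j \<in> MB" using u z FR_MB by blast+
  have sl: "letter_src w j \<le> length w" "letter_tgt w j \<le> length w" if "j \<in> letter_positions w s" for j
    using that by (auto simp: letter_positions_def letter_src_def letter_tgt_def)
  have Bs: "x \<in> space M" if "x \<in> B" for x using sets.sets_into_space[OF B(1)] that by (rule subsetD)
  show thesis
  proof (cases "aperiodic u")
    case False
    \<comment> \<open>A requirement on \<open>Q \<odot> u\<close> at the sources is one on
      \<open>Q\<close> at their images, which stay distinct because \<open>u\<close> is
      injective.\<close>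
    have inj1: "inj_on (\<lambda>j. (u \<odot> z (letter_src w j)) x) (letter_positions w s) \<and>
        inj_on (\<lambda>j. z (letter_tgt w j) x) (letter_positions w s)" if x: "x \<in> B" for x
    proof
      have zx: "inj_on (\<lambda>j. z j x) (letter_src w ` letter_positions w s)"
        "inj_on (\<lambda>j. z j x) (letter_tgt w ` letter_positions w s)"
        using sl by (auto intro!: inj_on_subset[OF inj[OF x]])
      show "inj_on (\<lambda>j. z (letter_tgt w j) x) (letter_positions w s)"
        using comp_inj_on[OF inj_on_letter_tgt[OF w] zx(2)] by (simp add: o_def)
      have "inj_on (\<lambda>j. z (letter_src w j) x) (letter_positions w s)"
        using comp_inj_on[OF inj_on_letter_src[OF w] zx(1)] by (simp add: o_def)
      then show "inj_on (\<lambda>j. (u \<odot> z (letter_src w j)) x) (letter_positions w s)"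
        using uMB zMB Bs[OF x] by (auto simp: inj_on_def mcomp_apply MB_inj MB_space)
    qed
    have ae: "AE x in M. x \<in> B \<longrightarrow> inj_on (\<lambda>j. (u \<odot> z (letter_src w j)) x) (letter_positions w s) \<and>
        inj_on (\<lambda>j. z (letter_tgt w j) x) (letter_positions w s)"
      by (rule AE_I2) (use inj1 in blast)
    have fin: "finite (letter_positions w s)" unfolding letter_positions_def by simp
    obtain A Q where AQ: "A \<in> sets M" "A \<subseteq> B" "measure M A > 0" "Q \<in> FR" "neq_measure Q ident < \<epsilon>"
      "\<And>x j. x \<in> A \<Longrightarrow> j \<in> letter_positions w s \<Longrightarrow> Q ((u \<odot> z (letter_src w j)) x) = z (letter_tgt w j) x"
      by (rule partial_map_extension[where y = "\<lambda>j. u \<odot> z (letter_src w j)" and z = "\<lambda>j. z (letter_tgt w j)",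
        OF fin FR_comp[OF u z] z B ae \<epsilon>]) (rule that)
    show thesis
    proof (rule that[OF AQ(1-3) FR_comp[OF AQ(4) u]])
      have "neq_measure u (Q \<odot> u) = neq_measure (ident \<odot> u) (Q \<odot> u)" using uMB by simp
      also have "\<dots> = neq_measure ident Q"
        using uMB FR_MB[OF AQ(4)] by (intro neq_measure_comp_right) simp_all
      also have "\<dots> = neq_measure Q ident" by (simp add: neq_measure_def eq_commute)
      finally show "neq_measure u (Q \<odot> u) < \<epsilon>" using AQ(5) by simp
      show "(Q \<odot> u) (z (letter_src w j) x) = z (letter_tgt w j) x" if "x \<in> A" "j \<in> letter_positions w s" for x j
      proof -
        have "x \<in> space M" using that(1) AQ(2) Bs by blast
        then show ?thesis
          using AQ(6)[OF that] uMB zMB FR_MB[OF AQ(4)] by (simp add: mcomp_apply MB_space)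
      qed
    qed (use False in simp)
  next
    case True
    obtain h :: "nat \<Rightarrow> int" where h: "inj_on h {..length w}"
      "\<And>j. j \<in> letter_positions w s \<Longrightarrow> h (letter_tgt w j) = h (letter_src w j) + 1"
      using letter_heights_exist[OF w, of s] by blast
    \<comment> \<open>Aperiodicity speaks of almost every point, which is why the extension lemma
      asks for injectivity only almost everywhere.\<close>
    have ae: "AE x in M. x \<in> B \<longrightarrow> inj_on (\<lambda>j. ipow u (h j) x) {..length w} \<and> inj_on (\<lambda>j. z j x) {..length w}"
      using True[unfolded aperiodic_def] AE_space
    proof eventually_elim
      case (elim x)
      have "inj_on (\<lambda>j. ipow u (h j) x) {..length w}"
      proof (rule inj_onI)
        fix i j assume ij: "i \<in> {..length w}" "j \<in> {..length w}" "ipow u (h i) x = ipow u (h j) x"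
        then have "ipow u (h i - h j) x = x" using ipow_eq_iff[OF uMB elim(2)] by blast
        moreover have "h i - h j \<noteq> 0 \<longrightarrow> ipow u (h i - h j) x \<noteq> x" using elim(1) by (rule spec)
        ultimately have "h i = h j" by simp
        then show "i = j" using h(1) ij(1,2) by (simp add: inj_on_def)
      qed
      then show ?case using inj by blast
    qed
    \<comment> \<open>Both \<open>S\<close> and its inverse enter the conjugate, each at the cost of
      the distance from \<open>S\<close> to the identity.\<close>
    have "\<epsilon> / 2 > 0" using \<epsilon> by simp
    obtain A S where AS: "A \<in> sets M" "A \<subseteq> B" "measure M A > 0" "S \<in> FR" "neq_measure S ident < \<epsilon> / 2"
      "\<And>x j. x \<in> A \<Longrightarrow> j \<in> {..length w} \<Longrightarrow> S (ipow u (h j) x) = z j x"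
      by (rule partial_map_extension[OF finite_atMost FR_ipow[OF u] z B ae \<open>\<epsilon> / 2 > 0\<close>]) (rule that)
    have SMB: "S \<in> MB" using AS(4) by (rule FR_MB)
    have u'FR: "S \<odot> u \<odot> minv S \<in> FR" using AS(4) u by (intro FR_comp FR_inv)
    have u'MB: "S \<odot> u \<odot> minv S \<in> MB" using u'FR by (rule FR_MB)
    have cls_u': "cls (S \<odot> u \<odot> minv S) = cls S \<otimes>\<^bsub>mp_aut M\<^esub> cls u \<otimes>\<^bsub>mp_aut M\<^esub> inv\<^bsub>mp_aut M\<^esub> (cls S)"
      using SMB uMB by (simp add: A.m_assoc)
    show thesis
    proof (rule that[OF AS(1-3) u'FR])
      have c: "cls S \<in> carrier (mp_aut M)" "cls u \<in> carrier (mp_aut M)" using SMB uMB by simp_all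
      have dS: "dist_u M (cls S) \<one>\<^bsub>mp_aut M\<^esub> < \<epsilon> / 2"
        using AS(5) SMB dist_u_cls[of S ident] cls.hom_one by simp
      have "dist_u M (cls S \<otimes>\<^bsub>mp_aut M\<^esub> cls u \<otimes>\<^bsub>mp_aut M\<^esub> inv\<^bsub>mp_aut M\<^esub> (cls S))
          (\<one>\<^bsub>mp_aut M\<^esub> \<otimes>\<^bsub>mp_aut M\<^esub> cls u \<otimes>\<^bsub>mp_aut M\<^esub> inv\<^bsub>mp_aut M\<^esub> \<one>\<^bsub>mp_aut M\<^esub>)
        \<le> dist_u M (cls S \<otimes>\<^bsub>mp_aut M\<^esub> cls u) (\<one>\<^bsub>mp_aut M\<^esub> \<otimes>\<^bsub>mp_aut M\<^esub> cls u)
          + dist_u M (inv\<^bsub>mp_aut M\<^esub> (cls S)) (inv\<^bsub>mp_aut M\<^esub> \<one>\<^bsub>mp_aut M\<^esub>)"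
        using c by (intro dist_u_mult) simp_all
      also have "\<dots> = dist_u M (cls S) \<one>\<^bsub>mp_aut M\<^esub> + dist_u M (cls S) \<one>\<^bsub>mp_aut M\<^esub>"
        using c by (simp only: dist_u_right dist_u_inv A.one_closed)
      finally have "dist_u M (cls (S \<odot> u \<odot> minv S)) (cls u) < \<epsilon>"
        using dS c by (simp add: cls_u')
      then show "neq_measure u (S \<odot> u \<odot> minv S) < \<epsilon>"
        using u'MB uMB by (simp add: D.commute flip: dist_u_cls)
      have "cls u \<in> APER M" using True uMB by (simp add: cls_in_APER_iff)
      then show "aperiodic (S \<odot> u \<odot> minv S)"
        using APER_conj[OF _ c(1)] cls_u' cls_in_APER_iff[OF u'MB] by simp
      show "(S \<odot> u \<odot> minv S) (z (letter_src w j) x) = z (letter_tgt w j) x"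
        if "x \<in> A" "j \<in> letter_positions w s" for x j
      proof -
        have x: "x \<in> space M" using that(1) AS(2) Bs by blast
        let ?p = "ipow u (h (letter_src w j)) x"
        have p: "?p \<in> space M" using uMB x by (simp add: MB_space)
        have "z (letter_src w j) x = S ?p" using AS(6)[OF that(1)] sl(1)[OF that(2)] by simp
        then have "(S \<odot> u \<odot> minv S) (z (letter_src w j) x) = S (u ?p)"
          using SMB uMB p by (simp add: mcomp_apply MB_space minv_left)
        \<comment> \<open>The height of the target exceeds that of the source by one, which is
          exactly one application of \<open>u\<close>.\<close>
        also have "u ?p = ipow u (h (letter_tgt w j)) x"
          using ipow_add_apply[OF uMB x, of 1 "h (letter_src w j)"] h(2)[OF that(2)] uMB
          by (simp add: add.commute)
        also have "S \<dots> = z (letter_tgt w j) x" using AS(6)[OF that(1)] sl(2)[OF that(2)] by simp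
        finally show ?thesis .
      qed
    qed
  qed
qed

section \<open>Density for a single word\<close>

text \<open>The path \<open>z\<close> is fixed beforehand and does not involve the maps
  \<open>u i\<close>, so these can be perturbed one at a time, each on a smaller set of starting
  points; what holds for earlier indices survives the shrinking.\<close>

lemma perturb_all:
  fixes w :: "(nat \<times> bool) list" and n :: nat
  assumes w: "reduced w" and B: "B \<in> sets M" "measure M B > 0"
    and z: "\<And>j. z j \<in> FR" and inj: "\<And>x. x \<in> B \<Longrightarrow> inj_on (\<lambda>j. z j x) {..length w}"
    and u: "\<And>i. i < n \<Longrightarrow> u i \<in> FR" and \<epsilon>: "\<epsilon> > 0"
  shows "\<exists>A u'. A \<in> sets M \<and> A \<subseteq> B \<and> measure M A > 0 \<and> (\<forall>i<n. u' i \<in> FR \<and>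
    neq_measure (u i) (u' i) < \<epsilon> \<and> (aperiodic (u i) \<longrightarrow> aperiodic (u' i)) \<and>
    (\<forall>x\<in>A. \<forall>j\<in>letter_positions w i. u' i (z (letter_src w j) x) = z (letter_tgt w j) x))"
  using u
proof (induction n)
  case 0
  then show ?case using B by blast
next
  case (Suc n)
  from Suc obtain A u' where A: "A \<in> sets M" "A \<subseteq> B" "measure M A > 0" and u': "\<forall>i<n. u' i \<in> FR \<and>
    neq_measure (u i) (u' i) < \<epsilon> \<and> (aperiodic (u i) \<longrightarrow> aperiodic (u' i)) \<and>
    (\<forall>x\<in>A. \<forall>j\<in>letter_positions w i. u' i (z (letter_src w j) x) = z (letter_tgt w j) x)"
    by auto
  have inj': "inj_on (\<lambda>j. z j x) {..length w}" if "x \<in> A" for x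
    using inj A(2) that by blast
  obtain C v where C: "C \<in> sets M" "C \<subseteq> A" "measure M C > 0" and v: "v \<in> FR" "neq_measure (u n) v < \<epsilon>"
    "aperiodic (u n) \<Longrightarrow> aperiodic v"
    "\<And>x j. x \<in> C \<Longrightarrow> j \<in> letter_positions w n \<Longrightarrow> v (z (letter_src w j) x) = z (letter_tgt w j) x"
    by (rule perturb_one[OF w A(1,3) z _ Suc.prems[OF lessI] \<epsilon>, where s = n]) (erule inj', rule that)
  have "\<forall>i<Suc n. (u'(n := v)) i \<in> FR \<and>
    neq_measure (u i) ((u'(n := v)) i) < \<epsilon> \<and> (aperiodic (u i) \<longrightarrow> aperiodic ((u'(n := v)) i)) \<and>
    (\<forall>x\<in>C. \<forall>j\<in>letter_positions w i. (u'(n := v)) i (z (letter_src w j) x) = z (letter_tgt w j) x)"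
  proof (intro allI impI)
    fix i assume "i < Suc n"
    then consider "i = n" | "i < n" by linarith
    then show "(u'(n := v)) i \<in> FR \<and>
    neq_measure (u i) ((u'(n := v)) i) < \<epsilon> \<and> (aperiodic (u i) \<longrightarrow> aperiodic ((u'(n := v)) i)) \<and>
    (\<forall>x\<in>C. \<forall>j\<in>letter_positions w i. (u'(n := v)) i (z (letter_src w j) x) = z (letter_tgt w j) x)"
    proof cases
      case 1
      then show ?thesis using v by simp
    next
      case 2
      then show ?thesis using u' C(2) by auto
    qed
  qed
  moreover have "C \<subseteq> B" using C(2) A(2) by (rule subset_trans)
  ultimately show ?case using C(1,3) by blast
qed

text \<open>Reading from the right, the letter at index \<open>j\<close> moves
  \<open>p (j + 1)\<close> to \<open>p j\<close>, so the path is traversed from its last label down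
  to 0.\<close>

lemma word_val_path:
  assumes g: "\<And>s. s \<in> S \<Longrightarrow> g s \<in> MB" and w: "set w \<subseteq> S \<times> UNIV"
    and p: "\<And>j. p j \<in> space M"
    and step: "\<And>s j. s \<in> S \<Longrightarrow> j \<in> letter_positions w s \<Longrightarrow> g s (p (letter_src w j)) = p (letter_tgt w j)"
  shows "word_val (mp_bij M) g w (p (length w)) = p 0"
proof -
  have gS: "g \<in> S \<rightarrow> MB" using g by simp
  have "i \<le> length w \<Longrightarrow> word_val (mp_bij M) g (drop (length w - i) w) (p (length w)) = p (length w - i)" for i
  proof (induction i)
    case 0
    then show ?case using p by (simp add: ident_apply)
  next
    case (Suc i)
    define j where "j = length w - Suc i"
    have j: "j < length w" "Suc j = length w - i" using Suc.prems by (auto simp: j_def)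
    have d: "drop j w = w ! j # drop (Suc j) w" using j(1) by (simp add: Cons_nth_drop_Suc)
    define s where "s = fst (w ! j)"
    have ws: "w ! j \<in> S \<times> UNIV" using w j(1) nth_mem by blast
    then have s: "s \<in> S" by (auto simp: s_def)
    have js: "j \<in> letter_positions w s" using j(1) by (simp add: letter_positions_def s_def)
    have c: "letter_val (mp_bij M) g (w ! j) \<in> MB" "word_val (mp_bij M) g (drop (Suc j) w) \<in> MB"
      using G.letter_val_closed[OF gS ws] G.word_val_closed[OF gS] w set_drop_subset by (blast, metis subset_trans)
    have "word_val (mp_bij M) g (drop j w) (p (length w)) = letter_val (mp_bij M) g (w ! j) (p (Suc j))"
      using Suc j(2) p mcomp_apply[OF c] by (simp add: d)
    also have "\<dots> = p j"
    proof (cases "snd (w ! j)")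
      case True
      then show ?thesis using step[OF s js] by (simp add: letter_val_def letter_src_def letter_tgt_def flip: s_def)
    next
      case False
      then have "g s (p j) = p (Suc j)" using step[OF s js] by (simp add: letter_src_def letter_tgt_def)
      then show ?thesis using False minv_left[OF g[OF s] p, of j] by (simp add: letter_val_def flip: s_def)
    qed
    finally show ?case by (simp add: j_def)
  qed
  from this[of "length w"] show ?thesis by simp
qed

text \<open>\<open>t\<close> takes the role of generator \<open>n\<close>, after the maps that may
  be perturbed. With heights taken with respect to \<open>n\<close>, the path
  \<open>ipow t (h j)\<close> already obeys the letters of \<open>t\<close>, and only the other
  generators have to be prescribed.\<close>

lemma density_step:
  fixes w :: "(nat \<times> bool) list" and n :: nat
  assumes t: "t \<in> FR" and inf: "\<And>k :: nat. k > 0 \<Longrightarrow> cls t [^]\<^bsub>mp_aut M\<^esub> k \<noteq> \<one>\<^bsub>mp_aut M\<^esub>"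
    and w: "w \<in> carrier (free_group {..<n + 1})" "w \<noteq> []"
    and u: "\<And>i. i < n \<Longrightarrow> u i \<in> FR" and \<epsilon>: "\<epsilon> > 0"
  obtains u' where "\<And>i. i < n \<Longrightarrow> u' i \<in> FR" "\<And>i. i < n \<Longrightarrow> neq_measure (u i) (u' i) < \<epsilon>"
    "\<And>i. i < n \<Longrightarrow> aperiodic (u i) \<Longrightarrow> aperiodic (u' i)"
    "word_val (mp_aut M) (\<lambda>s. if s < n then cls (u' s) else cls t) w \<noteq> \<one>\<^bsub>mp_aut M\<^esub>"
proof -
  have wr: "reduced w" "set w \<subseteq> {..<n + 1} \<times> UNIV" using w(1) by (simp_all add: free_group_def)
  have tMB: "t \<in> MB" using t by (rule FR_MB)
  obtain h :: "nat \<Rightarrow> int" where h: "inj_on h {..length w}"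
    "\<And>j. j \<in> letter_positions w n \<Longrightarrow> h (letter_tgt w j) = h (letter_src w j) + 1"
    using letter_heights_exist[OF wr(1), of n] by blast
  define z where "z j = ipow t (h j)" for j
  have z: "z j \<in> FR" for j unfolding z_def by (rule FR_ipow[OF t])
  \<comment> \<open>The bound \<open>L\<close> covers all height differences along the word; it is
    the length over which orbits of \<open>t\<close> have to be injective.\<close>
  have "finite ((\<lambda>(i, j). nat \<bar>h i - h j\<bar>) ` ({..length w} \<times> {..length w}))" by simp
  then obtain L where "\<forall>k \<in> (\<lambda>(i, j). nat \<bar>h i - h j\<bar>) ` ({..length w} \<times> {..length w}). k \<le> L"
    unfolding finite_nat_set_iff_bounded_le by blast
  then have L: "\<bar>h i - h j\<bar> \<le> int L" if "i \<le> length w" "j \<le> length w" for i j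
    using that by force
  obtain B where B: "B \<in> sets M" "measure M B > 0"
    "\<And>x k :: int. x \<in> B \<Longrightarrow> k \<noteq> 0 \<Longrightarrow> \<bar>k\<bar> \<le> int L \<Longrightarrow> ipow t k x \<noteq> x"
    by (rule infinite_order_imp_long_orbits[OF tMB, of L]) (erule inf, rule that)
  have Bs: "x \<in> space M" if "x \<in> B" for x using sets.sets_into_space[OF B(1)] that by (rule subsetD)
  have inj: "inj_on (\<lambda>j. z j x) {..length w}" if x: "x \<in> B" for x
  proof (rule inj_onI)
    fix i j assume ij: "i \<in> {..length w}" "j \<in> {..length w}" "z i x = z j x"
    then have "ipow t (h i - h j) x = x" using ipow_eq_iff[OF tMB Bs[OF x]] unfolding z_def by blast
    then have "h i - h j = 0" using B(3)[OF x, of "h i - h j"] L[of i j] ij(1,2) by auto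
    then show "i = j" using h(1) ij(1,2) by (simp add: inj_on_def)
  qed
  have "\<exists>A u'. A \<in> sets M \<and> A \<subseteq> B \<and> measure M A > 0 \<and> (\<forall>i<n. u' i \<in> FR \<and>
    neq_measure (u i) (u' i) < \<epsilon> \<and> (aperiodic (u i) \<longrightarrow> aperiodic (u' i)) \<and>
    (\<forall>x\<in>A. \<forall>j\<in>letter_positions w i. u' i (z (letter_src w j) x) = z (letter_tgt w j) x))"
    by (rule perturb_all[OF wr(1) B(1,2) z _ _ \<epsilon>]) (erule inj, erule u)
  then obtain A u' where A: "A \<in> sets M" "A \<subseteq> B" "measure M A > 0" and all: "\<forall>i<n. u' i \<in> FR \<and>
    neq_measure (u i) (u' i) < \<epsilon> \<and> (aperiodic (u i) \<longrightarrow> aperiodic (u' i)) \<and>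
    (\<forall>x\<in>A. \<forall>j\<in>letter_positions w i. u' i (z (letter_src w j) x) = z (letter_tgt w j) x)"
    by (elim exE conjE) (rule that)
  have u': "u' i \<in> FR" "neq_measure (u i) (u' i) < \<epsilon>" "aperiodic (u i) \<Longrightarrow> aperiodic (u' i)"
    "\<And>x j. x \<in> A \<Longrightarrow> j \<in> letter_positions w i \<Longrightarrow> u' i (z (letter_src w j) x) = z (letter_tgt w j) x"
    if "i < n" for i
    using all that by simp_all
  define g where "g s = (if s < n then u' s else t)" for s
  have g: "g s \<in> MB" for s unfolding g_def using u'(1) FR_MB tMB by simp
  have W: "word_val (mp_bij M) g w \<in> MB"
    using g wr(2) by (intro G.word_val_closed[where S = "{..<n + 1}"]) auto
  have path: "word_val (mp_bij M) g w (z (length w) x) = z 0 x" if x: "x \<in> A" for x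
  proof (rule word_val_path[where S = "{..<n + 1}"])
    have xs: "x \<in> space M" using x A(2) Bs by blast
    show "z j x \<in> space M" for j using FR_MB[OF z] xs by (rule MB_space)
    show "g s (z (letter_src w j) x) = z (letter_tgt w j) x"
      if "s \<in> {..<n + 1}" "j \<in> letter_positions w s" for s j
    proof (cases "s < n")
      case True
      then show ?thesis using u'(4)[OF True x that(2)] by (simp add: g_def)
    next
      case False
      then have "s = n" using that(1) by simp
      then show ?thesis
        using ipow_add_apply[OF tMB xs, of 1 "h (letter_src w j)"] h(2)[of j] that(2) tMB
        by (simp add: g_def z_def add.commute)
    qed
  qed (use g wr(2) in simp_all)
  have "cls (word_val (mp_bij M) g w) \<noteq> \<one>\<^bsub>mp_aut M\<^esub>"
  proof
    assume "cls (word_val (mp_bij M) g w) = \<one>\<^bsub>mp_aut M\<^esub>"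
    then have "cls (word_val (mp_bij M) g w) = cls ident" using cls.hom_one by simp
    then have "AE x in M. word_val (mp_bij M) g w x = ident x" using cls_eq_iff[OF W G.one_closed] by simp
    \<comment> \<open>The word is evaluated at the starting points \<open>z (length w) x\<close>, a
      substitution under which almost everywhere statements survive.\<close>
    from AE_mp_bij[OF FR_MB[OF z[of "length w"]] this]
    have "AE x in M. x \<notin> A"
      using AE_space
    proof eventually_elim
      case (elim x)
      show ?case
      proof
        assume x: "x \<in> A"
        have "z 0 x = z (length w) x"
          using elim path[OF x] MB_space[OF FR_MB[OF z] elim(2)] by (simp add: ident_apply)
        moreover have "x \<in> B" using x A(2) by blast
        ultimately have "0 = length w" using inj[of x] unfolding inj_on_def by auto
        then show False using w(2) by simp
      qed
    qed
    then have "measure M A = 0" using A(1) by (simp add: prob_eq_0)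
    then show False using A(3) by simp
  qed
  moreover have "cls (word_val (mp_bij M) g w) = word_val (mp_aut M) (\<lambda>s. cls (g s)) w"
    by (rule cls.word_val_hom_image[OF _ wr(2)]) (rule g)
  moreover have "(\<lambda>s. cls (g s)) = (\<lambda>s. if s < n then cls (u' s) else cls t)"
    by (intro ext) (simp add: g_def)
  ultimately have "word_val (mp_aut M) (\<lambda>s. if s < n then cls (u' s) else cls t) w \<noteq> \<one>\<^bsub>mp_aut M\<^esub>"
    by simp
  then show thesis using that u'(1-3) by blast
qed

end

section \<open>Baire category\<close>

context standard_pmp
begin

section \<open>Continuity of word maps and the Baire argument\<close>

lemma continuous_map_mult:
  assumes f: "continuous_map X D.mtopology f" and g: "continuous_map X D.mtopology g"
  shows "continuous_map X D.mtopology (\<lambda>x. f x \<otimes>\<^bsub>mp_aut M\<^esub> g x)"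
  unfolding D.continuous_map_to_metric
proof (intro ballI allI impI)
  fix x and \<epsilon> :: real assume x: "x \<in> topspace X" and "\<epsilon> > 0"
  then have e: "\<epsilon> / 2 > 0" by simp
  obtain U where U: "openin X U" "x \<in> U" "\<forall>y\<in>U. f y \<in> D.mball (f x) (\<epsilon> / 2)"
    using f[unfolded D.continuous_map_to_metric, rule_format, OF x e] by blast
  obtain V where V: "openin X V" "x \<in> V" "\<forall>y\<in>V. g y \<in> D.mball (g x) (\<epsilon> / 2)"
    using g[unfolded D.continuous_map_to_metric, rule_format, OF x e] by blast
  have "f y \<otimes>\<^bsub>mp_aut M\<^esub> g y \<in> D.mball (f x \<otimes>\<^bsub>mp_aut M\<^esub> g x) \<epsilon>" if "y \<in> U \<inter> V" for y
  proof -
    have "f x \<in> carrier (mp_aut M)" "f y \<in> carrier (mp_aut M)" "dist_u M (f x) (f y) < \<epsilon> / 2"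
      "g x \<in> carrier (mp_aut M)" "g y \<in> carrier (mp_aut M)" "dist_u M (g x) (g y) < \<epsilon> / 2"
      using U(3) V(3) that unfolding D.in_mball by blast+
    then show ?thesis using dist_u_mult[of "f x" "g x" "f y" "g y"] by (simp add: D.in_mball)
  qed
  then show "\<exists>U. openin X U \<and> x \<in> U \<and> (\<forall>y\<in>U. f y \<otimes>\<^bsub>mp_aut M\<^esub> g y \<in> D.mball (f x \<otimes>\<^bsub>mp_aut M\<^esub> g x) \<epsilon>)"
    using U V by (intro exI[of _ "U \<inter> V"]) auto
qed

lemma continuous_map_inv:
  assumes f: "continuous_map X D.mtopology f"
  shows "continuous_map X D.mtopology (\<lambda>x. inv\<^bsub>mp_aut M\<^esub> (f x))"
  unfolding D.continuous_map_to_metric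
proof (intro ballI allI impI)
  fix x and \<epsilon> :: real assume x: "x \<in> topspace X" and e: "\<epsilon> > 0"
  obtain U where U: "openin X U" "x \<in> U" "\<forall>y\<in>U. f y \<in> D.mball (f x) \<epsilon>"
    using f[unfolded D.continuous_map_to_metric, rule_format, OF x e] by blast
  have "\<forall>y\<in>U. inv\<^bsub>mp_aut M\<^esub> (f y) \<in> D.mball (inv\<^bsub>mp_aut M\<^esub> (f x)) \<epsilon>"
    using U(3) by (simp add: D.in_mball dist_u_inv)
  then show "\<exists>U. openin X U \<and> x \<in> U \<and> (\<forall>y\<in>U. inv\<^bsub>mp_aut M\<^esub> (f y) \<in> D.mball (inv\<^bsub>mp_aut M\<^esub> (f x)) \<epsilon>)"
    using U(1,2) by blast
qed

lemma continuous_map_word_val: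
  assumes g: "\<And>s. s \<in> S \<Longrightarrow> continuous_map X D.mtopology (\<lambda>x. g x s)" and "set w \<subseteq> S \<times> UNIV"
  shows "continuous_map X D.mtopology (\<lambda>x. word_val (mp_aut M) (g x) w)"
  using assms(2)
proof (induction w)
  case Nil
  then show ?case by simp
next
  case (Cons a w)
  then have a: "fst a \<in> S" and w: "set w \<subseteq> S \<times> UNIV" by auto
  have "continuous_map X D.mtopology (\<lambda>x. letter_val (mp_aut M) (g x) a)"
    using g[OF a] continuous_map_inv[OF g[OF a]] by (cases "snd a") (simp_all add: letter_val_def)
  then show ?case using continuous_map_mult Cons.IH[OF w] by simp
qed

text \<open>Stated for an arbitrary closed set \<open>\<A>\<close>, so that the full group and its
  aperiodic part are treated at once; the density of each word condition enters as
  \<open>perturb\<close>.\<close>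

lemma dense_gdelta_free_tuples:
  fixes n :: nat
  assumes \<A>: "closedin D.mtopology \<A>" and T: "T \<in> carrier (mp_aut M)"
    and perturb: "\<And>w U \<epsilon>. w \<in> carrier (free_group {..<n + 1}) \<Longrightarrow> w \<noteq> [] \<Longrightarrow> \<forall>i<n. U i \<in> \<A> \<Longrightarrow> \<epsilon> > 0 \<Longrightarrow>
      \<exists>U'. (\<forall>i<n. U' i \<in> \<A> \<and> dist_u M (U i) (U' i) < \<epsilon>) \<and>
        word_val (mp_aut M) (\<lambda>s. if s < n then U' s else T) w \<noteq> \<one>\<^bsub>mp_aut M\<^esub>"
  shows "dense_gdelta_in (tuple_topology M \<A> n) {U \<in> {..<n} \<rightarrow>\<^sub>E \<A>. U \<in> free_tuples M T n}"
proof -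
  let ?X = "tuple_topology M \<A> n"
  define gen where "gen U s = (if s < n then U s else T)" for U :: "nat \<Rightarrow> ('a \<Rightarrow> 'a) set" and s
  define W where "W = {w \<in> carrier (free_group {..<n + 1}). w \<noteq> []}"
  define Ow where "Ow w = {U \<in> topspace ?X. word_val (mp_aut M) (gen U) w \<in> carrier (mp_aut M) - {\<one>\<^bsub>mp_aut M\<^esub>}}" for w
  have \<A>c: "\<A> \<subseteq> carrier (mp_aut M)" using closedin_subset[OF \<A>] by simp
  have X: "?X = product_topology (\<lambda>_. subtopology D.mtopology \<A>) {..<n}"
    by (simp add: tuple_topology_def uniform_topology_eq)
  have topX: "topspace ?X = {..<n} \<rightarrow>\<^sub>E \<A>"
    using \<A>c by (simp add: X Int_absorb1)
  have Wc: "countable W" unfolding W_def by simp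
  \<comment> \<open>Ensures that the intersection is not over the empty family; 0 is a generator
    even for \<open>n = 0\<close>.\<close>
  have "[(0, True)] \<in> W" by (simp add: W_def free_group_def reduced_def)
  then have Wn: "Ow ` W \<noteq> {}" by blast
  have Wset: "set w \<subseteq> {..<n + 1} \<times> UNIV" if "w \<in> W" for w
    using that by (simp add: W_def free_group_def)
  have genc: "gen U \<in> {..<n + 1} \<rightarrow> carrier (mp_aut M)" if "U \<in> topspace ?X" for U
  proof
    fix s
    show "gen U s \<in> carrier (mp_aut M)"
    proof (cases "s < n")
      case True
      then have "U s \<in> \<A>" using that unfolding topX by (auto simp: PiE_iff)
      then show ?thesis using \<A>c True by (auto simp: gen_def)
    qed (use T in \<open>simp add: gen_def\<close>)
  qed
  have "continuous_map ?X D.mtopology (\<lambda>U. gen U s)" for s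
  proof (cases "s < n")
    case True
    have "continuous_map ?X (subtopology D.mtopology \<A>) (\<lambda>U. U s)"
      unfolding X using True by (intro continuous_map_product_projection) simp
    then show ?thesis using True by (simp add: gen_def continuous_map_in_subtopology)
  next
    case False
    then show ?thesis using T by (simp add: gen_def)
  qed
  then have cont: "continuous_map ?X D.mtopology (\<lambda>U. word_val (mp_aut M) (gen U) w)" if "w \<in> W" for w
    by (rule continuous_map_word_val[OF _ Wset[OF that]])
  have "closedin D.mtopology {\<one>\<^bsub>mp_aut M\<^esub>}"
    using D.Hausdorff_space_mtopology by (simp add: closedin_Hausdorff_sing_eq)
  then have op1: "openin D.mtopology (carrier (mp_aut M) - {\<one>\<^bsub>mp_aut M\<^esub>})"
    by (intro openin_diff) simp_all
  have Oop: "openin ?X (Ow w)" if "w \<in> W" for w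
    unfolding Ow_def by (rule openin_continuous_map_preimage[OF cont[OF that] op1])
  have Odense: "?X closure_of (Ow w) = topspace ?X" if w: "w \<in> W" for w
    unfolding dense_intersects_open
  proof (intro allI impI, elim conjE)
    fix V assume V: "openin ?X V" "V \<noteq> {}"
    then obtain U where U: "U \<in> V" by blast
    have UX: "U \<in> topspace ?X" using openin_subset[OF V(1)] U by (rule subsetD)
    obtain Vi where Vi: "\<forall>i\<in>{..<n}. openin (subtopology D.mtopology \<A>) (Vi i)"
      "U \<in> PiE {..<n} Vi" "PiE {..<n} Vi \<subseteq> V"
      using bspec[OF V(1)[unfolded X openin_product_topology_alt] U] by (elim exE conjE) (rule that)
    have "\<exists>r>0. \<forall>H\<in>\<A>. dist_u M (U i) H < r \<longrightarrow> H \<in> Vi i" if i: "i < n" for i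
    proof -
      obtain G where G: "openin D.mtopology G" "Vi i = G \<inter> \<A>"
        using Vi(1) i unfolding openin_subtopology by blast
      have "U i \<in> G" using PiE_mem[OF Vi(2)] i G(2) by blast
      then obtain r where r: "r > 0" "D.mball (U i) r \<subseteq> G"
        using G(1) unfolding D.openin_mtopology by blast
      have "U i \<in> carrier (mp_aut M)" using \<open>U i \<in> G\<close> G(1) unfolding D.openin_mtopology by blast
      then have "H \<in> Vi i" if "H \<in> \<A>" "dist_u M (U i) H < r" for H
        using that r(2) \<A>c unfolding G(2) by (auto simp: D.in_mball subset_iff)
      then show ?thesis using r(1) by blast
    qed
    then obtain r where r: "\<And>i. i < n \<Longrightarrow> r i > 0 \<and> (\<forall>H\<in>\<A>. dist_u M (U i) H < r i \<longrightarrow> H \<in> Vi i)"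
      by metis
    \<comment> \<open>The 1 is there for \<open>n = 0\<close>, when there are no radii to take the
      minimum of.\<close>
    define \<epsilon> :: real where "\<epsilon> = Min (insert 1 (r ` {..<n}))"
    have \<epsilon>: "\<epsilon> > 0" using r by (simp add: \<epsilon>_def)
    have \<epsilon>r: "\<epsilon> \<le> r i" if "i < n" for i unfolding \<epsilon>_def using that by (intro Min_le) auto
    have "\<forall>i<n. U i \<in> \<A>" using UX unfolding topX by (auto simp: PiE_iff)
    moreover have "w \<in> carrier (free_group {..<n + 1})" "w \<noteq> []" using w by (simp_all add: W_def)
    ultimately obtain U' where U': "\<forall>i<n. U' i \<in> \<A> \<and> dist_u M (U i) (U' i) < \<epsilon>"
      "word_val (mp_aut M) (\<lambda>s. if s < n then U' s else T) w \<noteq> \<one>\<^bsub>mp_aut M\<^esub>"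
      using perturb[of w U \<epsilon>] \<epsilon> by blast
    \<comment> \<open>Points of the product are extensional functions.\<close>
    let ?U = "restrict U' {..<n}"
    have "?U i \<in> Vi i" if "i < n" for i
    proof -
      have "U' i \<in> \<A>" "dist_u M (U i) (U' i) < r i" using U'(1) \<epsilon>r[OF that] that by force+
      then show ?thesis using r[OF that] that by simp
    qed
    then have "?U \<in> PiE {..<n} Vi" by simp
    then have UV: "?U \<in> V" using Vi(3) by (rule rev_subsetD)
    have UX': "?U \<in> topspace ?X" using openin_subset[OF V(1)] UV by (rule subsetD)
    have "gen ?U = (\<lambda>s. if s < n then U' s else T)" by (intro ext) (simp add: gen_def)
    then have "word_val (mp_aut M) (gen ?U) w \<noteq> \<one>\<^bsub>mp_aut M\<^esub>" using U'(2) by simp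
    moreover have "word_val (mp_aut M) (gen ?U) w \<in> carrier (mp_aut M)"
      by (rule A.word_val_closed[OF genc[OF UX'] Wset[OF w]])
    ultimately have "?U \<in> Ow w" using UX' by (simp add: Ow_def)
    then show "Ow w \<inter> V \<noteq> {}" using UV by blast
  qed
  have mem: "U \<in> free_tuples M T n \<longleftrightarrow> (\<forall>w\<in>W. U \<in> Ow w)" if U: "U \<in> topspace ?X" for U
  proof -
    have im: "gen U ` {..<n + 1} = insert T (U ` {..<n})"
    proof -
      have "{..<n + 1} = insert n {..<n}" by auto
      moreover have "gen U ` {..<n} = U ` {..<n}" by (intro image_cong) (simp_all add: gen_def)
      moreover have "gen U n = T" by (simp add: gen_def)
      ultimately show ?thesis by (simp only: image_insert)
    qed
    have "U \<in> free_tuples M T n \<longleftrightarrow>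
      subgroup_generated (mp_aut M) (gen U ` {..<n + 1}) \<cong> free_group {..<n + 1}"
      unfolding free_tuples_def im by simp
    also have "\<dots> \<longleftrightarrow> (\<forall>w\<in>W. word_val (mp_aut M) (gen U) w \<noteq> \<one>\<^bsub>mp_aut M\<^esub>)"
      unfolding A.subgroup_generated_iso_free_group_iff[OF finite_lessThan genc[OF U]] W_def by blast
    also have "\<dots> \<longleftrightarrow> (\<forall>w\<in>W. U \<in> Ow w)"
      using U A.word_val_closed[OF genc[OF U] Wset] by (simp add: Ow_def)
    finally show ?thesis .
  qed
  have eq: "{U \<in> {..<n} \<rightarrow>\<^sub>E \<A>. U \<in> free_tuples M T n} = \<Inter>(Ow ` W)"
  proof (intro Set.set_eqI iffI)
    fix U assume "U \<in> {U \<in> {..<n} \<rightarrow>\<^sub>E \<A>. U \<in> free_tuples M T n}"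
    then show "U \<in> \<Inter>(Ow ` W)" using mem[of U] topX by simp
  next
    fix U assume U: "U \<in> \<Inter>(Ow ` W)"
    then have "U \<in> topspace ?X" using Wn unfolding Ow_def by blast
    then show "U \<in> {U \<in> {..<n} \<rightarrow>\<^sub>E \<A>. U \<in> free_tuples M T n}" using mem[of U] topX U by simp
  qed
  \<comment> \<open>A closed subspace of a complete metric space is completely metrizable, and so is
    a product over a countable index set.\<close>
  have "completely_metrizable_space (subtopology D.mtopology \<A>)"
    using completely_metrizable_space_closedin[OF D.completely_metrizable_space_mtopology[OF mcomplete_mp_aut] \<A>] .
  then have "completely_metrizable_space ?X"
    unfolding X completely_metrizable_space_product_topology
    by (intro disjI2 conjI ballI) (auto intro: countable_subset[of _ "{..<n}"])
  then have "?X closure_of \<Inter>(Ow ` W) = topspace ?X"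
    using Wc Oop Odense by (intro Baire_category) auto
  moreover have "gdelta_in ?X (\<Inter>(Ow ` W))"
    using Wc Wn Oop by (intro gdelta_in_Inter) (auto intro: open_imp_gdelta_in)
  ultimately show ?thesis unfolding dense_gdelta_in_def eq by blast
qed

end

context pmp_relation
begin

section \<open>Specialisation to the full group and its aperiodic part\<close>

text \<open>Aperiodicity is preserved coordinate by coordinate, so that one statement yields the
  hypothesis \<open>perturb\<close> for both choices of \<open>\<A>\<close>.\<close>

lemma perturb_full_group:
  fixes n :: nat
  assumes T: "T \<in> full_group M R"
    and inf: "\<forall>k :: nat. k > 0 \<longrightarrow> T [^]\<^bsub>mp_aut M\<^esub> k \<noteq> \<one>\<^bsub>mp_aut M\<^esub>"
    and w: "w \<in> carrier (free_group {..<n + 1})" "w \<noteq> []"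
    and U: "\<forall>i<n. U i \<in> full_group M R" and \<epsilon>: "\<epsilon> > 0"
  shows "\<exists>U'. (\<forall>i<n. U' i \<in> full_group M R \<and> dist_u M (U i) (U' i) < \<epsilon> \<and>
      (U i \<in> APER M \<longrightarrow> U' i \<in> APER M)) \<and>
      word_val (mp_aut M) (\<lambda>s. if s < n then U' s else T) w \<noteq> \<one>\<^bsub>mp_aut M\<^esub>"
proof -
  have ex: "\<exists>f. f \<in> FR \<and> F = cls f" if F: "F \<in> full_group M R" for F
  proof -
    obtain f where "F = cls f" "f \<in> FR" by (rule imageE[OF F[unfolded full_group_eq]])
    then show ?thesis by (intro exI[of _ f] conjI)
  qed
  obtain t where t: "t \<in> FR" "T = cls t" using ex[OF T] by (elim exE conjE) (rule that)
  have "\<forall>i. \<exists>f. i < n \<longrightarrow> f \<in> FR \<and> U i = cls f"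
  proof
    fix i
    show "\<exists>f. i < n \<longrightarrow> f \<in> FR \<and> U i = cls f"
    proof (cases "i < n")
      case True
      then have "U i \<in> full_group M R" using U by simp
      from ex[OF this] show ?thesis by (elim exE) (rule exI, rule impI)
    qed simp
  qed
  then obtain u where "\<forall>i. i < n \<longrightarrow> u i \<in> FR \<and> U i = cls (u i)" by (rule choice[THEN exE])
  then have u: "u i \<in> FR" "U i = cls (u i)" if "i < n" for i using that by simp_all
  have inf': "cls t [^]\<^bsub>mp_aut M\<^esub> k \<noteq> \<one>\<^bsub>mp_aut M\<^esub>" if "k > 0" for k :: nat
    using inf that t(2) by simp
  obtain u' where u': "\<And>i. i < n \<Longrightarrow> u' i \<in> FR" "\<And>i. i < n \<Longrightarrow> neq_measure (u i) (u' i) < \<epsilon>"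
    "\<And>i. i < n \<Longrightarrow> aperiodic (u i) \<Longrightarrow> aperiodic (u' i)"
    "word_val (mp_aut M) (\<lambda>s. if s < n then cls (u' s) else cls t) w \<noteq> \<one>\<^bsub>mp_aut M\<^esub>"
    by (rule density_step[OF t(1) _ w _ \<epsilon>, of u]) (erule inf', erule u(1), rule that)
  show ?thesis
  proof (intro exI[of _ "\<lambda>i. cls (u' i)"] conjI allI impI)
    fix i assume i: "i < n"
    have MB: "u i \<in> MB" "u' i \<in> MB" using FR_MB[OF u(1)[OF i]] FR_MB[OF u'(1)[OF i]] .
    show "cls (u' i) \<in> full_group M R" using u'(1)[OF i] MB by (simp add: cls_in_full_group_iff)
    show "dist_u M (U i) (cls (u' i)) < \<epsilon>" using u'(2)[OF i] MB u(2)[OF i] by (simp add: dist_u_cls)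
    show "cls (u' i) \<in> APER M" if "U i \<in> APER M"
      using u'(3)[OF i] that MB u(2)[OF i] by (simp add: cls_in_APER_iff)
  next
    show "word_val (mp_aut M) (\<lambda>s. if s < n then cls (u' s) else T) w \<noteq> \<one>\<^bsub>mp_aut M\<^esub>"
      unfolding t(2) by (rule u'(4))
  qed
qed

end

theorem theorem1p6:
  fixes M :: "'a measure" and R :: "('a \<times> 'a) set" and T :: "('a \<Rightarrow> 'a) set" and n :: nat
  assumes "standard_prob_space M"
    and "pmp_equiv M R"
    and "T \<in> full_group M R"
    and "\<And>k :: nat. k > 0 \<Longrightarrow> T [^]\<^bsub>mp_aut M\<^esub> k \<noteq> \<one>\<^bsub>mp_aut M\<^esub>"
  shows "dense_gdelta_in (tuple_topology M (full_group M R) n)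
           {U \<in> {..<n} \<rightarrow>\<^sub>E full_group M R. U \<in> free_tuples M T n} \<and>
         (aperiodic_rel M R \<longrightarrow>
           dense_gdelta_in (tuple_topology M (full_group M R \<inter> APER M) n)
             {U \<in> {..<n} \<rightarrow>\<^sub>E (full_group M R \<inter> APER M). U \<in> free_tuples M T n})"
proof -
  interpret pmp_relation M R
    using assms(1,2) by (simp add: pmp_relation_def standard_pmp_def pmp_relation_axioms_def)
  have T: "T \<in> carrier (mp_aut M)" using full_group_subset assms(3) by (rule subsetD)
  have "\<forall>k :: nat. k > 0 \<longrightarrow> T [^]\<^bsub>mp_aut M\<^esub> k \<noteq> \<one>\<^bsub>mp_aut M\<^esub>" using assms(4) by simp
  note perturb = perturb_full_group[OF assms(3) this]
  show ?thesis
  proof (intro conjI impI)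
    show "dense_gdelta_in (tuple_topology M (full_group M R) n)
           {U \<in> {..<n} \<rightarrow>\<^sub>E full_group M R. U \<in> free_tuples M T n}"
    proof (rule dense_gdelta_free_tuples[OF closedin_full_group T], goal_cases)
      case (1 w U \<epsilon>)
      from perturb[OF 1] show ?case by blast
    qed
    show "dense_gdelta_in (tuple_topology M (full_group M R \<inter> APER M) n)
             {U \<in> {..<n} \<rightarrow>\<^sub>E (full_group M R \<inter> APER M). U \<in> free_tuples M T n}"
    proof (rule dense_gdelta_free_tuples[OF closedin_Int[OF closedin_full_group closedin_APER] T], goal_cases)
      case (1 w U \<epsilon>)
      then have U: "\<forall>i<n. U i \<in> full_group M R" "\<forall>i<n. U i \<in> APER M" by simp_all
      obtain U' where U': "\<forall>i<n. U' i \<in> full_group M R \<and> dist_u M (U i) (U' i) < \<epsilon> \<and>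
          (U i \<in> APER M \<longrightarrow> U' i \<in> APER M)"
        "word_val (mp_aut M) (\<lambda>s. if s < n then U' s else T) w \<noteq> \<one>\<^bsub>mp_aut M\<^esub>"
        using perturb[OF 1(1,2) U(1) 1(4)] by (elim exE conjE) (rule that)
      then have "\<forall>i<n. U' i \<in> full_group M R \<inter> APER M \<and> dist_u M (U i) (U' i) < \<epsilon>"
        using U(2) by simp
      then show ?case using U'(2) by (intro exI[of _ U'] conjI)
    qed
  qed
qed

end
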